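(* Let $A:[0,1]\to\mathbb{R}^{n\times n}$ and $B:[0,1]\to\mathbb{R}^{n\times m}$ be continuous and suppose that the pair $(A,B)$ is controllable. Let $\mu_0(dx)=\rho_0(x)dx$ and $\mu_1(dx)=\rho_1(x)dx$ be two probability measures on $\mathbb{R}^n$ with finite second moment. For $\epsilon>0$ let $\mathcal{P}_{01}^\epsilon$ be the solution of the Schrödinger problem with reference Markov process $$dx(t)=A(t)x(t)dt+\sqrt{\epsilon}\,B(t)dw(t)$$ ($w$ a standard Wiener process) and marginals $\mu_0,\mu_1$, and let $\mathcal{P}_t^\epsilon$, $t\in[0,1]$, be the corresponding entropic interpolation. Let $\pi$ be the solution of $$\inf_{\pi}\int_{\mathbb{R}^n\times\mathbb{R}^n}\tfrac12(y-\Phi_{10}x)'M_{10}^{-1}(y-\Phi_{10}x)\,d\pi(x,y)$$ over probability measures $\pi$ on $\mathbb{R}^n\times\mathbb{R}^n$ with marginals $\mu_0$ and $\mu_1$, and let $\mu_t$, $t\in[0,1]$, be the corresponding displacement interpolation with prior dynamics. Then, as $\epsilon\to0$, $\mathcal{P}_{01}^\epsilon$ converges weakly to $\pi$, and $\mathcal{P}_t^\epsilon$ converges weakly to $\mu_t$ for each $t\in[0,1]$.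
   Context: Prime denotes transpose. $\Phi(t,s)$ is the state transition matrix of $\dot x=A(t)x$ ($\partial_t\Phi(t,s)=A(t)\Phi(t,s)$, $\Phi(s,s)=I$); for $s<t$, $M(t,s)=\int_s^t\Phi(t,\tau)B(\tau)B(\tau)'\Phi(t,\tau)'d\tau$, and $M(t,t)=0$; $\Phi_{10}=\Phi(1,0)$, $M_{10}=M(1,0)$. Controllability means that $M(t,s)$ is invertible for all $0\le s<t\le1$. Schrödinger problem: let $q^\epsilon(s,x,t,y)$ be the transition density of the reference process, $$q^\epsilon(s,x,t,y)=(2\pi\epsilon)^{-n/2}\det(M(t,s))^{-1/2}\exp\Big(-\tfrac1{2\epsilon}(y-\Phi(t,s)x)'M(t,s)^{-1}(y-\Phi(t,s)x)\Big).$$ It is known (Jamison) that there is a pair of $\sigma$-finite measures $(\hat\varphi_0(x)dx,\varphi_1(x)dx)$ on $\mathbb{R}^n$ (depending on $\epsilon$, and unique up to reciprocal constant factors) such that the measure $$\mathcal{P}^\epsilon_{01}(E)=\int_E q^\epsilon(0,x,1,y)\hat\varphi_0(x)\varphi_1(y)\,dx\,dy$$ on $\mathbb{R}^n\times\mathbb{R}^n$ has marginals $\mu_0$ and $\mu_1$. This $\mathcal{P}_{01}^\epsilon$ is the solution of the Schrödinger problem. The entropic interpolation is $\mathcal{P}^\epsilon_t(dx)=\varphi(t,x)\hat\varphi(t,x)dx$ with $\varphi(t,x)=\int q^\epsilon(t,x,1,y)\varphi_1(y)dy$ and $\hat\varphi(t,x)=\int q^\epsilon(0,y,t,x)\hat\varphi_0(y)dy$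 for $0<t<1$, and $\mathcal{P}^\epsilon_0=\mu_0$, $\mathcal{P}^\epsilon_1=\mu_1$. Displacement interpolation with prior dynamics: the optimal $\pi$ is unique and concentrated on the graph of a map $T:\mathbb{R}^n\to\mathbb{R}^n$; then $\mu_t=(T_t)_\sharp\mu_0$ (push-forward), where $$T_t(x)=\Phi(t,1)M(1,t)M_{10}^{-1}\Phi_{10}x+M(t,0)\Phi(1,t)'M_{10}^{-1}T(x).$$ Weak convergence of probability measures means convergence of integrals of every bounded continuous function. *)

theory Defs
  imports "HOL-Probability.Probability"
begin

text \<open>All matrix functions are only ever constrained and used for times in \<open>[0,1]\<close>; there the
  following predicate determines \<open>\<Phi>\<close> uniquely.\<close>

definition state_transition ::
    "(real \<Rightarrow> real^'n^'n) \<Rightarrow> (real \<Rightarrow> real \<Rightarrow> real^'n^'n) \<Rightarrow> bool" where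
  "state_transition A \<Phi> \<longleftrightarrow>
     (\<forall>s\<in>{0..1}. \<Phi> s s = mat 1 \<and>
       (\<forall>t\<in>{0..1}. ((\<lambda>r. \<Phi> r s) has_vector_derivative (A t ** \<Phi> t s)) (at t within {0..1})))"

definition gramian ::
    "(real \<Rightarrow> real \<Rightarrow> real^'n^'n) \<Rightarrow> (real \<Rightarrow> real^'m^'n) \<Rightarrow> real \<Rightarrow> real \<Rightarrow> real^'n^'n" where
  "gramian \<Phi> B t s =
     integral {s..t} (\<lambda>r. \<Phi> t r ** B r ** transpose (B r) ** transpose (\<Phi> t r))"

lemma gramian_refl [simp]: "gramian \<Phi> B t t = 0"
  by (simp add: gramian_def)

definition controllable ::
    "(real \<Rightarrow> real \<Rightarrow> real^'n^'n) \<Rightarrow> (real \<Rightarrow> real^'m^'n) \<Rightarrow> bool" where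
  "controllable \<Phi> B \<longleftrightarrow> (\<forall>s t. 0 \<le> s \<and> s < t \<and> t \<le> 1 \<longrightarrow> invertible (gramian \<Phi> B t s))"

text \<open>The transition density of \<open>dx = A x dt + sqrt \<epsilon> B dw\<close>: given \<open>x(s) = x\<close>, the law of \<open>x(t)\<close> is
  Gaussian with mean \<open>\<Phi>(t,s) x\<close> and covariance \<open>\<epsilon> M(t,s)\<close>.\<close>

definition transition_density ::
    "(real \<Rightarrow> real \<Rightarrow> real^'n^'n) \<Rightarrow> (real \<Rightarrow> real^'m^'n) \<Rightarrow> real \<Rightarrow>
     real \<Rightarrow> real^'n \<Rightarrow> real \<Rightarrow> real^'n \<Rightarrow> real" where
  "transition_density \<Phi> B \<epsilon> s x t y =
     (2 * pi * \<epsilon>) powr (- real CARD('n) / 2) * det (gramian \<Phi> B t s) powr (- 1 / 2) *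
     exp (- (1 / (2 * \<epsilon>)) *
       ((y - \<Phi> t s *v x) \<bullet> (matrix_inv (gramian \<Phi> B t s) *v (y - \<Phi> t s *v x))))"

definition coupling ::
    "'a::topological_space measure \<Rightarrow> 'b::topological_space measure \<Rightarrow> ('a \<times> 'b) measure \<Rightarrow> bool"
    where
  "coupling \<mu> \<nu> \<pi> \<longleftrightarrow>
     prob_space \<pi> \<and> sets \<pi> = sets borel \<and> distr \<pi> borel fst = \<mu> \<and> distr \<pi> borel snd = \<nu>"

definition schrodinger_plan ::
    "(real \<Rightarrow> real \<Rightarrow> real^'n^'n) \<Rightarrow> (real \<Rightarrow> real^'m^'n) \<Rightarrow> real \<Rightarrow>
     (real^'n \<Rightarrow> ennreal) \<Rightarrow> (real^'n \<Rightarrow> ennreal) \<Rightarrow> ((real^'n) \<times> (real^'n)) measure" where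
  "schrodinger_plan \<Phi> B \<epsilon> \<phi>hat0 \<phi>1 =
     density lborel (\<lambda>(x, y). ennreal (transition_density \<Phi> B \<epsilon> 0 x 1 y) * \<phi>hat0 x * \<phi>1 y)"

definition schrodinger_pair ::
    "(real \<Rightarrow> real \<Rightarrow> real^'n^'n) \<Rightarrow> (real \<Rightarrow> real^'m^'n) \<Rightarrow> real \<Rightarrow>
     (real^'n) measure \<Rightarrow> (real^'n) measure \<Rightarrow>
     (real^'n \<Rightarrow> ennreal) \<Rightarrow> (real^'n \<Rightarrow> ennreal) \<Rightarrow> bool" where
  "schrodinger_pair \<Phi> B \<epsilon> \<mu>0 \<mu>1 \<phi>hat0 \<phi>1 \<longleftrightarrow>
     \<phi>hat0 \<in> borel_measurable borel \<and> \<phi>1 \<in> borel_measurable borel \<and>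
     sigma_finite_measure (density lborel \<phi>hat0) \<and> sigma_finite_measure (density lborel \<phi>1) \<and>
     coupling \<mu>0 \<mu>1 (schrodinger_plan \<Phi> B \<epsilon> \<phi>hat0 \<phi>1)"

text \<open>The two factors of the density are extended-valued: each may be infinite on a Lebesgue null
  set, which does not affect the measure.\<close>

definition entropic_interpolation ::
    "(real \<Rightarrow> real \<Rightarrow> real^'n^'n) \<Rightarrow> (real \<Rightarrow> real^'m^'n) \<Rightarrow> real \<Rightarrow>
     (real^'n) measure \<Rightarrow> (real^'n) measure \<Rightarrow>
     (real^'n \<Rightarrow> ennreal) \<Rightarrow> (real^'n \<Rightarrow> ennreal) \<Rightarrow> real \<Rightarrow> (real^'n) measure" where
  "entropic_interpolation \<Phi> B \<epsilon> \<mu>0 \<mu>1 \<phi>hat0 \<phi>1 t =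
     (if t = 0 then \<mu>0 else if t = 1 then \<mu>1
      else density lborel (\<lambda>x.
        (\<integral>\<^sup>+ y. ennreal (transition_density \<Phi> B \<epsilon> t x 1 y) * \<phi>1 y \<partial>lborel) *
        (\<integral>\<^sup>+ y. ennreal (transition_density \<Phi> B \<epsilon> 0 y t x) * \<phi>hat0 y \<partial>lborel)))"

definition transport_cost ::
    "(real \<Rightarrow> real \<Rightarrow> real^'n^'n) \<Rightarrow> (real \<Rightarrow> real^'m^'n) \<Rightarrow>
     ((real^'n) \<times> (real^'n)) measure \<Rightarrow> ennreal" where
  "transport_cost \<Phi> B \<pi> =
     (\<integral>\<^sup>+ (x, y). ennreal (1 / 2 *
       ((y - \<Phi> 1 0 *v x) \<bullet> (matrix_inv (gramian \<Phi> B 1 0) *v (y - \<Phi> 1 0 *v x)))) \<partial>\<pi>)"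

definition optimal_plan ::
    "(real \<Rightarrow> real \<Rightarrow> real^'n^'n) \<Rightarrow> (real \<Rightarrow> real^'m^'n) \<Rightarrow>
     (real^'n) measure \<Rightarrow> (real^'n) measure \<Rightarrow> ((real^'n) \<times> (real^'n)) measure \<Rightarrow> bool" where
  "optimal_plan \<Phi> B \<mu>0 \<mu>1 \<pi> \<longleftrightarrow>
     coupling \<mu>0 \<mu>1 \<pi> \<and>
     (\<forall>\<pi>'. coupling \<mu>0 \<mu>1 \<pi>' \<longrightarrow> transport_cost \<Phi> B \<pi> \<le> transport_cost \<Phi> B \<pi>')"

definition concentrated_on_graph ::
    "('a::topological_space \<times> 'b::topological_space) measure \<Rightarrow> ('a \<Rightarrow> 'b) \<Rightarrow> bool" where
  "concentrated_on_graph \<pi> T \<longleftrightarrow> T \<in> borel_measurable borel \<and> (AE p in \<pi>. snd p = T (fst p))"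

definition interpolation_map ::
    "(real \<Rightarrow> real \<Rightarrow> real^'n^'n) \<Rightarrow> (real \<Rightarrow> real^'m^'n) \<Rightarrow>
     (real^'n \<Rightarrow> real^'n) \<Rightarrow> real \<Rightarrow> real^'n \<Rightarrow> real^'n" where
  "interpolation_map \<Phi> B T t x =
     (\<Phi> t 1 ** gramian \<Phi> B 1 t ** matrix_inv (gramian \<Phi> B 1 0) ** \<Phi> 1 0) *v x +
     (gramian \<Phi> B t 0 ** transpose (\<Phi> 1 t) ** matrix_inv (gramian \<Phi> B 1 0)) *v T x"

definition displacement_interpolation ::
    "(real \<Rightarrow> real \<Rightarrow> real^'n^'n) \<Rightarrow> (real \<Rightarrow> real^'m^'n) \<Rightarrow>
     (real^'n) measure \<Rightarrow> (real^'n \<Rightarrow> real^'n) \<Rightarrow> real \<Rightarrow> (real^'n) measure" where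
  "displacement_interpolation \<Phi> B \<mu>0 T t = distr \<mu>0 borel (interpolation_map \<Phi> B T t)"

text \<open>The library's \<open>weak_conv_m\<close> is about sequences of measures on the real line, hence the
  general version.\<close>

definition weakly_converges ::
    "('i \<Rightarrow> 'a::topological_space measure) \<Rightarrow> 'a measure \<Rightarrow> 'i filter \<Rightarrow> bool" where
  "weakly_converges P \<mu> F \<longleftrightarrow>
     (\<forall>f::'a \<Rightarrow> real. continuous_on UNIV f \<and> bounded (range f) \<longrightarrow>
       ((\<lambda>i. \<integral>x. f x \<partial>(P i)) \<longlongrightarrow> (\<integral>x. f x \<partial>\<mu>)) F)"

end

theory Submission
  imports Defs
begin

text \<open>
  Up to one factor in \<open>x\<close> and one in \<open>y\<close>, the Schrodinger plan is the Gibbs measure of the transport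
  cost \<open>c(x,y) = 1/2 (y - \<Phi>(1,0) x)' M(1,0)\<^sup>-\<^sup>1 (y - \<Phi>(1,0) x)\<close>: its Lebesgue density is a constant times
  \<open>exp (- c(x,y) / \<epsilon>) \<phi>hat0(x) \<phi>1(y)\<close>. Everything about the limit of the plans is read off this form
  (and not off relative entropies, which can be infinite for these marginals).

  Take finitely many points \<open>(x i, y i)\<close> and small rectangles around the points \<open>(x i, y i)\<close> and
  around the cyclically shifted points \<open>(x (i + 1), y i)\<close>. In the product of the masses of either family
  the one-variable factors contribute the same quantity, so the ratio of the two products is about
  \<open>exp (- (\<Sum> c(x i, y i) - \<Sum> c(x (i + 1), y i)) / \<epsilon>)\<close>. If the difference of the sums were positive,
  the first product would tend to \<open>0\<close>. Therefore the support of every weak limit is \<open>c\<close>-cyclically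
  monotone (\<open>gibbs_limit_support_cyclically_monotone\<close>). Weak limits exist along subsequences, since the
  couplings of two fixed measures form a tight family (\<open>tight_imp_weakly_convergent_subsequence\<close>).

  Rockafellar's construction turns a cyclically monotone support into potentials \<open>u, v\<close> with
  \<open>u(x) + v(y) \<le> c(x,y)\<close> and equality on the support. Integrated against the limit and against
  the optimal plan \<open>\<pi>\<close>, whose cost is at most that of the limit, this forces equality \<open>\<pi>\<close>-almost everywhere
  too, so both couplings are carried by one closed set (\<open>cyclically_monotone_imp_common_contact_set\<close>).
  For a quadratic cost that set is monotone; along a line parallel to a coordinate axis
  the corresponding coordinate of its (linearly transformed) values is ambiguous at countably many points only, so it is a graph over Lebesgue-almost every
  \<open>x\<close> (\<open>closed_monotone_single_valued_AE\<close>). As \<open>\<mu>0\<close> has a density, the limit is \<open>\<pi>\<close>, along every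
  subsequence (\<open>gibbs_couplings_converge_to_optimal\<close>).

  For the interpolations, completing the square in \<open>q(0,x,t,z) q(t,z,1,y)\<close> as a function of \<open>z\<close> gives
  \<open>q(0,x,1,y)\<close> times a centred Gaussian density, with covariance proportional to \<open>\<epsilon>\<close> and
  independent of \<open>x\<close> and \<open>y\<close>, evaluated at \<open>z - m(x,y)\<close> (\<open>transition_density_bridge\<close>). Hence the entropic
  interpolation at time \<open>t\<close> is the law of \<open>m(x,y)\<close> plus an independent noise that vanishes with \<open>\<epsilon>\<close>
  (\<open>entropic_interpolation_eq_noisy_bridge\<close>, \<open>weakly_converges_add_vanishing_noise\<close>). Since
  \<open>m(x, T x)\<close> is the interpolation map (\<open>interpolation_map_eq_bridge_mean\<close>), its limit is the displacement
  interpolation. The Gaussian densities are normalised by a linear change of variables, and the facts on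
  \<open>\<Phi>\<close> and \<open>M\<close> that enter are the cocycle identity, positive definiteness and the
  decomposition of \<open>M(1,0)\<close> at time \<open>t\<close> (\<open>gramian_split\<close>).
\<close>

section \<open>Weak convergence and bounded continuous functions\<close>

text \<open>
  Continuous functions decreasing to the indicator of a nonempty closed set \<open>C\<close>: they give access
  to the measure of closed sets through integrals of bounded continuous functions.
\<close>

definition closed_cutoff :: "'a::metric_space set \<Rightarrow> nat \<Rightarrow> 'a \<Rightarrow> real" where
  "closed_cutoff C n x = max 0 (1 - real n * infdist x C)"

lemma closed_cutoff_continuous: "continuous_on UNIV (closed_cutoff C n)"
  unfolding closed_cutoff_def by (intro continuous_intros)

lemma closed_cutoff_measurable [measurable]: "closed_cutoff C n \<in> borel_measurable borel"
  by (intro borel_measurable_continuous_onI closed_cutoff_continuous)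

lemma closed_cutoff_bounds: "0 \<le> closed_cutoff C n x" "closed_cutoff C n x \<le> 1"
  unfolding closed_cutoff_def by (auto simp: infdist_nonneg)

lemma closed_cutoff_bounded: "bounded (range (closed_cutoff C n))"
  by (rule boundedI[where B=1]) (auto simp: closed_cutoff_bounds)

lemma closed_cutoff_eq_1: "x \<in> C \<Longrightarrow> closed_cutoff C n x = 1"
  unfolding closed_cutoff_def by simp

lemma closed_cutoff_tendsto:
  assumes "closed C" "C \<noteq> {}"
  shows "(\<lambda>n. closed_cutoff C n x) \<longlonglongrightarrow> indicator C x"
proof (cases "x \<in> C")
  case True
  then show ?thesis by (simp add: closed_cutoff_eq_1)
next
  case False
  then have d: "0 < infdist x C"
    using assms by (metis in_closed_iff_infdist_zero infdist_nonneg less_eq_real_def)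
  obtain N :: nat where N: "1 < real N * infdist x C"
    using reals_Archimedean3[OF d] by blast
  have "closed_cutoff C n x = 0" if "n \<ge> N" for n
  proof -
    have "real N * infdist x C \<le> real n * infdist x C"
      using that d by (intro mult_right_mono) auto
    then show ?thesis using N unfolding closed_cutoff_def by auto
  qed
  then have "eventually (\<lambda>n. closed_cutoff C n x = 0) sequentially"
    using eventually_sequentially by blast
  then show ?thesis using False by (simp add: tendsto_eventually)
qed

lemma integral_closed_cutoff_tendsto:
  fixes M :: "'a::metric_space measure"
  assumes "finite_measure M" and M: "sets M = sets borel" and C: "closed C" "C \<noteq> {}"
  shows "(\<lambda>n. \<integral>x. closed_cutoff C n x \<partial>M) \<longlonglongrightarrow> measure M C"
proof -
  interpret finite_measure M by fact
  note [measurable_cong] = M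
  have [measurable]: "C \<in> sets M" using C M by simp
  have "(\<lambda>n. \<integral>x. closed_cutoff C n x \<partial>M) \<longlonglongrightarrow> (\<integral>x. indicator C x \<partial>M)"
  proof (rule integral_dominated_convergence[where w="\<lambda>_. 1"])
    show "AE x in M. (\<lambda>n. closed_cutoff C n x) \<longlonglongrightarrow> indicator C x"
      using closed_cutoff_tendsto[OF C] by simp
    show "AE x in M. norm (closed_cutoff C n x) \<le> 1" for n
      using closed_cutoff_bounds[of C n] by simp
  qed auto
  then show ?thesis by simp
qed

lemma integrable_bounded_continuous:
  fixes f :: "'a::topological_space \<Rightarrow> real"
  assumes "finite_measure M" and M: "sets M = sets borel" and f: "continuous_on UNIV f" "bounded (range f)"
  shows "integrable M f"
proof -
  interpret finite_measure M by fact
  obtain B where "\<And>x. norm (f x) \<le> B" using f(2) unfolding bounded_iff by auto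
  moreover have "f \<in> borel_measurable M"
    using borel_measurable_continuous_onI[OF f(1)] M by (simp cong: measurable_cong_sets)
  ultimately show ?thesis by (intro integrable_const_bound[where B=B]) auto
qed

text \<open>
  Such integrals determine the measure of closed sets, and these form a generating system stable under intersections.
\<close>

lemma finite_measure_eqI_bounded_continuous:
  fixes M N :: "'a::metric_space measure"
  assumes M: "finite_measure M" "sets M = sets borel" and N: "finite_measure N" "sets N = sets borel"
    and eq: "\<And>f :: 'a \<Rightarrow> real. continuous_on UNIV f \<Longrightarrow> bounded (range f) \<Longrightarrow> (\<integral>x. f x \<partial>M) = (\<integral>x. f x \<partial>N)"
  shows "M = N"
proof -
  have closed_eq: "emeasure M C = emeasure N C" if C: "closed C" for C
  proof (cases "C = {}")
    case False
    have "measure M C = measure N C"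
      using integral_closed_cutoff_tendsto[OF M C False] integral_closed_cutoff_tendsto[OF N C False]
        eq[OF closed_cutoff_continuous closed_cutoff_bounded] by (simp add: LIMSEQ_unique)
    then show ?thesis using M(1) N(1) by (simp add: finite_measure.emeasure_eq_measure)
  qed simp
  show ?thesis
  proof (rule measure_eqI_generator_eq[where E="Collect closed" and \<Omega>=UNIV and A="\<lambda>_. UNIV"])
    show "Int_stable (Collect closed :: 'a set set)" by (auto simp: Int_stable_def)
    show "sets M = sigma_sets UNIV (Collect closed)" "sets N = sigma_sets UNIV (Collect closed)"
      using M(2) N(2) by (auto simp: borel_eq_closed)
    show "emeasure M UNIV \<noteq> \<infinity>" for i :: nat
      using M by (metis finite_measure.emeasure_finite infinity_ennreal_def)
  qed (use closed_eq in auto)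
qed

text \<open>
  Half of the portmanteau theorem: the mass of the closed complement is bounded above by the integral of a continuous cutoff, whose integrals converge.
\<close>

lemma weakly_converges_open_liminf:
  fixes P :: "'i \<Rightarrow> 'a::metric_space measure"
  assumes conv: "weakly_converges P \<mu> F" and \<mu>: "prob_space \<mu>" "sets \<mu> = sets borel"
    and P: "\<And>i. prob_space (P i)" "\<And>i. sets (P i) = sets borel"
    and U: "open U" and a: "a < measure \<mu> U"
  shows "\<forall>\<^sub>F i in F. a < measure (P i) U"
proof (cases "U = UNIV")
  case True
  then have "measure \<mu> U = 1" "measure (P i) U = 1" for i
    using \<mu> P prob_space.prob_space[of \<mu>] prob_space.prob_space[of "P i"]
      sets_eq_imp_space_eq[of \<mu> borel] sets_eq_imp_space_eq[of "P i" borel] by auto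
  then show ?thesis using a by simp
next
  case False
  let ?C = "- U"
  have C: "closed ?C" "?C \<noteq> {}" using U False by auto
  have compl: "measure N U = 1 - measure N ?C" if "prob_space N" "sets N = sets borel" for N
  proof -
    have "U \<in> sets N" "space N = UNIV" using that U sets_eq_imp_space_eq[of N borel] by auto
    then show ?thesis using prob_space.prob_compl[OF that(1), of U] by (simp add: Compl_eq_Diff_UNIV)
  qed
  have "measure \<mu> ?C < 1 - a" using a compl[OF \<mu>] by simp
  then have "\<forall>\<^sub>F n in sequentially. (\<integral>x. closed_cutoff ?C n x \<partial>\<mu>) < 1 - a"
    using integral_closed_cutoff_tendsto[OF prob_space.finite_measure[OF \<mu>(1)] \<mu>(2) C] order_tendstoD(2) by blast
  then obtain n where n: "(\<integral>x. closed_cutoff ?C n x \<partial>\<mu>) < 1 - a"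
    by (meson eventually_sequentially order_refl)
  have "((\<lambda>i. \<integral>x. closed_cutoff ?C n x \<partial>(P i)) \<longlongrightarrow> (\<integral>x. closed_cutoff ?C n x \<partial>\<mu>)) F"
    using conv closed_cutoff_continuous closed_cutoff_bounded unfolding weakly_converges_def by blast
  then have "\<forall>\<^sub>F i in F. (\<integral>x. closed_cutoff ?C n x \<partial>(P i)) < 1 - a"
    using n order_tendstoD(2) by blast
  then show ?thesis
  proof eventually_elim
    case (elim i)
    interpret Pi: prob_space "P i" by (rule P)
    have "measure (P i) ?C = (\<integral>x. indicator ?C x \<partial>(P i))"
      using P(2)[of i] C by (simp add: sets_eq_imp_space_eq[of "P i" borel])
    also have "\<dots> \<le> (\<integral>x. closed_cutoff ?C n x \<partial>(P i))"
    proof (rule integral_mono)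
      show "integrable (P i) (indicator ?C :: 'a \<Rightarrow> real)"
        using P(2)[of i] C by (intro integrable_real_indicator) (auto simp: Pi.emeasure_eq_measure)
      show "integrable (P i) (closed_cutoff ?C n)"
        by (rule integrable_bounded_continuous[OF Pi.finite_measure_axioms P(2) closed_cutoff_continuous closed_cutoff_bounded])
    qed (auto simp: indicator_def closed_cutoff_bounds closed_cutoff_eq_1)
    finally show ?case using elim compl[OF P(1) P(2), of i] by simp
  qed
qed

section \<open>Weak compactness of tight sequences\<close>

text \<open>
  Compactness on the line is Helly's theorem. It is transported to Euclidean spaces along a space-filling
  curve: a measure is moved to the line by a Borel section of a continuous map from the line, a limit is extracted there, and the
  continuous map brings it back. The curve is Schoenberg's. The step function below is even, has period 2, and
  is \<open>0\<close> on \<open>[0, 1/3]\<close> and \<open>1\<close> on \<open>[2/3, 1]\<close>; applied to \<open>3 ^ m * t\<close> it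
  reads off the \<open>m\<close>-th ternary digit of a point \<open>t\<close> of the Cantor set and yet is continuous in \<open>t\<close>.
\<close>

definition schoenberg_step :: "real \<Rightarrow> real" where
  "schoenberg_step t = max 0 (min 1 (1 / 2 - cos (pi * t)))"

text \<open>
  The point of the Cantor set with ternary digits \<open>0\<close> and \<open>2\<close> prescribed by \<open>d\<close>.
\<close>

definition ternary_code :: "(nat \<Rightarrow> bool) \<Rightarrow> real" where
  "ternary_code d = (\<Sum>k. 2 * of_bool (d k) / 3 ^ Suc k)"

lemma summable_ternary: "summable (\<lambda>k. 2 * of_bool (d k) / 3 ^ (Suc k + m) :: real)"
proof (rule summable_comparison_test'[where N=0])
  show "summable (\<lambda>k. 2 * (1 / 3 :: real) ^ k)" by (intro summable_mult summable_geometric) auto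
  show "norm (2 * of_bool (d k) / 3 ^ (Suc k + m) :: real) \<le> 2 * (1 / 3) ^ k" for k
  proof -
    have "1 \<le> 3 * (3::real) ^ m" using one_le_power[of "3::real" m] by linarith
    then show ?thesis by (auto simp: power_add field_simps)
  qed
qed

lemma sums_ternary_top: "(\<lambda>k. 2 / 3 ^ (Suc k + m) :: real) sums (1 / 3 ^ m)"
proof -
  have "(\<lambda>k. (2 / 3 ^ Suc m) * (1 / 3 :: real) ^ k) sums ((2 / 3 ^ Suc m) * (1 / (1 - 1 / 3)))"
    by (intro sums_mult geometric_sums) auto
  then show ?thesis by (simp add: power_add power_one_over field_simps)
qed

lemma ternary_tail_bounds:
  "0 \<le> (\<Sum>k. 2 * of_bool (d k) / 3 ^ (Suc k + m) :: real)"
  "(\<Sum>k. 2 * of_bool (d k) / 3 ^ (Suc k + m) :: real) \<le> 1 / 3 ^ m"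
proof -
  show "0 \<le> (\<Sum>k. 2 * of_bool (d k) / 3 ^ (Suc k + m) :: real)"
    by (intro suminf_nonneg summable_ternary) auto
  have "(\<Sum>k. 2 * of_bool (d k) / 3 ^ (Suc k + m) :: real) \<le> (\<Sum>k. 2 / 3 ^ (Suc k + m))"
    by (intro suminf_le summable_ternary sums_summable[OF sums_ternary_top] divide_right_mono) auto
  then show "(\<Sum>k. 2 * of_bool (d k) / 3 ^ (Suc k + m) :: real) \<le> 1 / 3 ^ m"
    using sums_unique[OF sums_ternary_top[of m]] by simp
qed

lemma ternary_code_bounds: "0 \<le> ternary_code d" "ternary_code d \<le> 1"
  using ternary_tail_bounds[of d 0] by (simp_all add: ternary_code_def)

text \<open>
  After multiplication by \<open>3 ^ m\<close> the leading digits form an even integer, which the period absorbs, and the remaining digits place the rest in \<open>[0, 1/3]\<close> or \<open>[2/3, 1]\<close> according to the digit number \<open>m\<close>.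
\<close>

lemma schoenberg_step_ternary_code: "schoenberg_step (3 ^ m * ternary_code d) = of_bool (d m)"
proof -
  let ?f = "\<lambda>k. 2 * of_bool (d k) / 3 ^ Suc k :: real"
  (* half of the even integer formed by the digits before the m-th *)
  define I :: int where "I = (\<Sum>i<m. of_bool (d i) * 3 ^ (m - Suc i))"
  define tail where "tail = (\<Sum>k. 2 * of_bool (d (k + Suc m)) / 3 ^ (Suc k + 1) :: real)"
  have sf: "summable ?f" using summable_ternary[of d 0] by simp
  have tail: "0 \<le> tail" "tail \<le> 1 / 3"
    using ternary_tail_bounds[of "\<lambda>k. d (k + Suc m)" 1] by (simp_all add: tail_def)
  have "ternary_code d = (\<Sum>k. ?f (k + Suc m)) + (\<Sum>i<Suc m. ?f i)"
    unfolding ternary_code_def by (rule suminf_split_initial_segment[OF sf])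
  then have "3 ^ m * ternary_code d = 3 ^ m * (\<Sum>k. ?f (k + Suc m)) + 3 ^ m * (\<Sum>i<m. ?f i) + 2 * of_bool (d m) / 3"
    by (simp add: algebra_simps)
  also have "3 ^ m * (\<Sum>k. ?f (k + Suc m)) = (\<Sum>k. 3 ^ m * ?f (k + Suc m))"
    by (rule suminf_mult[symmetric]) (rule summable_ignore_initial_segment[OF sf])
  also have "\<dots> = tail" unfolding tail_def
    by (rule suminf_cong) (simp add: power_add)
  also have "3 ^ m * (\<Sum>i<m. ?f i) = 2 * of_int I"
    unfolding I_def of_int_sum sum_distrib_left
  proof (rule sum.cong)
    fix i assume "i \<in> {..<m}"
    then have "(3::real) ^ m = 3 ^ (m - Suc i) * 3 ^ Suc i"
      by (subst power_add[symmetric]) simp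
    then show "3 ^ m * ?f i = 2 * of_int (of_bool (d i) * 3 ^ (m - Suc i))" by simp
  qed simp
  finally have t: "3 ^ m * ternary_code d = 2 * of_int I + (2 * of_bool (d m) / 3 + tail)" by simp
  define r where "r = 2 * of_bool (d m) / 3 + tail"
  have "cos (pi * (3 ^ m * ternary_code d)) = cos ((2 * pi) * of_int I + pi * r)"
    unfolding t r_def by (simp add: algebra_simps)
  also have "\<dots> = cos (pi * r)"
    unfolding cos_add using cos_int_2pin[of I] sin_int_2pin[of I] by simp
  finally have c: "cos (pi * (3 ^ m * ternary_code d)) = cos (pi * r)" .
  show ?thesis
  proof (cases "d m")
    case False
    then have "0 \<le> pi * r" "pi * r \<le> pi / 3" using tail by (auto simp: r_def mult_le_cancel_left_pos)
    then have "cos (pi / 3) \<le> cos (pi * r)" by (intro cos_monotone_0_pi_le) auto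
    then show ?thesis using False by (simp add: schoenberg_step_def c cos_60)
  next
    case True
    then have r: "2 / 3 \<le> r" "r \<le> 1" using tail by (auto simp: r_def)
    have "2 * pi / 3 \<le> pi * r" using mult_left_mono[OF r(1), of pi] by simp
    moreover have "pi * r \<le> pi" using mult_left_mono[OF r(2), of pi] by simp
    ultimately have "cos (pi * r) \<le> cos (2 * pi / 3)" by (intro cos_monotone_0_pi_le) auto
    then show ?thesis using True by (simp add: schoenberg_step_def c cos_120)
  qed
qed

definition binary_digit :: "real \<Rightarrow> nat \<Rightarrow> bool" where
  "binary_digit u i \<longleftrightarrow> odd \<lfloor>2 ^ Suc i * u\<rfloor>"

text \<open>
  The partial sums telescope to \<open>\<lfloor>2 ^ n * u\<rfloor> / 2 ^ n\<close>.
\<close>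

lemma binary_digits_sums:
  assumes "0 \<le> u" "u < 1"
  shows "(\<lambda>i. of_bool (binary_digit u i) / 2 ^ Suc i) sums u"
proof -
  have part: "(\<Sum>i<n. of_bool (binary_digit u i) / 2 ^ Suc i) = real_of_int \<lfloor>2 ^ n * u\<rfloor> / 2 ^ n" for n
  proof (induction n)
    case 0
    have "\<lfloor>u\<rfloor> = 0" using assms by (simp add: floor_eq_iff)
    then show ?case by simp
  next
    case (Suc n)
    have "\<lfloor>2 ^ n * u\<rfloor> = \<lfloor>(2 ^ Suc n * u) / real_of_int 2\<rfloor>" by simp
    also have "\<dots> = \<lfloor>2 ^ Suc n * u\<rfloor> div 2" by (rule floor_divide_real_eq_div) simp
    finally have "\<lfloor>2 ^ Suc n * u\<rfloor> = 2 * \<lfloor>2 ^ n * u\<rfloor> + of_bool (binary_digit u n)"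
      unfolding binary_digit_def by (simp add: odd_iff_mod_2_eq_one) presburger
    then have "real_of_int \<lfloor>2 ^ Suc n * u\<rfloor> = 2 * real_of_int \<lfloor>2 ^ n * u\<rfloor> + of_bool (binary_digit u n)"
      by simp
    then show ?case using Suc by (simp add: field_simps)
  qed
  have "(\<lambda>n. real_of_int \<lfloor>2 ^ n * u\<rfloor> / 2 ^ n) \<longlonglongrightarrow> u"
  proof (rule tendsto_sandwich)
    show "\<forall>\<^sub>F n in sequentially. u - (1 / 2) ^ n \<le> real_of_int \<lfloor>2 ^ n * u\<rfloor> / 2 ^ n"
    proof (rule always_eventually, rule allI)
      fix n
      have "2 ^ n * u - 1 \<le> real_of_int \<lfloor>2 ^ n * u\<rfloor>" by linarith
      then have "(2 ^ n * u - 1) / 2 ^ n \<le> real_of_int \<lfloor>2 ^ n * u\<rfloor> / 2 ^ n" by (rule divide_right_mono) simp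
      then show "u - (1 / 2) ^ n \<le> real_of_int \<lfloor>2 ^ n * u\<rfloor> / 2 ^ n" by (simp add: diff_divide_distrib power_one_over)
    qed
    show "\<forall>\<^sub>F n in sequentially. real_of_int \<lfloor>2 ^ n * u\<rfloor> / 2 ^ n \<le> u"
    proof (rule always_eventually, rule allI)
      fix n
      have "real_of_int \<lfloor>2 ^ n * u\<rfloor> \<le> 2 ^ n * u" by linarith
      then show "real_of_int \<lfloor>2 ^ n * u\<rfloor> / 2 ^ n \<le> u" by (simp add: field_simps)
    qed
    show "(\<lambda>n. u - (1 / 2) ^ n) \<longlonglongrightarrow> u"
      by (rule tendsto_eq_intros LIMSEQ_power_zero | simp)+
  qed simp
  then show ?thesis unfolding sums_def part .
qed

text \<open>
  The digits of all coordinates are interleaved by the pairing function, so that one point of the line codes a whole sequence of numbers and the number of coordinates does not enter.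
\<close>

definition schoenberg_curve :: "nat \<Rightarrow> real \<Rightarrow> real" where
  "schoenberg_curve j t = (\<Sum>i. schoenberg_step (3 ^ prod_encode (i, j) * t) / 2 ^ Suc i)"

definition schoenberg_code :: "(nat \<Rightarrow> real) \<Rightarrow> real" where
  "schoenberg_code u = ternary_code (\<lambda>k. binary_digit (u (snd (prod_decode k))) (fst (prod_decode k)))"

lemma schoenberg_curve_code:
  assumes "0 \<le> u j" "u j < 1"
  shows "schoenberg_curve j (schoenberg_code u) = u j"
  using sums_unique[OF binary_digits_sums[OF assms]]
  by (simp add: schoenberg_curve_def schoenberg_code_def schoenberg_step_ternary_code)

lemma continuous_schoenberg_curve: "continuous_on UNIV (schoenberg_curve j)"
proof -
  have "uniform_limit UNIV (\<lambda>n t. \<Sum>i<n. schoenberg_step (3 ^ prod_encode (i, j) * t) / 2 ^ Suc i)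
      (schoenberg_curve j) sequentially"
    unfolding schoenberg_curve_def
  proof (rule Weierstrass_m_test)
    show "summable (\<lambda>i. (1 / 2 :: real) ^ Suc i)" by (simp add: summable_geometric)
    show "norm (schoenberg_step (3 ^ prod_encode (i, j) * t) / 2 ^ Suc i) \<le> (1 / 2) ^ Suc i" for i t
      by (auto simp: schoenberg_step_def power_one_over divide_simps)
  qed
  then show ?thesis
  proof (rule uniform_limit_theorem[rotated])
    show "\<forall>\<^sub>F n in sequentially. continuous_on UNIV (\<lambda>t. \<Sum>i<n. schoenberg_step (3 ^ prod_encode (i, j) * t) / 2 ^ Suc i)"
      unfolding schoenberg_step_def by (intro always_eventually allI continuous_intros) auto
  qed simp
qed

lemma schoenberg_curve_measurable [measurable]: "schoenberg_curve j \<in> borel_measurable borel"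
  by (intro borel_measurable_continuous_onI continuous_schoenberg_curve)

lemma ternary_code_measurable [measurable]:
  assumes [measurable]: "\<And>k. Measurable.pred M (\<lambda>x. d x k)"
  shows "(\<lambda>x. ternary_code (d x)) \<in> borel_measurable M"
  unfolding ternary_code_def of_bool_def by measurable

lemma schoenberg_code_measurable [measurable]:
  assumes [measurable]: "\<And>k. (\<lambda>x. u x k) \<in> borel_measurable M"
  shows "(\<lambda>x. schoenberg_code (u x)) \<in> borel_measurable M"
  unfolding schoenberg_code_def binary_digit_def by measurable

definition sigmoid :: "real \<Rightarrow> real" where "sigmoid s = 1 / (1 + exp (- s))"
definition logit :: "real \<Rightarrow> real" where "logit u = ln (u / (1 - u))"

lemma sigmoid_bounds: "0 < sigmoid s" "sigmoid s < 1"
  unfolding sigmoid_def by (auto simp: add_pos_pos)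

lemma sigmoid_less_iff: "sigmoid s < sigmoid t \<longleftrightarrow> s < t"
proof -
  have "0 < 1 + exp (- s)" "0 < 1 + exp (- t)" by (simp_all add: add_pos_pos)
  then show ?thesis by (simp add: sigmoid_def divide_simps)
qed

lemma logit_sigmoid: "logit (sigmoid s) = s"
proof -
  have "0 < 1 + exp (- s)" by (simp add: add_pos_pos)
  then have "sigmoid s / (1 - sigmoid s) = exp s"
    by (simp add: sigmoid_def field_simps exp_minus)
  then show ?thesis by (simp add: logit_def)
qed

text \<open>
  The sigmoid moves \<open>\<real>\<close> into the open unit interval, where binary digits are available.
\<close>

definition line_of :: "'a::euclidean_space \<Rightarrow> real" where
  "line_of x = schoenberg_code (\<lambda>j. sigmoid (x \<bullet> from_nat_into Basis j))"

definition coordinate_curve :: "'a::euclidean_space \<Rightarrow> real \<Rightarrow> real" where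
  "coordinate_curve b = schoenberg_curve (to_nat_on Basis b)"

definition of_line :: "real \<Rightarrow> 'a::euclidean_space" where
  "of_line t = (\<Sum>b\<in>Basis. logit (coordinate_curve b t) *\<^sub>R b)"

lemma coordinate_curve_line_of:
  "b \<in> Basis \<Longrightarrow> coordinate_curve b (line_of x) = sigmoid (x \<bullet> b)"
  unfolding coordinate_curve_def line_of_def
  by (subst schoenberg_curve_code) (auto simp: sigmoid_bounds less_imp_le countable_finite)

lemma of_line_line_of: "of_line (line_of x) = x"
  by (simp add: of_line_def coordinate_curve_line_of logit_sigmoid euclidean_representation)

lemma coordinate_curve_measurable [measurable]: "coordinate_curve b \<in> borel_measurable borel"
  unfolding coordinate_curve_def by measurable

lemma line_of_measurable [measurable]: "line_of \<in> borel_measurable borel"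
  unfolding line_of_def sigmoid_def by measurable

lemma of_line_measurable [measurable]: "of_line \<in> borel_measurable borel"
  unfolding of_line_def logit_def by measurable

text \<open>
  Continuity fails only where a coordinate of the curve reaches an end of the unit interval. These points correspond to mass at infinity, which tightness excludes.
\<close>

lemma isCont_of_line:
  assumes "\<And>b::'a::euclidean_space. b \<in> Basis \<Longrightarrow> 0 < coordinate_curve b t \<and> coordinate_curve b t < 1"
  shows "isCont (of_line :: real \<Rightarrow> 'a) t"
proof -
  have "isCont (coordinate_curve b) t" for b :: 'a
    using continuous_schoenberg_curve continuous_on_eq_continuous_at unfolding coordinate_curve_def by blast
  then show ?thesis
    unfolding of_line_def logit_def using assms by (intro continuous_intros) (force simp: divide_simps)+
qed

text \<open>
  The sufficiency half of Prokhorov's theorem in Euclidean spaces, by Helly selection for the measures coded on the line. The decoding map is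
  discontinuous where a coordinate leaves \<open>(0, 1)\<close>; tightness makes this a null set for the limit, and that is
  enough for the convergence of the integrals.
\<close>

theorem tight_imp_weakly_convergent_subsequence:
  fixes Q :: "nat \<Rightarrow> 'a::euclidean_space measure"
  assumes prob: "\<And>k. prob_space (Q k)" and sets_Q: "\<And>k. sets (Q k) = sets borel"
    and tight: "\<And>\<eta>. 0 < \<eta> \<Longrightarrow> \<exists>R. \<forall>k. measure (Q k) {x. R < norm x} \<le> \<eta>"
  obtains r \<mu> where "strict_mono (r :: nat \<Rightarrow> nat)" "prob_space \<mu>" "sets \<mu> = sets borel"
    "weakly_converges (\<lambda>k. Q (r k)) \<mu> sequentially"
proof -
  define \<nu> where "\<nu> k = distr (Q k) borel (line_of :: 'a \<Rightarrow> real)" for k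
  have line_meas [measurable]: "line_of \<in> Q k \<rightarrow>\<^sub>M borel" for k
    using line_of_measurable sets_Q by (simp cong: measurable_cong_sets)
  have \<nu>: "real_distribution (\<nu> k)" for k
    unfolding \<nu>_def by (intro prob_space.real_distribution_distr prob line_meas)
  have "Helly_Selection.tight \<nu>" unfolding tight_def
  proof (intro conjI allI impI)
    fix \<eta> :: real assume "0 < \<eta>"
    have "measure (\<nu> k) {-1<..1} = 1" for k
    proof -
      have "(line_of :: 'a \<Rightarrow> real) -` {-1<..1} \<inter> space (Q k) = space (Q k)"
      proof -
        have "line_of x \<in> {-1<..1}" for x :: 'a
          using ternary_code_bounds by (force simp: line_of_def schoenberg_code_def intro: less_le_trans[of "-1" 0])
        then show ?thesis by auto
      qed
      then show ?thesis
        unfolding \<nu>_def using prob_space.prob_space[OF prob[of k]] by (subst measure_distr) auto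
    qed
    then show "\<exists>a b. a < b \<and> (\<forall>n. 1 - \<eta> < measure (\<nu> n) {a<..b})"
      using \<open>0 < \<eta>\<close> by (intro exI[of _ "-1"] exI[of _ 1]) auto
  qed (rule \<nu>)
  from tight_imp_convergent_subsubsequence[OF this strict_mono_id]
  obtain r M where r: "strict_mono r" and M: "real_distribution M" and conv: "weak_conv_m (\<nu> \<circ> r) M"
    by auto
  interpret M: real_distribution M by fact
  have \<nu>r: "real_distribution ((\<nu> \<circ> r) n)" for n using \<nu> by simp
  note bdd_conv = weak_conv_imp_bdd_ae_continuous_conv[OF \<nu>r M conv]
  have weak: "weakly_converges (\<nu> \<circ> r) M sequentially"
    unfolding weakly_converges_def
  proof (intro allI impI, elim conjE)
    fix f :: "real \<Rightarrow> real" assume f: "continuous_on UNIV f" "bounded (range f)"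
    then obtain B where "\<And>x. norm (f x) \<le> B" unfolding bounded_iff by auto
    then show "(\<lambda>i. integral\<^sup>L ((\<nu> \<circ> r) i) f) \<longlonglongrightarrow> integral\<^sup>L M f"
      using f by (intro weak_conv_imp_integral_bdd_continuous_conv[OF \<nu>r M conv])
        (auto simp: continuous_on_eq_continuous_at)
  qed
  have inside: "AE t in M. \<forall>b\<in>(Basis::'a set). 0 < coordinate_curve b t \<and> coordinate_curve b t < 1"
  proof (rule AE_finite_allI)
    fix b :: 'a assume b: "b \<in> Basis"
    (* the points of the line that code vectors with large b-coordinate; open, so the portmanteau inequality applies *)
    define V where "V R = {t. coordinate_curve b t < sigmoid (- R)} \<union> {t. sigmoid R < coordinate_curve b t}" for R
    have V_open: "open (V R)" for R
    proof -
      have "continuous_on UNIV (coordinate_curve b)"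
        unfolding coordinate_curve_def by (rule continuous_schoenberg_curve)
      then show ?thesis unfolding V_def by (intro open_Un open_Collect_less continuous_intros)
    qed
    define E where "E = {t. \<not> (0 < coordinate_curve b t \<and> coordinate_curve b t < 1)}"
    have E_sets [measurable]: "E \<in> sets borel" unfolding E_def by measurable
    have "measure M E \<le> \<eta>" if \<eta>: "0 < \<eta>" for \<eta>
    proof (rule ccontr)
      assume "\<not> measure M E \<le> \<eta>"
      obtain R where R: "\<And>k. measure (Q k) {x. R < norm x} \<le> \<eta>" using tight[OF \<eta>] by auto
      have "E \<subseteq> V R" unfolding E_def V_def using sigmoid_bounds[of R] sigmoid_bounds[of "-R"] by force
      then have "measure M E \<le> measure M (V R)" using V_open by (intro M.finite_measure_mono) auto
      then have "\<eta> < measure M (V R)" using \<open>\<not> measure M E \<le> \<eta>\<close> by simp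
      from weakly_converges_open_liminf[OF weak _ _ _ _ V_open this]
      have "\<forall>\<^sub>F n in sequentially. \<eta> < measure ((\<nu> \<circ> r) n) (V R)"
        using \<nu> M.prob_space_axioms by (auto simp: real_distribution_def real_distribution_axioms_def)
      then obtain n where n: "\<eta> < measure (\<nu> (r n)) (V R)"
        by (auto simp: eventually_sequentially)
      interpret Qn: prob_space "Q (r n)" by (rule prob)
      have [simp]: "space (Q (r n)) = UNIV" using sets_eq_imp_space_eq[OF sets_Q[of "r n"]] by simp
      have "measure (\<nu> (r n)) (V R) = measure (Q (r n)) ((line_of :: 'a \<Rightarrow> real) -` V R)"
        unfolding \<nu>_def using V_open by (subst measure_distr) auto
      also have "\<dots> \<le> measure (Q (r n)) {x. R < norm x}"
      proof (rule Qn.finite_measure_mono)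
        show "(line_of :: 'a \<Rightarrow> real) -` V R \<subseteq> {x. R < norm x}"
        proof
          fix x assume "x \<in> (line_of :: 'a \<Rightarrow> real) -` V R"
          then have "x \<bullet> b < - R \<or> R < x \<bullet> b"
            using b by (auto simp: V_def coordinate_curve_line_of sigmoid_less_iff)
          then show "x \<in> {x. R < norm x}" using Basis_le_norm[OF b, of x] by auto
        qed
      qed (simp add: sets_Q)
      finally show False using n R[of "r n"] by simp
    qed
    then have "measure M E \<le> 0" by (rule field_le_epsilon) simp
    then have "emeasure M E = 0" by (simp add: M.emeasure_eq_measure measure_le_0_iff)
    then show "AE t in M. 0 < coordinate_curve b t \<and> coordinate_curve b t < 1"
      by (intro AE_I[where N=E]) (auto simp: E_def)
  qed simp
  define \<mu> where "\<mu> = distr M borel (of_line :: real \<Rightarrow> 'a)"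
  show thesis
  proof (rule that[OF r])
    show "prob_space \<mu>" "sets \<mu> = sets borel"
      unfolding \<mu>_def by (auto intro!: M.prob_space_distr)
    show "weakly_converges (\<lambda>k. Q (r k)) \<mu> sequentially"
      unfolding weakly_converges_def
    proof (intro allI impI, elim conjE)
      fix f :: "'a \<Rightarrow> real" assume f: "continuous_on UNIV f" "bounded (range f)"
      then obtain B where B: "\<And>x. norm (f x) \<le> B" unfolding bounded_iff by auto
      have f_meas [measurable]: "f \<in> borel_measurable borel" using f(1) by (rule borel_measurable_continuous_onI)
      have "(\<lambda>k. integral\<^sup>L ((\<nu> \<circ> r) k) (\<lambda>t. f (of_line t))) \<longlonglongrightarrow> integral\<^sup>L M (\<lambda>t. f (of_line t))"
      proof (rule bdd_conv)
        have "isCont (\<lambda>t. f (of_line t)) t"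
          if "\<forall>b\<in>(Basis::'a set). 0 < coordinate_curve b t \<and> coordinate_curve b t < 1" for t
        proof (rule isCont_o2[where f=of_line and g=f])
          show "isCont (of_line :: real \<Rightarrow> 'a) t" using that by (intro isCont_of_line) blast
          show "isCont f (of_line t)" using f(1) by (simp add: continuous_on_eq_continuous_at)
        qed
        then have "{t. \<not> isCont (\<lambda>t. f (of_line t)) t}
          \<subseteq> {t. \<not> (\<forall>b\<in>(Basis::'a set). 0 < coordinate_curve b t \<and> coordinate_curve b t < 1)}" by auto
        moreover have "{t. \<not> (\<forall>b\<in>(Basis::'a set). 0 < coordinate_curve b t \<and> coordinate_curve b t < 1)} \<in> sets M"
          by simp
        moreover from this have "emeasure M {t. \<not> (\<forall>b\<in>(Basis::'a set). 0 < coordinate_curve b t \<and> coordinate_curve b t < 1)} = 0"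
          using inside by (subst (asm) AE_iff_measurable) auto
        ultimately show "emeasure M {t. \<not> isCont (\<lambda>t. f (of_line t)) t} = 0"
          by (cases "{t. \<not> isCont (\<lambda>t. f (of_line t)) t} \<in> sets M")
            (auto intro: emeasure_eq_0[rotated 1] simp: emeasure_notin_sets)
        show "norm (f (of_line t)) \<le> B" for t by (rule B)
      qed measurable
      then show "(\<lambda>k. integral\<^sup>L (Q (r k)) f) \<longlonglongrightarrow> integral\<^sup>L \<mu> f"
        by (simp add: \<nu>_def \<mu>_def integral_distr of_line_line_of)
    qed
  qed
qed

section \<open>Cyclical monotonicity and Kantorovich potentials\<close>

text \<open>
  The cyclic shift of the points is written as the sequential shift with the last term split off.
\<close>

definition cyclically_monotone :: "('a \<Rightarrow> 'b \<Rightarrow> real) \<Rightarrow> ('a \<times> 'b) set \<Rightarrow> bool" where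
  "cyclically_monotone c S \<longleftrightarrow> (\<forall>n z. (\<forall>i\<le>n. z i \<in> S) \<longrightarrow>
     (\<Sum>i\<le>n. c (fst (z i)) (snd (z i)))
       \<le> (\<Sum>i<n. c (fst (z (Suc i))) (snd (z i))) + c (fst (z 0)) (snd (z n)))"

text \<open>
  Rockafellar's sum along a chain \<open>z 0, ..., z n\<close> that is left at \<open>x\<close>.
\<close>

definition chain_cost :: "('a \<Rightarrow> 'b \<Rightarrow> real) \<Rightarrow> nat \<Rightarrow> (nat \<Rightarrow> 'a \<times> 'b) \<Rightarrow> 'a \<Rightarrow> real" where
  "chain_cost c n z x = c x (snd (z n)) - c (fst (z n)) (snd (z n)) +
     (\<Sum>i<n. c (fst (z (Suc i))) (snd (z i)) - c (fst (z i)) (snd (z i)))"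

definition chains :: "('a \<times> 'b) set \<Rightarrow> 'a \<times> 'b \<Rightarrow> (nat \<times> (nat \<Rightarrow> 'a \<times> 'b)) set" where
  "chains S p0 = {(n, z). z 0 = p0 \<and> (\<forall>i\<le>n. z i \<in> S)}"

definition chain_potential :: "('a \<Rightarrow> 'b \<Rightarrow> real) \<Rightarrow> ('a \<times> 'b) set \<Rightarrow> 'a \<times> 'b \<Rightarrow> 'a \<Rightarrow> ereal" where
  "chain_potential c S p0 x = (INF (n, z)\<in>chains S p0. ereal (chain_cost c n z x))"

definition conjugate_potential :: "('a \<Rightarrow> 'b \<Rightarrow> real) \<Rightarrow> ('a \<Rightarrow> ereal) \<Rightarrow> 'b \<Rightarrow> ereal" where
  "conjugate_potential c u y = (INF x. ereal (c x y) - u x)"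

lemma chain_potential_le:
  "p0 \<in> S \<Longrightarrow> chain_potential c S p0 x \<le> ereal (c x (snd p0) - c (fst p0) (snd p0))"
  unfolding chain_potential_def
  by (rule INF_lower2[where i="(0, \<lambda>_. p0)"]) (auto simp: chains_def chain_cost_def)

text \<open>
  Every chain can be prolonged by the point \<open>(x, y)\<close>.
\<close>

lemma chain_potential_superdifferential:
  assumes "(x, y) \<in> S"
  shows "chain_potential c S p0 x' \<le> chain_potential c S p0 x + ereal (c x' y - c x y)"
proof -
  have "chain_potential c S p0 x' - ereal (c x' y - c x y) \<le> ereal (chain_cost c n z x)"
    if "(n, z) \<in> chains S p0" for n z
  proof -
    define w where "w = z(Suc n := (x, y))"
    have w: "(Suc n, w) \<in> chains S p0"
      using that assms by (auto simp: chains_def w_def le_Suc_eq)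
    have "(\<Sum>i<n. c (fst (w (Suc i))) (snd (w i)) - c (fst (w i)) (snd (w i)))
        = (\<Sum>i<n. c (fst (z (Suc i))) (snd (z i)) - c (fst (z i)) (snd (z i)))"
      by (rule sum.cong) (auto simp: w_def)
    then have "chain_cost c (Suc n) w x' = c x' y - c x y + chain_cost c n z x"
      by (simp add: chain_cost_def) (simp add: w_def)
    then have "chain_potential c S p0 x' \<le> ereal (c x' y - c x y + chain_cost c n z x)"
      unfolding chain_potential_def using INF_lower[OF w, of "\<lambda>(n, z). ereal (chain_cost c n z x')"] by simp
    then show ?thesis by (cases "chain_potential c S p0 x'") auto
  qed
  then have "chain_potential c S p0 x' - ereal (c x' y - c x y) \<le> chain_potential c S p0 x"
    unfolding chain_potential_def[of c S p0 x] by (intro INF_greatest) auto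
  then show ?thesis
    by (cases "chain_potential c S p0 x'"; cases "chain_potential c S p0 x") auto
qed

text \<open>
  A chain that returns to its starting point is a cycle; this is where cyclical monotonicity enters.
\<close>

lemma chain_potential_base_nonneg:
  assumes "cyclically_monotone c S"
  shows "0 \<le> chain_potential c S p0 (fst p0)"
  unfolding chain_potential_def
proof (intro INF_greatest, clarify)
  fix n z assume "(n, z) \<in> chains S p0"
  then have z: "z 0 = p0" "\<forall>i\<le>n. z i \<in> S" by (auto simp: chains_def)
  have "(\<Sum>i\<le>n. c (fst (z i)) (snd (z i)))
       \<le> (\<Sum>i<n. c (fst (z (Suc i))) (snd (z i))) + c (fst (z 0)) (snd (z n))"
    using assms z(2) unfolding cyclically_monotone_def by blast
  moreover have "(\<Sum>i\<le>n. c (fst (z i)) (snd (z i))) = (\<Sum>i<n. c (fst (z i)) (snd (z i))) + c (fst (z n)) (snd (z n))"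
    by (simp flip: lessThan_Suc_atMost)
  ultimately show "0 \<le> ereal (chain_cost c n z (fst p0))"
    using z(1) by (simp add: chain_cost_def sum_subtractf)
qed

lemma chain_potential_finite:
  assumes mono: "cyclically_monotone c S" and p0: "p0 \<in> S" and xy: "(x, y) \<in> S"
  shows "\<bar>chain_potential c S p0 x\<bar> \<noteq> \<infinity>"
proof -
  have "0 \<le> chain_potential c S p0 x + ereal (c (fst p0) y - c x y)"
    using chain_potential_base_nonneg[OF mono, of p0] chain_potential_superdifferential[OF xy, of c p0 "fst p0"]
    by (rule order_trans)
  then show ?thesis using chain_potential_le[OF p0, of c x] by (cases "chain_potential c S p0 x") auto
qed

lemma add_conjugate_potential_le:
  assumes "\<bar>u x\<bar> \<noteq> \<infinity>" "\<bar>conjugate_potential c u y\<bar> \<noteq> \<infinity>"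
  shows "real_of_ereal (u x) + real_of_ereal (conjugate_potential c u y) \<le> c x y"
proof -
  have "conjugate_potential c u y \<le> ereal (c x y) - u x"
    unfolding conjugate_potential_def by (rule INF_lower) simp
  then show ?thesis using assms by (cases "u x"; cases "conjugate_potential c u y") auto
qed

text \<open>
  The infimum defining the conjugate is attained at \<open>x\<close>, by the superdifferential inequality.
\<close>

lemma conjugate_potential_contact:
  assumes mono: "cyclically_monotone c S" and p0: "p0 \<in> S" and xy: "(x, y) \<in> S"
  shows "conjugate_potential c (chain_potential c S p0) y = ereal (c x y) - chain_potential c S p0 x"
proof (rule antisym)
  show "conjugate_potential c (chain_potential c S p0) y \<le> ereal (c x y) - chain_potential c S p0 x"
    unfolding conjugate_potential_def by (rule INF_lower) simp
  show "ereal (c x y) - chain_potential c S p0 x \<le> conjugate_potential c (chain_potential c S p0) y"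
    unfolding conjugate_potential_def
  proof (rule INF_greatest)
    fix x'
    show "ereal (c x y) - chain_potential c S p0 x \<le> ereal (c x' y) - chain_potential c S p0 x'"
      using chain_potential_superdifferential[OF xy, of c p0 x'] chain_potential_finite[OF mono p0 xy]
        chain_potential_le[OF p0, of c x']
      by (cases "chain_potential c S p0 x"; cases "chain_potential c S p0 x'") auto
  qed
qed

lemma borel_measurable_INF_continuous:
  fixes f :: "'i \<Rightarrow> 'a::topological_space \<Rightarrow> ereal"
  assumes "\<And>i. i \<in> I \<Longrightarrow> continuous_on UNIV (f i)"
  shows "(\<lambda>x. INF i\<in>I. f i x) \<in> borel_measurable borel"
proof (rule borel_measurableI_less)
  fix a
  have "{x. (INF i\<in>I. f i x) < a} = (\<Union>i\<in>I. {x. f i x < a})"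
    by (auto simp: INF_less_iff)
  moreover have "open \<dots>"
    by (intro open_UN ballI open_Collect_less assms continuous_on_const)
  ultimately show "{x \<in> space borel. (INF i\<in>I. f i x) < a} \<in> sets borel" by simp
qed

lemma chain_potential_measurable:
  fixes c :: "'a::topological_space \<Rightarrow> 'b \<Rightarrow> real"
  assumes "\<And>y. continuous_on UNIV (\<lambda>x. c x y)"
  shows "chain_potential c S p0 \<in> borel_measurable borel"
  unfolding chain_potential_def[abs_def] case_prod_unfold chain_cost_def
  by (intro borel_measurable_INF_continuous continuous_on_ereal continuous_intros assms)

lemma conjugate_potential_measurable:
  fixes c :: "'a \<Rightarrow> 'b::topological_space \<Rightarrow> real"
  assumes cont: "\<And>x. continuous_on UNIV (\<lambda>y. c x y)"
  shows "conjugate_potential c u \<in> borel_measurable borel"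
  unfolding conjugate_potential_def[abs_def]
proof (rule borel_measurable_INF_continuous)
  fix x
  show "continuous_on UNIV (\<lambda>y. ereal (c x y) - u x)"
  proof (cases "u x")
    case (real r)
    then show ?thesis by (auto intro!: continuous_on_ereal continuous_intros cont)
  qed auto
qed

text \<open>
  Kantorovich duality in the form needed for comparing two couplings. The potentials are bounded above by integrable functions; on the
  contact set their sum is the integrable cost, so they are integrable. Their integrals depend on the marginals only, hence the costs of
  \<open>P\<close> and \<open>Q\<close> can be compared, and \<open>Q\<close> has to be concentrated where the duality inequality is an equality. That
  set need not be closed, but the inequality for pairs of points passes to its closure.
\<close>

theorem cyclically_monotone_imp_common_contact_set:
  fixes c :: "'a::euclidean_space \<Rightarrow> 'b::euclidean_space \<Rightarrow> real"
  assumes cont: "continuous_on UNIV (\<lambda>p. c (fst p) (snd p))"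
    and S: "cyclically_monotone c S" "AE p in P. p \<in> S"
    and P: "coupling \<mu> \<nu> P" "integrable P (\<lambda>p. c (fst p) (snd p))"
    and Q: "coupling \<mu> \<nu> Q" "integrable Q (\<lambda>p. c (fst p) (snd p))"
    and le: "(\<integral>p. c (fst p) (snd p) \<partial>Q) \<le> (\<integral>p. c (fst p) (snd p) \<partial>P)"
    and marg: "\<And>y. integrable \<mu> (\<lambda>x. c x y)" "\<And>x. integrable \<nu> (\<lambda>y. c x y)"
  obtains C where "closed C" "AE p in P. p \<in> C" "AE p in Q. p \<in> C"
    "\<And>x y x' y'. (x, y) \<in> C \<Longrightarrow> (x', y') \<in> C \<Longrightarrow> c x y + c x' y' \<le> c x y' + c x' y"
proof -
  have contx: "continuous_on UNIV (\<lambda>x. c x y)" for y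
    by (rule continuous_on_compose2[OF cont, of UNIV "\<lambda>x. (x, y)", simplified]) (intro continuous_intros)
  have conty: "continuous_on UNIV (\<lambda>y. c x y)" for x
    by (rule continuous_on_compose2[OF cont, of UNIV "\<lambda>y. (x, y)", simplified]) (intro continuous_intros)
  interpret P: prob_space P using P(1) by (simp add: coupling_def)
  interpret Q: prob_space Q using Q(1) by (simp add: coupling_def)
  have "S \<noteq> {}"
    using S(2) P.prob_space P.AE_False by fastforce
  then obtain p0 where p0: "p0 \<in> S" by auto
  define u where "u = chain_potential c S p0"
  define v where "v = conjugate_potential c u"
  define u' where "u' x = real_of_ereal (u x)" for x
  define v' where "v' y = real_of_ereal (v y)" for y
  have u_meas [measurable]: "u \<in> borel_measurable borel"
    unfolding u_def by (rule chain_potential_measurable[OF contx])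
  have v_meas [measurable]: "v \<in> borel_measurable borel"
    unfolding v_def by (rule conjugate_potential_measurable[OF conty])
  have [measurable]: "u' \<in> borel_measurable borel" "v' \<in> borel_measurable borel"
    unfolding u'_def v'_def by measurable
  have marg_meas: "fst \<in> R \<rightarrow>\<^sub>M borel" "snd \<in> R \<rightarrow>\<^sub>M borel" if "coupling \<mu> \<nu> R" for R
    using that unfolding coupling_def
    by (simp_all cong: measurable_cong_sets add: borel_measurable_continuous_onI continuous_on_fst continuous_on_snd)
  have marg_eq: "distr R borel fst = \<mu>" "distr R borel snd = \<nu>" if "coupling \<mu> \<nu> R" for R
    using that by (simp_all add: coupling_def)
  have AE_fst: "(AE p in R. W (fst p)) \<longleftrightarrow> (AE x in \<mu>. W x)" if "coupling \<mu> \<nu> R" "{x. W x} \<in> sets borel" for R W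
    unfolding marg_eq(1)[OF that(1), symmetric] using that marg_meas[OF that(1)] by (subst AE_distr_iff) auto
  have AE_snd: "(AE p in R. W (snd p)) \<longleftrightarrow> (AE x in \<nu>. W x)" if "coupling \<mu> \<nu> R" "{x. W x} \<in> sets borel" for R W
    unfolding marg_eq(2)[OF that(1), symmetric] using that marg_meas[OF that(1)] by (subst AE_distr_iff) auto
  have int_fst: "integrable R (\<lambda>p. g (fst p)) \<longleftrightarrow> integrable \<mu> g" "(\<integral>p. g (fst p) \<partial>R) = (\<integral>x. g x \<partial>\<mu>)"
    if "coupling \<mu> \<nu> R" "g \<in> borel_measurable borel" for R and g :: "'a \<Rightarrow> real"
    unfolding marg_eq(1)[OF that(1), symmetric] using that marg_meas[OF that(1)]
    by (simp_all add: integrable_distr_eq integral_distr)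
  have int_snd: "integrable R (\<lambda>p. g (snd p)) \<longleftrightarrow> integrable \<nu> g" "(\<integral>p. g (snd p) \<partial>R) = (\<integral>x. g x \<partial>\<nu>)"
    if "coupling \<mu> \<nu> R" "g \<in> borel_measurable borel" for R and g :: "'b \<Rightarrow> real"
    unfolding marg_eq(2)[OF that(1), symmetric] using that marg_meas[OF that(1)]
    by (simp_all add: integrable_distr_eq integral_distr)
  have u_fin: "\<bar>u x\<bar> \<noteq> \<infinity>" if "(x, y) \<in> S" for x y
    unfolding u_def by (rule chain_potential_finite[OF S(1) p0 that])
  have v_eq: "v y = ereal (c x y) - u x" if "(x, y) \<in> S" for x y
    unfolding v_def u_def by (rule conjugate_potential_contact[OF S(1) p0 that])
  have v_fin: "\<bar>v y\<bar> \<noteq> \<infinity>" if "(x, y) \<in> S" for x y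
    using v_eq[OF that] u_fin[OF that] by (cases "u x") auto
  have contact: "u' x + v' y = c x y" if "(x, y) \<in> S" for x y
    using v_eq[OF that] u_fin[OF that] by (cases "u x") (auto simp: u'_def v'_def)
  have below: "u' x + v' y \<le> c x y" if "\<bar>u x\<bar> \<noteq> \<infinity>" "\<bar>v y\<bar> \<noteq> \<infinity>" for x y
    using add_conjugate_potential_le[of u x c y] that by (simp add: v_def u'_def v'_def)
  have u_le: "u' x \<le> c x (snd p0) - c (fst p0) (snd p0)" if "\<bar>u x\<bar> \<noteq> \<infinity>" for x
    using chain_potential_le[OF p0, of c x] that by (cases "u x") (auto simp: u_def u'_def)
  have v_le: "v' y \<le> c (fst p0) y - u' (fst p0)" if "\<bar>v y\<bar> \<noteq> \<infinity>" for y
    using below[OF _ that, of "fst p0"] u_fin[of "fst p0" "snd p0"] p0 by simp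
  (* upper bounds of the potentials; on the contact set an upper bound of one is a lower bound of the other *)
  define \<alpha> where "\<alpha> x = c x (snd p0) - c (fst p0) (snd p0)" for x
  define \<beta> where "\<beta> y = c (fst p0) y - u' (fst p0)" for y
  have [measurable]: "\<alpha> \<in> borel_measurable borel" "\<beta> \<in> borel_measurable borel"
    unfolding \<alpha>_def \<beta>_def by (intro borel_measurable_continuous_onI continuous_intros contx conty)+
  interpret \<mu>: prob_space \<mu> using P(1) marg_meas[OF P(1)] P.prob_space_distr by (auto simp: coupling_def)
  interpret \<nu>: prob_space \<nu> using P(1) marg_meas[OF P(1)] P.prob_space_distr by (auto simp: coupling_def)
  have \<alpha>\<beta>_int: "integrable \<mu> \<alpha>" "integrable \<nu> \<beta>"
    unfolding \<alpha>_def \<beta>_def using marg by auto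
  have fin_P: "AE p in P. \<bar>u (fst p)\<bar> \<noteq> \<infinity>" "AE p in P. \<bar>v (snd p)\<bar> \<noteq> \<infinity>"
  proof -
    have fin: "\<bar>u (fst p)\<bar> \<noteq> \<infinity>" "\<bar>v (snd p)\<bar> \<noteq> \<infinity>" if "p \<in> S" for p
      using u_fin[of "fst p" "snd p"] v_fin[of "fst p" "snd p"] that by auto
    show "AE p in P. \<bar>u (fst p)\<bar> \<noteq> \<infinity>" by (rule eventually_mono[OF S(2) fin(1)])
    show "AE p in P. \<bar>v (snd p)\<bar> \<noteq> \<infinity>" by (rule eventually_mono[OF S(2) fin(2)])
  qed
  have fin_Q: "AE p in Q. \<bar>u (fst p)\<bar> \<noteq> \<infinity>" "AE p in Q. \<bar>v (snd p)\<bar> \<noteq> \<infinity>"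
    using fin_P AE_fst[OF P(1), of "\<lambda>x. \<bar>u x\<bar> \<noteq> \<infinity>"] AE_fst[OF Q(1), of "\<lambda>x. \<bar>u x\<bar> \<noteq> \<infinity>"]
      AE_snd[OF P(1), of "\<lambda>x. \<bar>v x\<bar> \<noteq> \<infinity>"] AE_snd[OF Q(1), of "\<lambda>x. \<bar>v x\<bar> \<noteq> \<infinity>"] by simp_all
  have eq_P: "AE p in P. u' (fst p) + v' (snd p) = c (fst p) (snd p)"
    using S(2) by eventually_elim (metis contact prod.collapse)
  have dom_int: "integrable P (\<lambda>p. \<bar>\<alpha> (fst p)\<bar> + \<bar>\<beta> (snd p)\<bar> + \<bar>c (fst p) (snd p)\<bar>)"
    using \<alpha>\<beta>_int P by (intro Bochner_Integration.integrable_add integrable_abs) (simp_all add: int_fst int_snd)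
  have u_int: "integrable \<mu> u'"
  proof -
    have "integrable P (\<lambda>p. u' (fst p))"
    proof (rule Bochner_Integration.integrable_bound[OF dom_int])
      show "(\<lambda>p. u' (fst p)) \<in> borel_measurable P"
        using marg_meas[OF P(1)] by (intro measurable_compose[of fst P borel u' borel]) auto
      show "AE p in P. norm (u' (fst p)) \<le> norm (\<bar>\<alpha> (fst p)\<bar> + \<bar>\<beta> (snd p)\<bar> + \<bar>c (fst p) (snd p)\<bar>)"
        using eq_P fin_P
      proof eventually_elim
        case (elim p)
        then show ?case using u_le[of "fst p"] v_le[of "snd p"] unfolding \<alpha>_def \<beta>_def by (auto simp: abs_if)
      qed
    qed
    then show ?thesis using int_fst(1)[OF P(1), of u'] by simp
  qed
  have v_int: "integrable \<nu> v'"
  proof -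
    have "integrable P (\<lambda>p. v' (snd p))"
    proof (rule Bochner_Integration.integrable_bound[OF dom_int])
      show "(\<lambda>p. v' (snd p)) \<in> borel_measurable P"
        using marg_meas[OF P(1)] by (intro measurable_compose[of snd P borel v' borel]) auto
      show "AE p in P. norm (v' (snd p)) \<le> norm (\<bar>\<alpha> (fst p)\<bar> + \<bar>\<beta> (snd p)\<bar> + \<bar>c (fst p) (snd p)\<bar>)"
        using eq_P fin_P
      proof eventually_elim
        case (elim p)
        then show ?case using u_le[of "fst p"] v_le[of "snd p"] unfolding \<alpha>_def \<beta>_def by (auto simp: abs_if)
      qed
    qed
    then show ?thesis using int_snd(1)[OF P(1), of v'] by simp
  qed
  have split_int: "integrable R (\<lambda>p. u' (fst p) + v' (snd p))"
      "(\<integral>p. u' (fst p) + v' (snd p) \<partial>R) = (\<integral>x. u' x \<partial>\<mu>) + (\<integral>y. v' y \<partial>\<nu>)" if "coupling \<mu> \<nu> R" for R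
    using u_int v_int int_fst[OF that, of u'] int_snd[OF that, of v'] by simp_all
  define h where "h p = c (fst p) (snd p) - (u' (fst p) + v' (snd p))" for p
  have h_int: "integrable Q h" unfolding h_def using Q split_int[OF Q(1)] by simp
  have h_nonneg: "AE p in Q. 0 \<le> h p" using fin_Q by eventually_elim (use below in \<open>auto simp: h_def\<close>)
  have "(\<integral>p. c (fst p) (snd p) \<partial>P) = (\<integral>p. u' (fst p) + v' (snd p) \<partial>P)"
    by (rule integral_cong_AE) (use eq_P borel_measurable_integrable[OF P(2)] borel_measurable_integrable[OF split_int(1)[OF P(1)]] in auto)
  then have "(\<integral>p. h p \<partial>Q) \<le> 0"
    unfolding h_def using le Q(2) split_int[OF Q(1)] split_int(2)[OF P(1)] by simp
  then have "(\<integral>p. h p \<partial>Q) = 0" using integral_nonneg_AE[OF h_nonneg] by simp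
  then have h0: "AE p in Q. h p = 0" using integral_nonneg_eq_0_iff_AE[OF h_int h_nonneg] by simp
  define C where "C = {p. \<bar>u (fst p)\<bar> \<noteq> \<infinity> \<and> \<bar>v (snd p)\<bar> \<noteq> \<infinity> \<and> h p = 0}"
  define K where "K = {w. c (fst (fst w)) (snd (fst w)) + c (fst (snd w)) (snd (snd w))
      \<le> c (fst (fst w)) (snd (snd w)) + c (fst (snd w)) (snd (fst w))}"
  show thesis
  proof (rule that[of "closure C"])
    have "AE p in P. p \<in> C" using eq_P fin_P by eventually_elim (auto simp: C_def h_def)
    then show "AE p in P. p \<in> closure C" by eventually_elim (use closure_subset in auto)
    have "AE p in Q. p \<in> C" using h0 fin_Q by eventually_elim (auto simp: C_def)
    then show "AE p in Q. p \<in> closure C" by eventually_elim (use closure_subset in auto)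
    have "C \<times> C \<subseteq> K"
    proof (clarify, unfold K_def, clarsimp)
      fix x y x' y' assume "(x, y) \<in> C" "(x', y') \<in> C"
      then show "c x y + c x' y' \<le> c x y' + c x' y"
        using below[of x y'] below[of x' y] by (auto simp: C_def h_def)
    qed
    moreover have "closed K"
      unfolding K_def
      by (intro closed_Collect_le continuous_intros continuous_on_compose2[OF cont, of UNIV "\<lambda>w. (fst (fst w), snd (fst w))", simplified]
        continuous_on_compose2[OF cont, of UNIV "\<lambda>w. (fst (snd w), snd (snd w))", simplified]
        continuous_on_compose2[OF cont, of UNIV "\<lambda>w. (fst (fst w), snd (snd w))", simplified]
        continuous_on_compose2[OF cont, of UNIV "\<lambda>w. (fst (snd w), snd (fst w))", simplified])
    ultimately have sub: "closure C \<times> closure C \<subseteq> K" by (metis closure_Times closure_minimal)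
    fix x y x' y' assume "(x, y) \<in> closure C" "(x', y') \<in> closure C"
    then show "c x y + c x' y' \<le> c x y' + c x' y" using sub by (auto simp: K_def)
  qed simp
qed

section \<open>Monotone sets are graphs almost everywhere\<close>

lemma nn_integral_lborel_translate:
  fixes f :: "'a::euclidean_space \<Rightarrow> ennreal"
  assumes [measurable]: "f \<in> borel_measurable borel"
  shows "(\<integral>\<^sup>+x. f (a + x) \<partial>lborel) = (\<integral>\<^sup>+x. f x \<partial>lborel)"
proof -
  have "(\<integral>\<^sup>+x. f x \<partial>lborel) = (\<integral>\<^sup>+x. f x \<partial>(distr lborel borel ((+) a)))"
    by (simp add: lborel_distr_plus)
  then show ?thesis by (simp add: nn_integral_distr)
qed

text \<open>
  Tonelli with translations only: averaging the translates of \<open>N\<close> along \<open>e\<close> does not change its measure, while for each starting point the average is the length of a countable set.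
\<close>

lemma null_sets_if_lines_countable:
  fixes N :: "'a::euclidean_space set"
  assumes N: "N \<in> sets borel" and cnt: "\<And>x. countable {s::real. x + s *\<^sub>R e \<in> N}"
  shows "N \<in> null_sets lborel"
proof -
  have [measurable]: "N \<in> sets borel" by fact
  have "emeasure lborel N = (\<integral>\<^sup>+s. indicator {0..1} s * emeasure lborel N \<partial>(lborel :: real measure))"
    by (simp add: nn_integral_multc)
  also have "\<dots> = (\<integral>\<^sup>+s. (\<integral>\<^sup>+x. indicator {0..1} s * indicator N (x + s *\<^sub>R e) \<partial>lborel) \<partial>(lborel :: real measure))"
  proof (rule nn_integral_cong)
    fix s :: real
    have "(\<integral>\<^sup>+x. indicator N (x + s *\<^sub>R e) \<partial>lborel) = emeasure lborel N"
      using nn_integral_lborel_translate[of "indicator N" "s *\<^sub>R e"] by (simp add: add.commute)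
    then show "indicator {0..1} s * emeasure lborel N
        = (\<integral>\<^sup>+x. indicator {0..1} s * indicator N (x + s *\<^sub>R e) \<partial>lborel)"
      by (subst nn_integral_cmult) auto
  qed
  also have "\<dots> = (\<integral>\<^sup>+x. (\<integral>\<^sup>+s. indicator {0..1} s * indicator N (x + s *\<^sub>R e) \<partial>(lborel :: real measure)) \<partial>lborel)"
    by (rule lborel_pair.Fubini') measurable
  also have "\<dots> = (\<integral>\<^sup>+x. 0 \<partial>(lborel :: 'a measure))"
  proof (rule nn_integral_cong)
    fix x
    have "AE s in lborel. s \<notin> {s. x + s *\<^sub>R e \<in> N}"
      by (rule AE_not_in) (rule countable_imp_null_set_lborel[OF cnt])
    then have "(\<integral>\<^sup>+s. indicator {0..1} s * indicator N (x + s *\<^sub>R e) \<partial>(lborel :: real measure))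
        = (\<integral>\<^sup>+s. 0 \<partial>(lborel :: real measure))"
      by (intro nn_integral_cong_AE) (auto elim!: eventually_mono)
    then show "(\<integral>\<^sup>+s. indicator {0..1} s * indicator N (x + s *\<^sub>R e) \<partial>(lborel :: real measure)) = 0" by simp
  qed
  finally show ?thesis using N by (simp add: null_setsI)
qed


lemma closed_sigma_compact:
  fixes S :: "'a::euclidean_space set"
  assumes "closed S"
  shows "S = (\<Union>k::nat. S \<inter> cball 0 (real k))"
  by (auto simp: real_arch_simple)

text \<open>
  Along a line in direction \<open>e\<close> the function \<open>K y \<bullet> e\<close> is a monotone multivalued function of the position. Its values at
  different positions lie in intervals that do not overlap, so at most countably many are nondegenerate. The exceptional set is a countable union of projections
  of compact sets, which makes it measurable.
\<close>

lemma closed_monotone_single_valued_AE: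
  fixes K :: "'b::euclidean_space \<Rightarrow> 'a::euclidean_space"
  assumes lin: "linear K" and inj: "inj K" and S: "closed S"
    and mono: "\<And>x y x' y'. (x, y) \<in> S \<Longrightarrow> (x', y') \<in> S \<Longrightarrow> 0 \<le> (x - x') \<bullet> (K y - K y')"
  obtains N where "N \<in> null_sets lborel"
    and "\<And>x y y'. x \<notin> N \<Longrightarrow> (x, y) \<in> S \<Longrightarrow> (x, y') \<in> S \<Longrightarrow> y = y'"
proof -
  have contK: "continuous_on UNIV K"
    using lin by (simp add: linear_continuous_on linear_linear)
  define Z where "Z e k m = fst ` {w :: 'a \<times> ('b \<times> 'b). norm w \<le> real k \<and> (fst w, fst (snd w)) \<in> S \<and> (fst w, snd (snd w)) \<in> S
      \<and> K (fst (snd w)) \<bullet> e + 1 / real (Suc m) \<le> K (snd (snd w)) \<bullet> e}" for e :: 'a and k m :: nat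
  have Z_sets: "Z e k m \<in> sets borel" for e k m
  proof -
    let ?W = "{w :: 'a \<times> ('b \<times> 'b). norm w \<le> real k \<and> (fst w, fst (snd w)) \<in> S \<and> (fst w, snd (snd w)) \<in> S
      \<and> K (fst (snd w)) \<bullet> e + 1 / real (Suc m) \<le> K (snd (snd w)) \<bullet> e}"
    have "?W = cball 0 (real k) \<inter> ((\<lambda>w. (fst w, fst (snd w))) -` S) \<inter> ((\<lambda>w. (fst w, snd (snd w))) -` S)
      \<inter> {w. K (fst (snd w)) \<bullet> e + 1 / real (Suc m) \<le> K (snd (snd w)) \<bullet> e}" by auto
    moreover have "closed \<dots>"
      by (intro closed_Int closed_cball continuous_closed_vimage S closed_Collect_le continuous_intros
          continuous_on_compose2[OF contK] | auto)+
    ultimately have "closed ?W" by simp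
    moreover have "bounded ?W" by (rule boundedI[where B="real k"]) auto
    ultimately have "compact ?W" by (simp add: compact_eq_bounded_closed)
    then have "compact (Z e k m)" unfolding Z_def by (intro compact_continuous_image continuous_intros)
    then show ?thesis by (simp add: compact_imp_closed)
  qed
  have Z_null: "Z e k m \<in> null_sets lborel" for e k m
  proof (rule null_sets_if_lines_countable[OF Z_sets])
    fix x :: 'a
    let ?C = "{s::real. x + s *\<^sub>R e \<in> Z e k m}"
    (* a rational number strictly between two values at s labels the position s; monotonicity makes the labels increasing in s *)
    have "\<exists>q::rat. \<exists>y y'. (x + s *\<^sub>R e, y) \<in> S \<and> (x + s *\<^sub>R e, y') \<in> S \<and> K y \<bullet> e < of_rat q \<and> of_rat q < K y' \<bullet> e"
      if "s \<in> ?C" for s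
    proof -
      from that obtain y y' where "(x + s *\<^sub>R e, y) \<in> S" "(x + s *\<^sub>R e, y') \<in> S" and le: "K y \<bullet> e + 1 / real (Suc m) \<le> K y' \<bullet> e"
        unfolding Z_def by auto
      moreover have "K y \<bullet> e < K y' \<bullet> e" using le by (smt (verit) of_nat_0_less_iff zero_less_Suc zero_less_divide_1_iff)
      ultimately show ?thesis using of_rat_dense by blast
    qed
    then obtain q :: "real \<Rightarrow> rat" where q: "\<And>s. s \<in> ?C \<Longrightarrow> \<exists>y y'. (x + s *\<^sub>R e, y) \<in> S \<and> (x + s *\<^sub>R e, y') \<in> S
        \<and> K y \<bullet> e < of_rat (q s) \<and> of_rat (q s) < K y' \<bullet> e"
      by metis
    have less: "q s < q s'" if st: "s \<in> ?C" "s' \<in> ?C" "s < s'" for s s'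
    proof -
      obtain y' where y: "(x + s *\<^sub>R e, y') \<in> S" "of_rat (q s) < K y' \<bullet> e" using q[OF st(1)] by auto
      obtain y where y': "(x + s' *\<^sub>R e, y) \<in> S" "K y \<bullet> e < of_rat (q s')" using q[OF st(2)] by auto
      have "0 \<le> ((x + s' *\<^sub>R e) - (x + s *\<^sub>R e)) \<bullet> (K y - K y')" by (rule mono[OF y'(1) y(1)])
      also have "\<dots> = (s' - s) * (K y \<bullet> e - K y' \<bullet> e)"
        by (simp add: algebra_simps inner_diff_right inner_commute)
      finally have "K y' \<bullet> e \<le> K y \<bullet> e" using st(3) by (simp add: zero_le_mult_iff)
      then have "real_of_rat (q s) < real_of_rat (q s')" using y(2) y'(2) by linarith
      then show ?thesis by (simp add: of_rat_less)
    qed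
    have "inj_on q ?C"
    proof (rule inj_onI)
      fix s s' assume "s \<in> ?C" "s' \<in> ?C" "q s = q s'"
      then show "s = s'" using less[of s s'] less[of s' s] by (cases s s' rule: linorder_cases) auto
    qed
    then show "countable ?C" by (rule countableI')
  qed
  show thesis
  proof (rule that)
    show "(\<Union>e\<in>Basis. \<Union>k. \<Union>m. Z e k m) \<in> null_sets lborel"
      by (rule null_sets_UN' | rule Z_null | simp add: countable_finite)+
    fix x y y' assume x: "x \<notin> (\<Union>e\<in>Basis. \<Union>k. \<Union>m. Z e k m)" and S: "(x, y) \<in> S" "(x, y') \<in> S"
    have le: "K b \<bullet> e \<le> K a \<bullet> e" if "(x, a) \<in> S" "(x, b) \<in> S" "e \<in> Basis" for a b e
    proof (rule ccontr)
      assume "\<not> K b \<bullet> e \<le> K a \<bullet> e"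
      then have "0 < K b \<bullet> e - K a \<bullet> e" by simp
      then obtain m where m: "1 / real (Suc m) < K b \<bullet> e - K a \<bullet> e"
        using nat_approx_posE by blast
      obtain k :: nat where k: "norm (x, (a, b)) \<le> real k" using real_arch_simple by blast
      have "x \<in> Z e k m" unfolding Z_def
        by (rule image_eqI[where x="(x, (a, b))"]) (use m k that in auto)
      then show False using x that by blast
    qed
    have "K y = K y'" by (rule euclidean_eqI) (use le S in \<open>auto intro!: antisym\<close>)
    then show "y = y'" using inj by (auto dest: injD)
  qed
qed

text \<open>
  Over the complement of \<open>N\<close> the closed set is the graph of a map; the map is Borel because preimages of closed sets are projections of \<open>\<sigma>\<close>-compact sets. A coupling carried by a graph is determined by its first marginal.
\<close>

lemma coupling_eq_graph:
  fixes P :: "('a::euclidean_space \<times> 'b::euclidean_space) measure"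
  assumes S: "closed S" and N: "N \<in> sets borel" "emeasure \<mu> N = 0"
    and single: "\<And>x y y'. x \<notin> N \<Longrightarrow> (x, y) \<in> S \<Longrightarrow> (x, y') \<in> S \<Longrightarrow> y = y'"
    and P: "prob_space P" "sets P = sets borel" "distr P borel fst = \<mu>" "AE p in P. p \<in> S"
    and Q: "prob_space Q" "sets Q = sets borel" "distr Q borel fst = \<mu>" "AE p in Q. p \<in> S"
  shows "P = Q"
proof -
  define D where "D = fst ` S - N"
  define T where "T x = (if x \<in> D then (THE y. (x, y) \<in> S) else 0)" for x
  have T: "T x = y" if "(x, y) \<in> S" "x \<notin> N" for x y
  proof -
    have "(THE y. (x, y) \<in> S) = y" using that single by blast
    moreover have "x \<in> D" using that unfolding D_def by force
    ultimately show ?thesis by (simp add: T_def)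
  qed
  have proj: "fst ` (S \<inter> UNIV \<times> C) \<in> sets borel" if C: "closed C" for C
  proof -
    have cl: "closed (S \<inter> UNIV \<times> C)" by (intro closed_Int S closed_Times C) auto
    have "fst ` (S \<inter> UNIV \<times> C) = (\<Union>k::nat. fst ` ((S \<inter> UNIV \<times> C) \<inter> cball 0 (real k)))"
      using closed_sigma_compact[OF cl] by (metis image_UN)
    moreover have "compact (fst ` ((S \<inter> UNIV \<times> C) \<inter> cball 0 (real k)))" for k :: nat
      by (intro compact_continuous_image continuous_intros closed_Int_compact[OF cl] compact_cball)
    ultimately show ?thesis by (simp add: borel_closed compact_imp_closed sets.countable_UN)
  qed
  have D_sets: "D \<in> sets borel" unfolding D_def using proj[of UNIV] N by simp
  have T_meas [measurable]: "T \<in> borel_measurable borel"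
  proof (rule borel_measurableI)
    fix U :: "'b set" assume U: "open U"
    define C where "C = - U"
    have C: "closed C" using U by (simp add: C_def closed_Compl)
    have "T -` C = (fst ` (S \<inter> UNIV \<times> C) - N) \<union> (if 0 \<in> C then - D else {})"
    proof (intro set_eqI)
      fix x
      show "x \<in> T -` C \<longleftrightarrow> x \<in> (fst ` (S \<inter> UNIV \<times> C) - N) \<union> (if 0 \<in> C then - D else {})"
      proof (cases "x \<in> D")
        case True
        then obtain y where y: "(x, y) \<in> S" "x \<notin> N" unfolding D_def by auto
        then have "T x = y" by (rule T)
        moreover have "x \<in> fst ` (S \<inter> UNIV \<times> C) \<longleftrightarrow> y \<in> C"
        proof
          assume "x \<in> fst ` (S \<inter> UNIV \<times> C)"
          then obtain y' where "(x, y') \<in> S" "y' \<in> C" by auto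
          then show "y \<in> C" using single y by metis
        next
          assume "y \<in> C"
          then have "(x, y) \<in> S \<inter> UNIV \<times> C" using y by simp
          then show "x \<in> fst ` (S \<inter> UNIV \<times> C)" by (rule image_eqI[rotated]) simp
        qed
        ultimately show ?thesis using True y by auto
      next
        case False
        then have "x \<notin> fst ` (S \<inter> UNIV \<times> C) - N" unfolding D_def by auto
        then show ?thesis using False by (simp add: T_def)
      qed
    qed
    then have "T -` C \<in> sets borel" using proj[OF C] N(1) D_sets by auto
    moreover have "T -` U \<inter> space borel = - (T -` C)" by (auto simp: C_def)
    ultimately show "T -` U \<inter> space borel \<in> sets borel" by simp
  qed
  have graph: "R = distr \<mu> borel (\<lambda>x. (x, T x))"
    if R: "prob_space R" "sets R = sets borel" "distr R borel fst = \<mu>" "AE p in R. p \<in> S" for R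
  proof -
    note [measurable_cong] = R(2)
    have fst_meas: "fst \<in> R \<rightarrow>\<^sub>M borel" using R(2) by (simp cong: measurable_cong_sets add: borel_measurable_continuous_onI continuous_on_fst)
    have "emeasure R (fst -` N \<inter> space R) = 0"
      using N R(3) emeasure_distr[OF fst_meas N(1)] by simp
    then have "AE p in R. fst p \<notin> N"
      using measurable_sets[OF fst_meas N(1)] by (intro AE_I[where N="fst -` N \<inter> space R"]) auto
    with R(4) have ae: "AE p in R. p = (fst p, T (fst p))"
      by eventually_elim (metis T prod.collapse)
    have "R = distr R R (\<lambda>p. p)" by simp
    also have "\<dots> = distr R borel (\<lambda>p. (fst p, T (fst p)))"
    proof (rule distr_cong_AE)
      show "AE x in R. x = (fst x, T (fst x))" by (rule ae)
      show "(\<lambda>p. (fst p, T (fst p))) \<in> R \<rightarrow>\<^sub>M borel"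
        using fst_meas by (intro borel_measurable_Pair measurable_compose[OF fst_meas T_meas]) auto
    qed (use R(2) in auto)
    also have "\<dots> = distr (distr R borel fst) borel (\<lambda>x. (x, T x))"
      using fst_meas by (subst distr_distr) (auto simp: comp_def intro!: borel_measurable_Pair)
    finally show ?thesis using R(3) by simp
  qed
  show ?thesis using graph[OF P] graph[OF Q] by simp
qed

section \<open>Small-noise limits of Gibbs measures\<close>

definition support :: "'a::topological_space measure \<Rightarrow> 'a set" where
  "support \<mu> = {x. \<forall>U. open U \<longrightarrow> x \<in> U \<longrightarrow> 0 < measure \<mu> U}"

lemma AE_support:
  fixes \<mu> :: "'a::second_countable_topology measure"
  assumes "finite_measure \<mu>" and sets: "sets \<mu> = sets borel"
  shows "AE x in \<mu>. x \<in> support \<mu>"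
proof -
  interpret finite_measure \<mu> by fact
  let ?F = "{U. open U \<and> measure \<mu> U = 0}"
  obtain F where F: "F \<subseteq> ?F" "countable F" "\<Union>F = \<Union>?F"
    using Lindelof[of ?F] by auto
  have "\<Union>F \<in> null_sets \<mu>"
  proof (rule null_sets_UN'[of F "\<lambda>U. U", simplified])
    show "U \<in> null_sets \<mu>" if "U \<in> F" for U
      using that F(1) sets by (intro null_setsI) (auto simp: emeasure_eq_measure)
  qed (use F in auto)
  then have "AE x in \<mu>. x \<notin> \<Union>F" by (rule AE_not_in)
  then show ?thesis
    unfolding F(3) by eventually_elim (auto simp: support_def zero_less_measure_iff less_le)
qed

text \<open>
  The mass of a rectangle is a product \<open>F * G\<close> that separates the two sides, up to the oscillation of the kernel.
\<close>

lemma gibbs_rectangle_bounds: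
  fixes f :: "'a::euclidean_space \<Rightarrow> ennreal" and g :: "'b::euclidean_space \<Rightarrow> ennreal"
  assumes [measurable]: "f \<in> borel_measurable borel" "g \<in> borel_measurable borel"
    "(\<lambda>p. k (fst p) (snd p)) \<in> borel_measurable borel" "U \<in> sets borel" "V \<in> sets borel"
    and k: "\<And>x y. x \<in> U \<Longrightarrow> y \<in> V \<Longrightarrow> l \<le> k x y" "\<And>x y. x \<in> U \<Longrightarrow> y \<in> V \<Longrightarrow> k x y \<le> h"
  defines "P \<equiv> density lborel (\<lambda>(x, y). ennreal (k x y) * f x * g y)"
    and "F \<equiv> \<integral>\<^sup>+x. f x * indicator U x \<partial>lborel" and "G \<equiv> \<integral>\<^sup>+y. g y * indicator V y \<partial>lborel"
  shows "ennreal l * (F * G) \<le> emeasure P (U \<times> V)" "emeasure P (U \<times> V) \<le> ennreal h * (F * G)"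
proof -
  have UV [measurable]: "U \<times> V \<in> sets (borel :: ('a \<times> 'b) measure)"
    by (simp add: borel_prod[symmetric])
  define \<gamma> where "\<gamma> p = f (fst p) * g (snd p) * indicator (U \<times> V) p" for p
  have [measurable]: "\<gamma> \<in> borel_measurable borel"
    unfolding \<gamma>_def by (intro borel_measurable_times_ennreal measurable_compose[OF _ assms(1)] measurable_compose[OF _ assms(2)]) 
      (auto intro!: borel_measurable_continuous_onI continuous_intros)
  have "(\<integral>\<^sup>+p. \<gamma> p \<partial>lborel) = (\<integral>\<^sup>+x. (\<integral>\<^sup>+y. (f x * indicator U x) * (g y * indicator V y) \<partial>lborel) \<partial>lborel)"
    unfolding lborel_prod[symmetric]
    by (subst lborel.nn_integral_fst[symmetric])
      (auto simp: \<gamma>_def lborel_prod indicator_times ac_simps intro!: nn_integral_cong)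
  also have "\<dots> = F * G"
    unfolding F_def G_def by (subst nn_integral_cmult) (auto simp: nn_integral_multc)
  finally have FG: "(\<integral>\<^sup>+p. \<gamma> p \<partial>lborel) = F * G" .
  have f2 [measurable]: "(\<lambda>p::'a \<times> 'b. f (fst p)) \<in> borel_measurable borel"
    by (rule measurable_compose[OF _ assms(1)]) (auto intro!: borel_measurable_continuous_onI continuous_intros)
  have g2 [measurable]: "(\<lambda>p::'a \<times> 'b. g (snd p)) \<in> borel_measurable borel"
    by (rule measurable_compose[OF _ assms(2)]) (auto intro!: borel_measurable_continuous_onI continuous_intros)
  have P: "emeasure P (U \<times> V) = (\<integral>\<^sup>+p. ennreal (k (fst p) (snd p)) * \<gamma> p \<partial>lborel)"
    unfolding P_def case_prod_unfold
    by (subst emeasure_density) (auto simp: \<gamma>_def ac_simps intro!: nn_integral_cong)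
  have low: "ennreal l * \<gamma> p \<le> ennreal (k (fst p) (snd p)) * \<gamma> p"
    and high: "ennreal (k (fst p) (snd p)) * \<gamma> p \<le> ennreal h * \<gamma> p" for p
  proof -
    have "ennreal l * \<gamma> p \<le> ennreal (k (fst p) (snd p)) * \<gamma> p \<and> ennreal (k (fst p) (snd p)) * \<gamma> p \<le> ennreal h * \<gamma> p"
    proof (cases "p \<in> U \<times> V")
      case True
      then show ?thesis by (intro conjI mult_right_mono ennreal_leI k) auto
    qed (simp add: \<gamma>_def)
    then show "ennreal l * \<gamma> p \<le> ennreal (k (fst p) (snd p)) * \<gamma> p"
      "ennreal (k (fst p) (snd p)) * \<gamma> p \<le> ennreal h * \<gamma> p" by simp_all
  qed
  show "ennreal l * (F * G) \<le> emeasure P (U \<times> V)"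
    unfolding P FG[symmetric] by (subst nn_integral_cmult[symmetric]) (auto intro!: nn_integral_mono low)
  show "emeasure P (U \<times> V) \<le> ennreal h * (F * G)"
    unfolding P FG[symmetric] by (subst nn_integral_cmult[symmetric]) (auto intro!: nn_integral_mono high)
qed

lemma exp_neg_inverse_tendsto_0:
  assumes "0 < (a::real)" "\<And>k. 0 < \<epsilon> k" "\<epsilon> \<longlonglongrightarrow> 0"
  shows "(\<lambda>k. exp (- a * inverse (\<epsilon> k))) \<longlonglongrightarrow> 0"
proof -
  have "filterlim \<epsilon> (at_right 0) sequentially"
    using assms by (auto simp: filterlim_at intro!: always_eventually less_imp_neq[symmetric])
  then have "filterlim (\<lambda>k. inverse (\<epsilon> k)) at_top sequentially"
    by (rule filterlim_compose[OF filterlim_inverse_at_top_right])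
  then have "filterlim (\<lambda>k. a * inverse (\<epsilon> k)) at_top sequentially"
    using assms by (intro filterlim_tendsto_pos_mult_at_top[OF tendsto_const]) auto
  then have "filterlim (\<lambda>k. - a * inverse (\<epsilon> k)) at_bot sequentially"
    by (simp add: filterlim_uminus_at_top)
  then show ?thesis by (rule filterlim_compose[OF exp_at_bot])
qed

text \<open>
  A violated cycle inequality with gap \<open>\<Delta>\<close> persists on small rectangles around the points. There the product of the masses
  of the rectangles is at most \<open>exp (- \<Delta> / (2 \<epsilon>))\<close> times the product for the shifted rectangles, because the factors \<open>F\<close> and \<open>G\<close> occur
  equally often in both. So the product tends to \<open>0\<close>, whereas each factor stays bounded below by the portmanteau inequality.
\<close>

theorem gibbs_limit_support_cyclically_monotone:
  fixes P :: "nat \<Rightarrow> ('a::euclidean_space \<times> 'b::euclidean_space) measure"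
  assumes cont: "continuous_on UNIV (\<lambda>p. c (fst p) (snd p))"
    and P: "\<And>k. P k = density lborel (\<lambda>(x, y). ennreal (C k * exp (- c x y / \<epsilon> k)) * f k x * g k y)"
    and meas: "\<And>k. f k \<in> borel_measurable borel" "\<And>k. g k \<in> borel_measurable borel"
    and pos: "\<And>k. 0 < C k" "\<And>k. 0 < \<epsilon> k" and \<epsilon>: "\<epsilon> \<longlonglongrightarrow> 0"
    and prob: "\<And>k. prob_space (P k)"
    and \<mu>: "prob_space \<mu>" "sets \<mu> = sets borel" and conv: "weakly_converges P \<mu> sequentially"
  shows "cyclically_monotone c (support \<mu>)"
  unfolding cyclically_monotone_def
proof (intro allI impI, rule ccontr)
  fix n and z :: "nat \<Rightarrow> 'a \<times> 'b"
  assume z: "\<forall>i\<le>n. z i \<in> support \<mu>"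
    and neg: "\<not> (\<Sum>i\<le>n. c (fst (z i)) (snd (z i)))
       \<le> (\<Sum>i<n. c (fst (z (Suc i))) (snd (z i))) + c (fst (z 0)) (snd (z n))"
  define a where "a i j = c (fst (z i)) (snd (z j))" for i j
  (* the cyclic shift of the indices 0, ..., n *)
  define s where "s j = (if j < n then Suc j else 0)" for j
  have s_bij: "bij_betw s {..n} {..n}"
    by (rule bij_betw_byWitness[where f'="\<lambda>i. if i = 0 then n else i - 1"]) (auto simp: s_def)
  have off: "(\<Sum>i<n. c (fst (z (Suc i))) (snd (z i))) + c (fst (z 0)) (snd (z n)) = (\<Sum>j\<le>n. a (s j) j)"
    by (simp add: a_def s_def flip: lessThan_Suc_atMost)
  define \<Delta> where "\<Delta> = (\<Sum>i\<le>n. a i i) - (\<Sum>j\<le>n. a (s j) j)"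
  have \<Delta>: "0 < \<Delta>" using neg unfolding off \<Delta>_def by (simp add: a_def)
  (* two families of n + 1 rectangles, each with error \<eta> per rectangle, use up half of the gap *)
  define \<eta> where "\<eta> = \<Delta> / (4 * real (Suc n))"
  have \<eta>: "0 < \<eta>" using \<Delta> by (simp add: \<eta>_def)
  have "\<exists>\<delta>>0. \<forall>p. dist p (fst (z i), snd (z j)) < \<delta> \<longrightarrow> \<bar>c (fst p) (snd p) - a i j\<bar> < \<eta>" for i j
  proof -
    have "isCont (\<lambda>p. c (fst p) (snd p)) (fst (z i), snd (z j))"
      using cont by (simp add: continuous_on_eq_continuous_at)
    then show ?thesis using \<eta> unfolding a_def continuous_at_eps_delta dist_real_def fst_conv snd_conv by blast
  qed
  then obtain \<delta> where \<delta>: "\<And>i j. 0 < \<delta> i j"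
    "\<And>i j p. dist p (fst (z i), snd (z j)) < \<delta> i j \<Longrightarrow> \<bar>c (fst p) (snd p) - a i j\<bar> < \<eta>"
    by metis
  define d where "d = Min ((\<lambda>(i, j). \<delta> i j) ` ({..n} \<times> {..n}))"
  have d: "0 < d" "\<And>i j. i \<le> n \<Longrightarrow> j \<le> n \<Longrightarrow> d \<le> \<delta> i j"
    unfolding d_def using \<delta>(1) by (auto simp: Min_gr_iff intro!: Min_le)
  define U where "U i = ball (fst (z i)) (d / 2)" for i
  define V where "V j = ball (snd (z j)) (d / 2)" for j
  have near: "\<bar>c x y - a i j\<bar> < \<eta>" if "x \<in> U i" "y \<in> V j" "i \<le> n" "j \<le> n" for x y i j
  proof -
    have "dist (x, y) (fst (z i), snd (z j)) \<le> dist x (fst (z i)) + dist y (snd (z j))"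
      unfolding dist_Pair_Pair by (rule sqrt_sum_squares_le_sum) auto
    also have "\<dots> < d" using that by (simp add: U_def V_def dist_commute)
    also have "d \<le> \<delta> i j" using d that by simp
    finally show ?thesis using \<delta>(2)[of "(x, y)" i j] by simp
  qed
  define m where "m i = measure \<mu> (U i \<times> V i) / 2" for i
  have UV_open: "open (U i \<times> V j)" for i j by (auto simp: U_def V_def open_Times)
  have mpos: "0 < measure \<mu> (U i \<times> V i)" if "i \<le> n" for i
  proof -
    have "z i \<in> U i \<times> V i" using d(1) by (simp add: U_def V_def mem_Times_iff)
    moreover have "z i \<in> support \<mu>" using z that by simp
    ultimately show ?thesis using UV_open[of i i] unfolding support_def by simp
  qed
  have sets_P: "sets (P k) = sets borel" for k by (simp add: P)
  have "\<forall>\<^sub>F k in sequentially. m i < measure (P k) (U i \<times> V i)" if "i \<le> n" for i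
    using mpos[OF that] by (intro weakly_converges_open_liminf[OF conv \<mu> prob sets_P UV_open]) (simp add: m_def)
  then have "\<forall>\<^sub>F k in sequentially. \<forall>i\<in>{..n}. m i < measure (P k) (U i \<times> V i)"
    by (simp add: eventually_ball_finite)
  moreover have "\<forall>\<^sub>F k in sequentially. exp (- (\<Delta> / 2) / \<epsilon> k) < (\<Prod>i\<le>n. m i)"
  proof -
    have "(\<lambda>k. exp (- (\<Delta> / 2) * inverse (\<epsilon> k))) \<longlonglongrightarrow> 0"
      using \<Delta> pos(2) \<epsilon> by (intro exp_neg_inverse_tendsto_0) auto
    moreover have "0 < (\<Prod>i\<le>n. m i)" using mpos by (auto simp: m_def intro!: prod_pos)
    ultimately show ?thesis by (auto dest!: order_tendstoD(2) simp: field_simps)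
  qed
  ultimately have "\<forall>\<^sub>F k in sequentially. False"
  proof eventually_elim
    case (elim k)
    interpret Pk: prob_space "P k" by (rule prob)
    define F where "F i = (\<integral>\<^sup>+x. f k x * indicator (U i) x \<partial>lborel)" for i
    define G where "G j = (\<integral>\<^sup>+y. g k y * indicator (V j) y \<partial>lborel)" for j
    have c_meas: "(\<lambda>p. C k * exp (- c (fst p) (snd p) / \<epsilon> k)) \<in> borel_measurable borel"
      using pos(2)[of k] by (intro borel_measurable_continuous_onI continuous_intros cont) auto
    have lo: "C k * exp (- (a i j + \<eta>) / \<epsilon> k) \<le> C k * exp (- c x y / \<epsilon> k)"
      and hi: "C k * exp (- c x y / \<epsilon> k) \<le> C k * exp (- (a i j - \<eta>) / \<epsilon> k)"
      if "i \<le> n" "j \<le> n" "x \<in> U i" "y \<in> V j" for i j x y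
    proof -
      have "- (a i j + \<eta>) / \<epsilon> k \<le> - c x y / \<epsilon> k" "- c x y / \<epsilon> k \<le> - (a i j - \<eta>) / \<epsilon> k"
        using near[OF that(3,4,1,2)] pos(2)[of k] by (simp_all only: divide_le_cancel) linarith+
      then show "C k * exp (- (a i j + \<eta>) / \<epsilon> k) \<le> C k * exp (- c x y / \<epsilon> k)"
        "C k * exp (- c x y / \<epsilon> k) \<le> C k * exp (- (a i j - \<eta>) / \<epsilon> k)"
        using pos(1)[of k] by (simp_all add: mult_left_mono)
    qed
    have lower: "ennreal (C k * exp (- (a i j + \<eta>) / \<epsilon> k)) * (F i * G j) \<le> emeasure (P k) (U i \<times> V j)"
      and upper: "emeasure (P k) (U i \<times> V j) \<le> ennreal (C k * exp (- (a i j - \<eta>) / \<epsilon> k)) * (F i * G j)"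
      if "i \<le> n" "j \<le> n" for i j
    proof -
      have "U i \<in> sets borel" "V j \<in> sets borel" by (simp_all add: U_def V_def)
      note bounds = gibbs_rectangle_bounds[OF meas(1)[of k] meas(2)[of k] c_meas this lo[OF that] hi[OF that], folded P]
      show "ennreal (C k * exp (- (a i j + \<eta>) / \<epsilon> k)) * (F i * G j) \<le> emeasure (P k) (U i \<times> V j)"
        "emeasure (P k) (U i \<times> V j) \<le> ennreal (C k * exp (- (a i j - \<eta>) / \<epsilon> k)) * (F i * G j)"
        unfolding F_def G_def by (rule bounds(1), assumption+, rule bounds(2), assumption+)
    qed
    have const_prod: "(\<Prod>j\<le>n. ennreal (C k * exp (- b j / \<epsilon> k))) = ennreal (C k ^ Suc n * exp (- (\<Sum>j\<le>n. b j) / \<epsilon> k))" for b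
    proof -
      have "(\<Prod>j\<le>n. ennreal (C k * exp (- b j / \<epsilon> k))) = ennreal (\<Prod>j\<le>n. C k * exp (- b j / \<epsilon> k))"
        using pos(1)[of k] by (intro prod_ennreal) (simp add: less_imp_le)
      also have "(\<Prod>j\<le>n. C k * exp (- b j / \<epsilon> k)) = C k ^ Suc n * exp (\<Sum>j\<le>n. - b j / \<epsilon> k)"
        by (simp add: prod.distrib exp_sum)
      finally show ?thesis by (simp add: sum_negf sum_divide_distrib)
    qed
    let ?X = "(\<Prod>i\<le>n. F i) * (\<Prod>i\<le>n. G i)"
    have "(\<Prod>i\<le>n. emeasure (P k) (U i \<times> V i)) \<le> (\<Prod>i\<le>n. ennreal (C k * exp (- (a i i - \<eta>) / \<epsilon> k)) * (F i * G i))"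
      using upper by (intro prod_mono_ennreal) auto
    also have "\<dots> = ennreal (C k ^ Suc n * exp (- (\<Sum>i\<le>n. a i i - \<eta>) / \<epsilon> k)) * ?X"
      by (simp only: prod.distrib const_prod)
    also have "C k ^ Suc n * exp (- (\<Sum>i\<le>n. a i i - \<eta>) / \<epsilon> k)
        = exp (- (\<Delta> / 2) / \<epsilon> k) * (C k ^ Suc n * exp (- (\<Sum>j\<le>n. a (s j) j + \<eta>) / \<epsilon> k))"
    proof -
      have "real (Suc n) * \<eta> = \<Delta> / 4" unfolding \<eta>_def by (simp del: of_nat_Suc)
      then have "(\<Sum>i\<le>n. a i i - \<eta>) = \<Delta> / 2 + (\<Sum>j\<le>n. a (s j) j + \<eta>)"
        by (simp add: sum.distrib sum_subtractf \<Delta>_def del: of_nat_Suc) (simp add: field_simps)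
      then show ?thesis by (simp add: exp_add[symmetric] add_divide_distrib diff_divide_distrib)
    qed
    also have "ennreal \<dots> * ?X = ennreal (exp (- (\<Delta> / 2) / \<epsilon> k)) * (ennreal (C k ^ Suc n * exp (- (\<Sum>j\<le>n. a (s j) j + \<eta>) / \<epsilon> k)) * ?X)"
      using pos(1)[of k] by (simp add: ennreal_mult mult.assoc)
    also have "ennreal (C k ^ Suc n * exp (- (\<Sum>j\<le>n. a (s j) j + \<eta>) / \<epsilon> k)) * ?X
        = (\<Prod>j\<le>n. ennreal (C k * exp (- (a (s j) j + \<eta>) / \<epsilon> k)) * (F (s j) * G j))"
      using prod.reindex_bij_betw[OF s_bij, of F] by (simp only: prod.distrib const_prod)
    also have "\<dots> \<le> (\<Prod>j\<le>n. emeasure (P k) (U (s j) \<times> V j))"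
      using lower by (intro prod_mono_ennreal) (auto simp: s_def)
    also have "\<dots> \<le> (\<Prod>j\<le>n. 1)"
      by (intro prod_mono_ennreal) (auto simp: Pk.emeasure_eq_measure Pk.prob_le_1)
    finally have "(\<Prod>i\<le>n. emeasure (P k) (U i \<times> V i)) \<le> ennreal (exp (- (\<Delta> / 2) / \<epsilon> k))"
      by (simp add: mult_left_mono)
    then have "ennreal (\<Prod>i\<le>n. measure (P k) (U i \<times> V i)) \<le> ennreal (exp (- (\<Delta> / 2) / \<epsilon> k))"
      by (simp add: Pk.emeasure_eq_measure prod_ennreal)
    then have "(\<Prod>i\<le>n. measure (P k) (U i \<times> V i)) \<le> exp (- (\<Delta> / 2) / \<epsilon> k)"
      by (simp add: ennreal_le_iff)
    moreover have "(\<Prod>i\<le>n. m i) \<le> (\<Prod>i\<le>n. measure (P k) (U i \<times> V i))"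
      using elim(1) by (intro prod_mono) (auto simp: m_def less_imp_le)
    ultimately show ?case using elim(2) by linarith
  qed
  then show False by simp
qed

section \<open>State transition matrices and Gramians\<close>

lemma bounded_bilinear_matrix_mult: "bounded_bilinear (\<lambda>(A::real^'n^'m) (B::real^'k^'n). A ** B)"
  unfolding bilinear_conv_bounded_bilinear[symmetric] bilinear_def
  by (auto intro!: linearI simp: matrix_matrix_mult_def vec_eq_iff algebra_simps sum.distrib sum_distrib_left)

lemma bounded_linear_matrix_mult_left: "bounded_linear (\<lambda>A::real^'n^'m. A ** (B::real^'k^'n))"
  by (rule bounded_bilinear.bounded_linear_left[OF bounded_bilinear_matrix_mult])

lemma bounded_linear_matrix_mult_right: "bounded_linear (\<lambda>B::real^'k^'n. (A::real^'n^'m) ** B)"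
  by (rule bounded_bilinear.bounded_linear_right[OF bounded_bilinear_matrix_mult])

lemma bounded_linear_transpose: "bounded_linear (transpose :: real^'n^'m \<Rightarrow> real^'m^'n)"
  unfolding linear_conv_bounded_linear[symmetric]
  by (auto intro!: linearI simp: transpose_def vec_eq_iff)

lemma bounded_linear_quadratic_form: "bounded_linear (\<lambda>A::real^'n^'m. u \<bullet> (A *v w))"
  unfolding linear_conv_bounded_linear[symmetric]
  by (auto intro!: linearI simp: matrix_vector_mult_add_rdistrib inner_add_right scaleR_matrix_vector_assoc[symmetric])

lemma inner_matrix_vector: "u \<bullet> ((A::real^'n^'m) *v w) = (transpose A *v u) \<bullet> w"
  by (metis dot_lmul_matrix inner_commute transpose_matrix_vector)

lemma nonneg_slope_imp_mono:
  fixes g :: "real \<Rightarrow> real"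
  assumes "a \<le> b" and "\<And>x. x \<in> {a..b} \<Longrightarrow> (g has_real_derivative g' x) (at x within {a..b})"
    and "\<And>x. x \<in> {a..b} \<Longrightarrow> 0 \<le> g' x"
  shows "g a \<le> g b"
proof -
  have "\<exists>x\<in>{a..b}. g b - g a = g' x * (b - a)"
    using assms by (intro mvt_very_simple) (auto simp: has_field_derivative_def)
  then show ?thesis using assms by (metis diff_ge_0_iff_ge mult_nonneg_nonneg)
qed

text \<open>
  Gronwall's argument: with \<open>L\<close> a bound for the operator, \<open>exp (- 2 L t) |X t|\<^sup>2\<close> is nonincreasing and \<open>exp (2 L t) |X t|\<^sup>2\<close> is nondecreasing, which settles the times after and before \<open>t0\<close>.
\<close>

lemma linear_ode_zero:
  fixes A X :: "real \<Rightarrow> real^'n^'n"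
  assumes A: "continuous_on {0..1} A" and t0: "t0 \<in> {0..1}" "X t0 = 0"
    and X: "\<And>t. t \<in> {0..1} \<Longrightarrow> (X has_vector_derivative A t ** X t) (at t within {0..1})"
    and t: "t \<in> {0..1}"
  shows "X t = 0"
proof -
  obtain K where K: "0 < K" "\<And>(a::real^'n^'n) (b::real^'n^'n). norm (a ** b) \<le> norm a * norm b * K"
    using bounded_bilinear.pos_bounded[OF bounded_bilinear_matrix_mult] by blast
  have "bounded (A ` {0..1})" by (intro compact_imp_bounded compact_continuous_image A) simp
  then obtain L0 where L0: "0 < L0" "\<And>t. t \<in> {0..1} \<Longrightarrow> norm (A t) \<le> L0"
    unfolding bounded_pos by auto
  define L where "L = L0 * K"
  have AX: "\<bar>X t \<bullet> (A t ** X t)\<bar> \<le> L * (X t \<bullet> X t)" if "t \<in> {0..1}" for t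
  proof -
    have "\<bar>X t \<bullet> (A t ** X t)\<bar> \<le> norm (X t) * norm (A t ** X t)" by (rule Cauchy_Schwarz_ineq2)
    also have "\<dots> \<le> norm (X t) * (L0 * norm (X t) * K)"
      using K L0(2)[OF that] by (intro mult_left_mono order_trans[OF K(2)] mult_right_mono) auto
    also have "\<dots> = L * (X t \<bullet> X t)" by (simp add: L_def power2_norm_eq_inner[symmetric] power2_eq_square)
    finally show ?thesis .
  qed
  (* the sign \<sigma> treats both time directions at once: in either case the function is nondecreasing *)
  define g where "g \<sigma> t = \<sigma> * exp (2 * \<sigma> * L * t) * (X t \<bullet> X t)" for \<sigma> t
  define g' where "g' \<sigma> t = exp (2 * \<sigma> * L * t) * (2 * \<sigma> * \<sigma> * L * (X t \<bullet> X t) + 2 * \<sigma> * (X t \<bullet> (A t ** X t)))" for \<sigma> t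
  have g_deriv: "(g \<sigma> has_real_derivative g' \<sigma> t) (at t within {a..b})" if "t \<in> {a..b}" "{a..b} \<subseteq> {0..1}" for \<sigma> t a b
  proof -
    have "(X has_derivative (\<lambda>h. h *\<^sub>R (A t ** X t))) (at t within {a..b})"
      using X[of t] that unfolding has_vector_derivative_def by (auto intro: has_derivative_subset)
    note dX [derivative_intros] = this
    show ?thesis unfolding g_def has_field_derivative_def
      by (rule derivative_eq_intros refl | simp)+
        (auto simp: fun_eq_iff g'_def inner_commute algebra_simps)
  qed
  have g'_nonneg: "0 \<le> g' \<sigma> t" if "t \<in> {0..1}" "\<sigma> = 1 \<or> \<sigma> = -1" for \<sigma> t
    using AX[OF that(1)] that(2) unfolding g'_def by (intro mult_nonneg_nonneg) (auto simp: abs_le_iff)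
  have "X t \<bullet> X t \<le> 0"
  proof (cases "t0 \<le> t")
    case True
    have "g (-1) t0 \<le> g (-1) t"
      using True t t0 by (intro nonneg_slope_imp_mono[OF True g_deriv g'_nonneg]) auto
    then show ?thesis using t0(2) by (simp add: g_def mult_le_0_iff)
  next
    case False
    then have "g 1 t \<le> g 1 t0"
      using t t0 by (intro nonneg_slope_imp_mono[OF _ g_deriv g'_nonneg]) auto
    then show ?thesis using t0(2) by (simp add: g_def mult_le_0_iff)
  qed
  then show ?thesis by (metis inner_eq_zero_iff inner_ge_zero antisym)
qed

text \<open>
  As functions of \<open>t\<close> both sides solve the same linear equation and agree at \<open>t = s\<close>.
\<close>

lemma state_transition_compose:
  assumes \<Phi>: "state_transition A \<Phi>" and A: "continuous_on {0..1} A"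
    and "t \<in> {0..1}" "s \<in> {0..1}" "r \<in> {0..1}"
  shows "\<Phi> t s ** \<Phi> s r = \<Phi> t r"
proof -
  have d: "((\<lambda>r. \<Phi> r s) has_vector_derivative A t ** \<Phi> t s) (at t within {0..1})" if "s \<in> {0..1}" "t \<in> {0..1}" for s t
    using \<Phi> that by (auto simp: state_transition_def)
  define Y where "Y u = \<Phi> u s ** \<Phi> s r - \<Phi> u r" for u
  have "Y s = 0" using assms by (simp add: Y_def state_transition_def)
  moreover have "(Y has_vector_derivative A u ** Y u) (at u within {0..1})" if u: "u \<in> {0..1}" for u
  proof -
    have "(Y has_vector_derivative A u ** \<Phi> u s ** \<Phi> s r - A u ** \<Phi> u r) (at u within {0..1})"
      unfolding Y_def using assms u
      by (intro has_vector_derivative_diff d bounded_linear.has_vector_derivative[OF bounded_linear_matrix_mult_left]) auto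
    then show ?thesis
      by (simp add: Y_def matrix_mul_assoc bounded_bilinear.diff_right[OF bounded_bilinear_matrix_mult])
  qed
  ultimately have "Y t = 0" using assms by (intro linear_ode_zero[OF A]) auto
  then show ?thesis by (simp add: Y_def)
qed

lemma state_transition_inverse:
  assumes "state_transition A \<Phi>" "continuous_on {0..1} A" "t \<in> {0..1}" "s \<in> {0..1}"
  shows "\<Phi> t s ** \<Phi> s t = mat 1"
  using state_transition_compose[OF assms(1,2), of t s t] assms by (simp add: state_transition_def)

definition pos_def :: "real^'n^'n \<Rightarrow> bool" where
  "pos_def M \<longleftrightarrow> transpose M = M \<and> (\<forall>v. v \<noteq> 0 \<longrightarrow> 0 < v \<bullet> (M *v v))"

lemma
  assumes "invertible (M :: real^'n^'n)"
  shows matrix_inv_right: "M ** matrix_inv M = mat 1" and matrix_inv_left: "matrix_inv M ** M = mat 1"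
  using someI_ex[OF assms[unfolded invertible_def]] unfolding matrix_inv_def by simp_all

lemma matrix_inv_vector:
  assumes "invertible (M :: real^'n^'n)"
  shows "M *v (matrix_inv M *v v) = v" "matrix_inv M *v (M *v v) = v"
  using matrix_inv_right[OF assms] matrix_inv_left[OF assms] by (simp_all add: matrix_vector_mul_assoc)

lemma symmetric_inner:
  "transpose (M :: real^'n^'n) = M \<Longrightarrow> u \<bullet> (M *v w) = (M *v u) \<bullet> w"
  by (metis inner_matrix_vector)

lemma pos_def_invertible:
  assumes "pos_def M" shows "invertible M"
proof -
  have "M *v v = 0 \<Longrightarrow> v = 0" for v
    using assms unfolding pos_def_def by (metis inner_zero_right less_irrefl)
  then show ?thesis by (simp add: invertible_left_inverse matrix_left_invertible_ker)
qed

lemma transpose_matrix_inv: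
  assumes "invertible (M :: real^'n^'n)" "transpose M = M"
  shows "transpose (matrix_inv M) = matrix_inv M"
proof -
  have "transpose (matrix_inv M) ** M = mat 1"
    by (metis assms matrix_inv_right matrix_transpose_mul transpose_mat)
  then have "transpose (matrix_inv M) ** M ** matrix_inv M = matrix_inv M" by simp
  then show ?thesis
    by (simp add: matrix_mul_assoc[symmetric] matrix_inv_right[OF assms(1)])
qed

lemma pos_def_matrix_inv:
  assumes "pos_def M" shows "pos_def (matrix_inv M)"
  unfolding pos_def_def
proof (intro conjI allI impI)
  have inv: "invertible M" and sym: "transpose M = M" using assms pos_def_invertible by (auto simp: pos_def_def)
  show "transpose (matrix_inv M) = matrix_inv M" by (rule transpose_matrix_inv[OF inv sym])
  fix v :: "real^'a" assume "v \<noteq> 0"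
  let ?w = "matrix_inv M *v v"
  have w: "M *v ?w = v" by (rule matrix_inv_vector(1)[OF inv])
  then have "?w \<noteq> 0" using \<open>v \<noteq> 0\<close> by auto
  then have "0 < ?w \<bullet> (M *v ?w)" using assms by (simp add: pos_def_def)
  then show "0 < v \<bullet> (matrix_inv M *v v)" unfolding w by (simp add: inner_commute)
qed

text \<open>
  If the form vanished at \<open>v\<close>, moving from \<open>v\<close> a little in the direction \<open>- M v\<close> would make it negative.
\<close>

lemma pos_defI_semidefinite:
  assumes sym: "transpose M = M" and inv: "invertible M" and psd: "\<And>v. 0 \<le> v \<bullet> (M *v v)"
  shows "pos_def M"
  unfolding pos_def_def
proof (intro conjI allI impI sym)
  fix v :: "real^'a" assume v: "v \<noteq> 0"
  show "0 < v \<bullet> (M *v v)"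
  proof (rule ccontr)
    assume "\<not> 0 < v \<bullet> (M *v v)"
    then have vv: "v \<bullet> (M *v v) = 0" using psd[of v] by simp
    let ?w = "M *v v" let ?a = "(M *v v) \<bullet> (M *v v)" let ?b = "(M *v v) \<bullet> (M *v (M *v v))"
    have "M *v v \<noteq> 0" using matrix_inv_vector(2)[OF inv, of v] v by auto
    then have a: "0 < ?a" by simp
    have q: "0 \<le> - 2 * s * ?a + s\<^sup>2 * ?b" for s
    proof -
      have "(v - s *\<^sub>R ?w) \<bullet> (M *v (v - s *\<^sub>R ?w)) = v \<bullet> (M *v v) - 2 * s * ?a + s\<^sup>2 * ?b"
        using symmetric_inner[OF sym, of v ?w]
        by (simp add: matrix_vector_mult_diff_distrib matrix_vector_mult_scaleR inner_diff_left inner_diff_right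
            algebra_simps power2_eq_square)
      then show ?thesis using psd[of "v - s *\<^sub>R ?w"] vv by simp
    qed
    show False
    proof (cases "?b \<le> 0")
      case True
      then show False using q[of 1] a by simp
    next
      case False
      then have "- 2 * (?a / ?b) * ?a + (?a / ?b)\<^sup>2 * ?b = - (?a * ?a / ?b)"
        by (simp add: field_simps power2_eq_square)
      moreover have "0 < ?a * ?a / ?b" using False a by (intro divide_pos_pos mult_pos_pos) auto
      ultimately show False using q[of "?a / ?b"] by linarith
    qed
  qed
qed

text \<open>
  The integral of a function that is not integrable is \<open>0\<close> by convention, and \<open>0\<close> is not invertible; so controllability already contains integrability of the integrand.
\<close>

lemma gramian_integrable:
  assumes "controllable \<Phi> B" "0 \<le> s" "s < t" "t \<le> 1"
  shows "(\<lambda>r. \<Phi> t r ** B r ** transpose (B r) ** transpose (\<Phi> t r)) integrable_on {s..t}"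
proof (rule ccontr)
  assume "\<not> ?thesis"
  then have "gramian \<Phi> B t s = 0" unfolding gramian_def by (rule not_integrable_integral)
  then have "invertible (0 :: real^'a^'a)" using assms by (metis controllable_def)
  then show False by (metis det_0 invertible_det_nz mat_0)
qed

lemma gramian_pos_def:
  assumes ctrl: "controllable \<Phi> B" "0 \<le> s" "s < t" "t \<le> 1"
  shows "pos_def (gramian \<Phi> B t s)"
proof (rule pos_defI_semidefinite)
  let ?f = "\<lambda>r. \<Phi> t r ** B r ** transpose (B r) ** transpose (\<Phi> t r)"
  note int = gramian_integrable[OF ctrl]
  show "transpose (gramian \<Phi> B t s) = gramian \<Phi> B t s"
    unfolding gramian_def using integral_linear[OF int bounded_linear_transpose]
    by (simp add: comp_def matrix_transpose_mul matrix_mul_assoc)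
  show "invertible (gramian \<Phi> B t s)" using ctrl by (auto simp: controllable_def)
  fix v
  have "v \<bullet> (gramian \<Phi> B t s *v v) = integral {s..t} (\<lambda>r. v \<bullet> (?f r *v v))"
    unfolding gramian_def using integral_linear[OF int bounded_linear_quadratic_form[of v v]] by (simp add: comp_def)
  also have "\<dots> \<ge> 0"
  proof (rule integral_nonneg)
    show "(\<lambda>r. v \<bullet> (?f r *v v)) integrable_on {s..t}"
      using integrable_linear[OF int bounded_linear_quadratic_form[of v v]] by (simp add: comp_def)
    fix r
    have "?f r *v v = \<Phi> t r ** B r *v (transpose (\<Phi> t r ** B r) *v v)"
      by (simp add: matrix_vector_mul_assoc matrix_transpose_mul matrix_mul_assoc del: transpose_matrix_vector)
    then have "v \<bullet> (?f r *v v) = (transpose (\<Phi> t r ** B r) *v v) \<bullet> (transpose (\<Phi> t r ** B r) *v v)"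
      by (simp only: inner_matrix_vector[of v "\<Phi> t r ** B r"])
    then show "0 \<le> v \<bullet> (?f r *v v)" by (metis inner_ge_zero)
  qed
  finally show "0 \<le> v \<bullet> (gramian \<Phi> B t s *v v)" .
qed

text \<open>
  The covariance produced up to time \<open>t\<close> is transported by the flow, and the one produced after \<open>t\<close> is added.
\<close>

lemma gramian_split:
  assumes \<Phi>: "state_transition A \<Phi>" "continuous_on {0..1} A" and ctrl: "controllable \<Phi> B"
    and t: "0 < t" "t < 1"
  shows "gramian \<Phi> B 1 0 = \<Phi> 1 t ** gramian \<Phi> B t 0 ** transpose (\<Phi> 1 t) + gramian \<Phi> B 1 t"
proof -
  let ?f = "\<lambda>u r. \<Phi> u r ** B r ** transpose (B r) ** transpose (\<Phi> u r)"
  have "gramian \<Phi> B 1 0 = integral {0..t} (?f 1) + integral {t..1} (?f 1)"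
    unfolding gramian_def using t gramian_integrable[OF ctrl, of 0 1] by (intro Henstock_Kurzweil_Integration.integral_combine[symmetric]) auto
  also have "integral {0..t} (?f 1) = integral {0..t} (\<lambda>r. \<Phi> 1 t ** ?f t r ** transpose (\<Phi> 1 t))"
  proof (rule integral_cong)
    fix r assume "r \<in> {0..t}"
    then have "\<Phi> 1 r = \<Phi> 1 t ** \<Phi> t r" using t by (intro state_transition_compose[OF \<Phi>, symmetric]) auto
    then show "?f 1 r = \<Phi> 1 t ** ?f t r ** transpose (\<Phi> 1 t)"
      by (simp add: matrix_transpose_mul matrix_mul_assoc)
  qed
  also have "\<dots> = \<Phi> 1 t ** integral {0..t} (?f t) ** transpose (\<Phi> 1 t)"
    using integral_linear[OF gramian_integrable[OF ctrl, of 0 t]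
        bounded_linear_compose[OF bounded_linear_matrix_mult_left[of "transpose (\<Phi> 1 t)"] bounded_linear_matrix_mult_right[of "\<Phi> 1 t"]]] t
    by (simp add: comp_def)
  finally show ?thesis by (simp add: gramian_def)
qed

text \<open>
  With \<open>e = M\<^sup>-\<^sup>1 d\<close> one has \<open>v = w + P F' e\<close> and \<open>d - F v = R e - F w\<close>; on expanding, the mixed terms \<open>w \<bullet> F' e\<close> cancel and the constant terms add up to \<open>d \<bullet> e\<close>.
\<close>

lemma complete_square_bridge:
  fixes P R F M :: "real^'n^'n" and v d :: "real^'n"
  assumes P: "pos_def P" and R: "pos_def R" and M: "invertible M" "M = F ** P ** transpose F + R"
  defines "w \<equiv> v - (P ** transpose F ** matrix_inv M) *v d"
  shows "v \<bullet> (matrix_inv P *v v) + (d - F *v v) \<bullet> (matrix_inv R *v (d - F *v v))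
    = d \<bullet> (matrix_inv M *v d) + (w \<bullet> (matrix_inv P *v w) + (F *v w) \<bullet> (matrix_inv R *v (F *v w)))"
proof -
  note [simp del] = transpose_matrix_vector
  define e where "e = matrix_inv M *v d"
  have d: "d = M *v e" unfolding e_def by (simp add: matrix_inv_vector[OF M(1)])
  define g where "g = transpose F *v e"
  have dM: "d = F *v (P *v g) + R *v e"
    unfolding d M(2) g_def by (simp add: matrix_vector_mult_add_rdistrib matrix_vector_mul_assoc matrix_mul_assoc)
  have v: "v = w + P *v g"
    unfolding w_def e_def g_def by (simp add: matrix_vector_mul_assoc matrix_mul_assoc)
  have dv: "d - F *v v = R *v e - F *v w"
    unfolding v dM by (simp add: matrix_vector_right_distrib)
  note invs = matrix_inv_vector[OF pos_def_invertible[OF P]] matrix_inv_vector[OF pos_def_invertible[OF R]]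
  have symP: "u \<bullet> (matrix_inv P *v x) = (matrix_inv P *v u) \<bullet> x" for u x
    by (rule symmetric_inner) (use pos_def_matrix_inv[OF P] in \<open>simp add: pos_def_def\<close>)
  have symR: "u \<bullet> (matrix_inv R *v x) = (matrix_inv R *v u) \<bullet> x" for u x
    by (rule symmetric_inner) (use pos_def_matrix_inv[OF R] in \<open>simp add: pos_def_def\<close>)
  have cross: "(F *v x) \<bullet> e = x \<bullet> g" for x
    unfolding g_def by (simp only: inner_matrix_vector[of x "transpose F" e] transpose_transpose)
  have 1: "v \<bullet> (matrix_inv P *v v) = w \<bullet> (matrix_inv P *v w) + 2 * (w \<bullet> g) + (P *v g) \<bullet> g"
    unfolding v using symP[of "P *v g" w]
    by (simp add: matrix_vector_right_distrib inner_add_left inner_add_right invs inner_commute)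
  have 2: "(d - F *v v) \<bullet> (matrix_inv R *v (d - F *v v)) = (R *v e) \<bullet> e - 2 * (w \<bullet> g) + (F *v w) \<bullet> (matrix_inv R *v (F *v w))"
    unfolding dv using symR[of "R *v e" "F *v w"] cross[of w]
    by (simp add: matrix_vector_mult_diff_distrib inner_diff_left inner_diff_right invs inner_commute)
  have 3: "d \<bullet> (matrix_inv M *v d) = (P *v g) \<bullet> g + (R *v e) \<bullet> e"
    unfolding e_def[symmetric] by (subst dM) (simp add: inner_add_left cross)
  show ?thesis unfolding 1 2 3 by simp
qed

section \<open>Gaussian integrals\<close>

lemma Basis_cart: "(Basis :: (real^'n) set) = (\<lambda>i. axis i 1) ` UNIV"
  by (auto simp: Basis_vec_def)

lemma prod_Basis_cart: "(\<Prod>b\<in>(Basis::(real^'n) set). g b) = (\<Prod>i\<in>UNIV. g (axis i 1))"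
  unfolding Basis_cart by (subst prod.reindex) (auto simp: inj_on_def axis_eq_axis)

lemma matrix_vector_mult_measurable [measurable]: "(\<lambda>x. (A :: real^'n^'m) *v x) \<in> borel_measurable borel"
  by (intro borel_measurable_continuous_onI linear_continuous_on matrix_vector_mul_bounded_linear)

text \<open>
  Shears are reduced to translations: average over translations by \<open>s *\<^sub>R e\<close> with \<open>s \<in> [0, 1]\<close>, exchange the integrals, and absorb the shift \<open>g x\<close>, which is constant along \<open>e\<close>, into \<open>s\<close>.
\<close>

lemma nn_integral_lborel_shear:
  fixes f :: "'a::euclidean_space \<Rightarrow> ennreal" and g :: "'a \<Rightarrow> real"
  assumes [measurable]: "f \<in> borel_measurable borel" "g \<in> borel_measurable borel"
    and g: "\<And>x s. g (x + s *\<^sub>R e) = g x"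
  shows "(\<integral>\<^sup>+x. f (x + g x *\<^sub>R e) \<partial>lborel) = (\<integral>\<^sup>+x. f x \<partial>lborel)"
proof -
  let ?I = "indicator {0..1} :: real \<Rightarrow> ennreal"
  have mass: "(\<integral>\<^sup>+s. ?I (s + t) * c \<partial>lborel) = c" for t c
    using nn_integral_lborel_translate[of "?I" t] by (simp add: nn_integral_multc add.commute)
  have "(\<integral>\<^sup>+x. f (x + g x *\<^sub>R e) \<partial>lborel) = (\<integral>\<^sup>+s. ?I (s + 0) * (\<integral>\<^sup>+x. f (x + g x *\<^sub>R e) \<partial>lborel) \<partial>lborel)"
    by (rule mass[symmetric])
  also have "\<dots> = (\<integral>\<^sup>+s. (\<integral>\<^sup>+x. ?I s * f (x + (s + g x) *\<^sub>R e) \<partial>lborel) \<partial>lborel)"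
  proof (rule nn_integral_cong)
    fix s :: real
    have "(\<integral>\<^sup>+x. f (x + (s + g x) *\<^sub>R e) \<partial>lborel) = (\<integral>\<^sup>+x. f (x + g x *\<^sub>R e) \<partial>lborel)"
      using nn_integral_lborel_translate[of "\<lambda>x. f (x + g x *\<^sub>R e)" "s *\<^sub>R e"] g[of _ s]
      by (simp add: algebra_simps)
    then show "?I (s + 0) * (\<integral>\<^sup>+x. f (x + g x *\<^sub>R e) \<partial>lborel) = (\<integral>\<^sup>+x. ?I s * f (x + (s + g x) *\<^sub>R e) \<partial>lborel)"
      by (subst nn_integral_cmult) auto
  qed
  also have "\<dots> = (\<integral>\<^sup>+x. (\<integral>\<^sup>+s. ?I s * f (x + (s + g x) *\<^sub>R e) \<partial>lborel) \<partial>lborel)"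
    by (rule lborel_pair.Fubini') measurable
  also have "\<dots> = (\<integral>\<^sup>+x. (\<integral>\<^sup>+s. ?I (s - g x) * f (x + s *\<^sub>R e) \<partial>lborel) \<partial>lborel)"
  proof (rule nn_integral_cong)
    fix x
    show "(\<integral>\<^sup>+s. ?I s * f (x + (s + g x) *\<^sub>R e) \<partial>lborel) = (\<integral>\<^sup>+s. ?I (s - g x) * f (x + s *\<^sub>R e) \<partial>lborel)"
      using nn_integral_lborel_translate[of "\<lambda>s. ?I (s - g x) * f (x + s *\<^sub>R e)" "g x"]
      by (simp add: algebra_simps)
  qed
  also have "\<dots> = (\<integral>\<^sup>+s. (\<integral>\<^sup>+x. ?I (s - g x) * f (x + s *\<^sub>R e) \<partial>lborel) \<partial>lborel)"
    by (rule lborel_pair.Fubini'[symmetric]) measurable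
  also have "\<dots> = (\<integral>\<^sup>+s. (\<integral>\<^sup>+x. ?I (s - g x) * f x \<partial>lborel) \<partial>lborel)"
  proof (rule nn_integral_cong)
    fix s :: real
    show "(\<integral>\<^sup>+x. ?I (s - g x) * f (x + s *\<^sub>R e) \<partial>lborel) = (\<integral>\<^sup>+x. ?I (s - g x) * f x \<partial>lborel)"
      using nn_integral_lborel_translate[of "\<lambda>x. ?I (s - g x) * f x" "s *\<^sub>R e"] g[of _ s]
      by (simp add: add.commute)
  qed
  also have "\<dots> = (\<integral>\<^sup>+x. (\<integral>\<^sup>+s. ?I (s - g x) * f x \<partial>lborel) \<partial>lborel)"
    by (rule lborel_pair.Fubini') measurable
  also have "\<dots> = (\<integral>\<^sup>+x. f x \<partial>lborel)"
    using mass[of "- g x" "f x" for x] by simp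
  finally show ?thesis .
qed

lemma nn_integral_lborel_permute:
  fixes f :: "real^'n \<Rightarrow> ennreal"
  assumes [measurable]: "f \<in> borel_measurable borel" and p: "p permutes UNIV"
  shows "(\<integral>\<^sup>+x. f (\<chi> i. x $ p i) \<partial>lborel) = (\<integral>\<^sup>+x. f x \<partial>lborel)"
proof -
  let ?T = "\<lambda>x::real^'n. \<chi> i. x $ p i"
  have [measurable]: "?T \<in> borel_measurable borel"
    by (intro borel_measurable_continuous_onI continuous_intros)
  have "lborel = distr lborel borel ?T"
  proof (rule lborel_eqI)
    fix l u :: "real^'n" assume le: "\<And>b. b \<in> Basis \<Longrightarrow> l \<bullet> b \<le> u \<bullet> b"
    let ?S = "\<lambda>x::real^'n. \<chi> i. x $ inv p i"
    have bij: "bij p" using p by (simp add: permutes_bij)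
    have "?T -` box l u = box (?S l) (?S u)"
      using bij by (auto simp: mem_box_cart bij_is_surj surj_f_inv_f bij_is_inj inv_f_f)
        (metis bij_inv_eq_iff bij)+
    then have "emeasure (distr lborel borel ?T) (box l u) = emeasure lborel (box (?S l) (?S u))"
      by (subst emeasure_distr) auto
    also have "\<dots> = (\<Prod>b\<in>Basis. (?S u - ?S l) \<bullet> b)"
    proof (rule emeasure_lborel_box)
      fix b :: "real^'n" assume "b \<in> Basis"
      then obtain i where "b = axis i 1" by (auto simp: Basis_cart)
      then show "?S l \<bullet> b \<le> ?S u \<bullet> b" using le[of "axis (inv p i) 1"] by (simp add: inner_axis Basis_cart)
    qed
    also have "(\<Prod>b\<in>Basis. (?S u - ?S l) \<bullet> b) = (\<Prod>i\<in>UNIV. (u - l) $ inv p i)"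
      by (simp add: prod_Basis_cart inner_axis)
    also have "\<dots> = (\<Prod>i\<in>UNIV. (u - l) $ i)"
      using prod.reindex_bij_betw[OF bij_imp_bij_inv[OF bij], of "\<lambda>i. (u - l) $ i"] by simp
    also have "\<dots> = (\<Prod>b\<in>Basis. (u - l) \<bullet> b)"
      by (simp add: prod_Basis_cart inner_axis)
    finally show "emeasure (distr lborel borel ?T) (box l u) = (\<Prod>b\<in>Basis. (u - l) \<bullet> b)" .
  qed simp
  then have "(\<integral>\<^sup>+x. f x \<partial>lborel) = (\<integral>\<^sup>+x. f x \<partial>(distr lborel borel ?T))" by simp
  then show ?thesis by (simp add: nn_integral_distr)
qed

lemma nn_integral_lborel_diagonal:
  fixes f :: "real^'n \<Rightarrow> ennreal" and L :: "real^'n^'n"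
  assumes [measurable]: "f \<in> borel_measurable borel" and diag: "\<And>i j. i \<noteq> j \<Longrightarrow> L $ i $ j = 0" and det: "det L \<noteq> 0"
  shows "(\<integral>\<^sup>+x. f x \<partial>lborel) = ennreal \<bar>det L\<bar> * (\<integral>\<^sup>+x. f (L *v x) \<partial>lborel)"
proof -
  define c where "c b = (L *v b) \<bullet> b" for b
  have c_axis: "c (axis i 1) = L $ i $ i" for i
    by (simp add: c_def matrix_vector_mult_basis inner_axis column_def)
  have det_eq: "det L = (\<Prod>i\<in>UNIV. L $ i $ i)" by (rule det_diagonal) (rule diag)
  have nz: "c b \<noteq> 0" if "b \<in> Basis" for b
    using that det by (auto simp: Basis_cart c_axis det_eq)
  have L_axis: "L *v b = c b *\<^sub>R b" if b: "b \<in> Basis" for b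
  proof -
    obtain i where i: "b = axis i 1" using b by (auto simp: Basis_cart)
    show ?thesis unfolding i c_axis matrix_vector_mult_basis
      using diag[of _ i] by (auto simp: vec_eq_iff column_def axis_def)
  qed
  have T: "0 + (\<Sum>b\<in>Basis. (c b * (x \<bullet> b)) *\<^sub>R b) = L *v x" for x
  proof -
    have "L *v x = L *v (\<Sum>b\<in>Basis. (x \<bullet> b) *\<^sub>R b)" by (simp add: euclidean_representation)
    also have "\<dots> = (\<Sum>b\<in>Basis. (x \<bullet> b) *\<^sub>R (L *v b))"
      by (simp add: linear_sum[OF matrix_vector_mul_linear] matrix_vector_mult_scaleR)
    also have "\<dots> = (\<Sum>b\<in>Basis. (c b * (x \<bullet> b)) *\<^sub>R b)" by (intro sum.cong) (auto simp: L_axis)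
    finally show ?thesis by simp
  qed
  have "lborel = density (distr lborel borel (\<lambda>x. L *v x)) (\<lambda>_. (\<Prod>b\<in>Basis. \<bar>c b\<bar>))"
    using lborel_affine_euclidean[of c 0, OF nz] unfolding T by simp
  then have "(\<integral>\<^sup>+x. f x \<partial>lborel) = (\<integral>\<^sup>+x. f x \<partial>(density (distr lborel borel (\<lambda>x. L *v x)) (\<lambda>_. (\<Prod>b\<in>Basis. \<bar>c b\<bar>))))" by simp
  also have "\<dots> = (\<Prod>b\<in>Basis. \<bar>c b\<bar>) * (\<integral>\<^sup>+x. f (L *v x) \<partial>lborel)"
    by (simp add: nn_integral_density nn_integral_distr nn_integral_cmult)
  also have "(\<Prod>b\<in>Basis. \<bar>c b\<bar>) = \<bar>det L\<bar>"
    by (simp add: prod_Basis_cart c_axis det_eq abs_prod)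
  finally show ?thesis .
qed

text \<open>
  Both sides are multiplicative in \<open>L\<close>, so the elementary matrices suffice: diagonal matrices, transpositions of coordinates and shears.
\<close>

theorem nn_integral_lborel_linear:
  fixes f :: "real^'n \<Rightarrow> ennreal" and L :: "real^'n^'n"
  assumes "f \<in> borel_measurable borel" and "det L \<noteq> 0"
  shows "(\<integral>\<^sup>+x. f x \<partial>lborel) = ennreal \<bar>det L\<bar> * (\<integral>\<^sup>+x. f (L *v x) \<partial>lborel)"
proof -
  define P where "P L \<longleftrightarrow> (det L \<noteq> 0 \<longrightarrow> (\<forall>f \<in> borel_measurable borel.
      (\<integral>\<^sup>+x. f x \<partial>lborel) = ennreal \<bar>det L\<bar> * (\<integral>\<^sup>+x. f (L *v x) \<partial>lborel)))" for L :: "real^'n^'n"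
  have "P L"
  proof (rule induct_matrix_elementary)
    fix A B assume AB: "P A" "P B"
    show "P (A ** B)" unfolding P_def
    proof (intro impI ballI)
      fix f :: "real^'n \<Rightarrow> ennreal" assume d: "det (A ** B) \<noteq> 0" and f [measurable]: "f \<in> borel_measurable borel"
      have dA: "det A \<noteq> 0" and dB: "det B \<noteq> 0" using d by (auto simp: det_mul)
      have "(\<integral>\<^sup>+x. f x \<partial>lborel) = ennreal \<bar>det A\<bar> * (\<integral>\<^sup>+x. f (A *v x) \<partial>lborel)"
        using AB(1) dA f unfolding P_def by blast
      also have "(\<integral>\<^sup>+x. f (A *v x) \<partial>lborel) = ennreal \<bar>det B\<bar> * (\<integral>\<^sup>+x. f (A *v (B *v x)) \<partial>lborel)"
      proof -
        have "(\<lambda>x. f (A *v x)) \<in> borel_measurable borel" by measurable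
        then show ?thesis using AB(2) dB unfolding P_def by blast
      qed
      finally show "(\<integral>\<^sup>+x. f x \<partial>lborel) = ennreal \<bar>det (A ** B)\<bar> * (\<integral>\<^sup>+x. f (A ** B *v x) \<partial>lborel)"
        by (simp add: matrix_vector_mul_assoc det_mul abs_mult ennreal_mult mult.assoc)
    qed
  next
    fix A :: "real^'n^'n" and i assume "row i A = 0"
    then show "P A" by (simp add: P_def det_zero_row)
  next
    fix A :: "real^'n^'n" assume "\<And>i j. i \<noteq> j \<Longrightarrow> A $ i $ j = 0"
    then show "P A" using nn_integral_lborel_diagonal unfolding P_def by blast
  next
    fix m n :: 'n assume "m \<noteq> n"
    let ?p = "Transposition.transpose m n" let ?A = "(\<chi> i j. mat 1 $ i $ ?p j) :: real^'n^'n"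
    have p: "?p permutes UNIV" by (simp add: permutes_swap_id)
    have "\<bar>det ?A\<bar> = 1"
      using det_permute_columns[OF p, of "mat 1 :: real^'n^'n"] by (simp flip: of_int_abs)
    moreover have "?A *v x = (\<chi> i. x $ ?p i)" for x
    proof -
      have "(\<Sum>j\<in>UNIV. mat 1 $ i $ ?p j * x $ j) = x $ ?p i" for i
      proof -
        have "(\<Sum>j\<in>UNIV. mat 1 $ i $ ?p j * x $ j) = (\<Sum>j\<in>UNIV. if j = ?p i then x $ j else 0)"
          by (rule sum.cong) (auto simp: mat_def transpose_eq_iff)
        then show ?thesis by simp
      qed
      then show ?thesis by (simp add: matrix_vector_mult_def)
    qed
    ultimately show "P ?A"
      unfolding P_def by (intro impI ballI) (simp only: nn_integral_lborel_permute[OF _ p] ennreal_1 mult_1)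
  next
    fix m n :: 'n and c :: real assume mn: "m \<noteq> n"
    let ?A = "(\<chi> i j. if i = m \<and> j = n then c else of_bool (i = j)) :: real^'n^'n"
    have "?A = (\<chi> k. if k = m then row m (mat 1) + c *s row n (mat 1) else row k (mat 1))"
      using mn by (auto simp: vec_eq_iff row_def mat_def)
    then have "det ?A = 1" using det_row_operation[OF mn, of "mat 1" c] by simp
    moreover have "?A *v x = x + (c * x $ n) *\<^sub>R axis m 1" for x
    proof -
      have "(\<Sum>j\<in>UNIV. (if i = m \<and> j = n then c else of_bool (i = j)) * x $ j) = x $ i + (if i = m then c * x $ n else 0)" for i
      proof -
        have "(\<Sum>j\<in>UNIV. (if i = m \<and> j = n then c else of_bool (i = j)) * x $ j)
          = (\<Sum>j\<in>UNIV. (if j = i then x $ j else 0) + (if j = n then (if i = m then c * x $ n else 0) else 0))"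
          using mn by (intro sum.cong) auto
        then show ?thesis by (simp add: sum.distrib)
      qed
      then show ?thesis by (auto simp: matrix_vector_mult_def vec_eq_iff axis_def)
    qed
    moreover have "(\<integral>\<^sup>+x. f (x + (c * x $ n) *\<^sub>R axis m 1) \<partial>lborel) = (\<integral>\<^sup>+x. f x \<partial>lborel)"
      if f: "f \<in> borel_measurable borel" for f :: "real^'n \<Rightarrow> ennreal"
      using mn by (intro nn_integral_lborel_shear[OF f]) (auto simp: axis_def intro!: borel_measurable_continuous_onI continuous_intros)
    ultimately show "P ?A" unfolding P_def by (intro impI ballI) (simp only: abs_one ennreal_1 mult_1)
  qed
  then show ?thesis using assms unfolding P_def by blast
qed

text \<open>
  Gram-Schmidt for the inner product defined by \<open>N\<close>.
\<close>

lemma pos_def_orthonormal_set: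
  fixes N :: "real^'n^'n"
  assumes N: "pos_def N" and k: "k \<le> CARD('n)"
  shows "\<exists>S. finite S \<and> card S = k \<and> (\<forall>u\<in>S. \<forall>v\<in>S. u \<bullet> (N *v v) = (if u = v then 1 else 0))"
  using k
proof (induction k)
  case 0
  then show ?case by (intro exI[of _ "{}"]) auto
next
  case (Suc k)
  then obtain S where S: "finite S" "card S = k"
    "\<And>u v. u \<in> S \<Longrightarrow> v \<in> S \<Longrightarrow> u \<bullet> (N *v v) = (if u = v then 1 else 0)" by force
  have "dim (span S) < DIM(real^'n)"
    using dim_le_card[of S S] S Suc.prems by (simp add: span_superset)
  then have "span S \<noteq> UNIV" by (metis dim_UNIV less_irrefl)
  then obtain x where x: "x \<notin> span S" by auto
  (* the component of x that is orthogonal to S *)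
  define y where "y = x - (\<Sum>u\<in>S. (u \<bullet> (N *v x)) *\<^sub>R u)"
  have "y \<noteq> 0"
  proof
    assume "y = 0"
    then have "x = (\<Sum>u\<in>S. (u \<bullet> (N *v x)) *\<^sub>R u)" by (simp add: y_def)
    also have "\<dots> \<in> span S" by (intro span_sum span_scale span_base)
    finally show False using x by simp
  qed
  then have yy: "0 < y \<bullet> (N *v y)" using N by (simp add: pos_def_def)
  have sym: "u \<bullet> (N *v w) = (N *v u) \<bullet> w" for u w
    by (rule symmetric_inner) (use N in \<open>simp add: pos_def_def\<close>)
  have orth: "v \<bullet> (N *v y) = 0" if v: "v \<in> S" for v
  proof -
    have "v \<bullet> (N *v y) = v \<bullet> (N *v x) - (\<Sum>u\<in>S. (u \<bullet> (N *v x)) * (v \<bullet> (N *v u)))"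
      by (simp add: y_def matrix_vector_mult_diff_distrib inner_diff_right linear_sum[OF matrix_vector_mul_linear]
          inner_sum_right matrix_vector_mult_scaleR)
    also have "(\<Sum>u\<in>S. (u \<bullet> (N *v x)) * (v \<bullet> (N *v u))) = (\<Sum>u\<in>S. if u = v then v \<bullet> (N *v x) else 0)"
      using S(3) v by (intro sum.cong) auto
    finally show ?thesis using S(1) v by simp
  qed
  define z where "z = (1 / sqrt (y \<bullet> (N *v y))) *\<^sub>R y"
  have z: "z \<bullet> (N *v z) = 1" "\<And>v. v \<in> S \<Longrightarrow> v \<bullet> (N *v z) = 0"
    using yy orth by (auto simp: z_def matrix_vector_mult_scaleR real_div_sqrt field_simps)
  then have "z \<notin> S" using zero_neq_one by force
  moreover have "z \<bullet> (N *v v) = 0" if "v \<in> S" for v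
    using z(2)[OF that] sym[of z v] by (simp add: inner_commute)
  ultimately show ?case using S z by (intro exI[of _ "insert z S"]) auto
qed

lemma pos_def_congruent_identity:
  fixes N :: "real^'n^'n"
  assumes N: "pos_def N"
  obtains L :: "real^'n^'n" where "transpose L ** N ** L = mat 1"
proof -
  obtain S where S: "finite S" "card S = CARD('n)"
    "\<And>u v. u \<in> S \<Longrightarrow> v \<in> S \<Longrightarrow> u \<bullet> (N *v v) = (if u = v then 1 else 0)"
    using pos_def_orthonormal_set[OF N order_refl] by force
  obtain h :: "'n \<Rightarrow> real^'n" where h: "bij_betw h UNIV S"
    using finite_same_card_bij[of "UNIV :: 'n set" S] S by auto
  define L :: "real^'n^'n" where "L = (\<chi> i j. h j $ i)"
  have L: "L *v axis j 1 = h j" for j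
    by (simp add: L_def matrix_vector_mult_basis column_def vec_eq_iff)
  have "(transpose L ** N ** L) $ i $ j = mat 1 $ i $ j" for i j
  proof -
    have "(transpose L ** N ** L) $ i $ j = axis i 1 \<bullet> ((transpose L ** N ** L) *v axis j 1)"
      by (simp add: matrix_vector_mult_basis column_def inner_axis' inner_axis)
    also have "\<dots> = axis i 1 \<bullet> (transpose L *v (N *v (L *v axis j 1)))"
      by (simp add: matrix_vector_mul_assoc matrix_mul_assoc del: transpose_matrix_vector)
    also have "\<dots> = h i \<bullet> (N *v h j)"
      by (simp only: inner_matrix_vector[of _ "transpose L"] transpose_transpose L)
    also have "\<dots> = (if h i = h j then 1 else 0)" using h by (intro S(3)) (auto simp: bij_betw_def)
    also have "\<dots> = mat 1 $ i $ j" using h by (auto simp: mat_def bij_betw_def inj_def)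
    finally show ?thesis .
  qed
  then have "transpose L ** N ** L = mat 1" by (simp add: vec_eq_iff)
  then show thesis by (rule that)
qed

lemma nn_integral_standard_gaussian:
  "(\<integral>\<^sup>+x. ennreal (exp (- (x \<bullet> x) / 2)) \<partial>(lborel :: 'a::euclidean_space measure)) = ennreal (sqrt (2 * pi) ^ DIM('a))"
proof -
  have one: "(\<integral>\<^sup>+x. ennreal (exp (- x\<^sup>2 / 2)) \<partial>(lborel::real measure)) = ennreal (sqrt (2 * pi))"
  proof -
    have "(\<integral>\<^sup>+x. ennreal (exp (- x\<^sup>2 / 2)) \<partial>(lborel::real measure)) = (\<integral>\<^sup>+x. ennreal (sqrt (2 * pi)) * ennreal (std_normal_density x) \<partial>lborel)"
      by (intro nn_integral_cong) (simp add: std_normal_density_def ennreal_mult[symmetric])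
    also have "\<dots> = ennreal (sqrt (2 * pi)) * (\<integral>\<^sup>+x. ennreal (std_normal_density x) \<partial>lborel)"
      by (subst nn_integral_cmult) auto
    also have "(\<integral>\<^sup>+x. ennreal (std_normal_density x) \<partial>lborel) = 1"
      by (subst nn_integral_eq_integral) auto
    finally show ?thesis by simp
  qed
  have "(\<integral>\<^sup>+x. ennreal (exp (- (x \<bullet> x) / 2)) \<partial>(lborel :: 'a measure)) = (\<integral>\<^sup>+x. (\<Prod>b\<in>Basis. ennreal (exp (- (x \<bullet> b)\<^sup>2 / 2))) \<partial>(lborel :: 'a measure))"
  proof (rule nn_integral_cong)
    fix x :: 'a
    have "- (x \<bullet> x) / 2 = (\<Sum>b\<in>Basis. - (x \<bullet> b)\<^sup>2 / 2)"
      by (subst euclidean_inner) (simp add: power2_eq_square sum_negf sum_divide_distrib)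
    then have "exp (- (x \<bullet> x) / 2) = (\<Prod>b\<in>Basis. exp (- (x \<bullet> b)\<^sup>2 / 2))" by (simp add: exp_sum)
    then show "ennreal (exp (- (x \<bullet> x) / 2)) = (\<Prod>b\<in>Basis. ennreal (exp (- (x \<bullet> b)\<^sup>2 / 2)))"
      by (simp add: prod_ennreal)
  qed
  also have "\<dots> = (\<Prod>b\<in>(Basis::'a set). ennreal (sqrt (2 * pi)))"
    by (subst nn_integral_lborel_prod) (simp_all only: one, measurable)
  finally show ?thesis by (simp add: ennreal_power)
qed

text \<open>
  The substitution \<open>w = sqrt \<epsilon> L u\<close> with \<open>L' M\<^sup>-\<^sup>1 L = 1\<close> reduces to the standard Gaussian; the determinant of \<open>L\<close> is \<open>sqrt (det M)\<close> up to sign.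
\<close>

lemma nn_integral_gaussian_kernel:
  fixes M :: "real^'n^'n"
  assumes M: "pos_def M" and \<epsilon>: "0 < \<epsilon>"
  shows "(\<integral>\<^sup>+w. ennreal ((2 * pi * \<epsilon>) powr (- real CARD('n) / 2) * det M powr (- 1 / 2) *
      exp (- (1 / (2 * \<epsilon>)) * (w \<bullet> (matrix_inv M *v w)))) \<partial>lborel) = 1"
proof -
  let ?c = "(2 * pi * \<epsilon>) powr (- real CARD('n) / 2) * det M powr (- 1 / 2)"
  obtain L :: "real^'n^'n" where L: "transpose L ** matrix_inv M ** L = mat 1"
    by (rule pos_def_congruent_identity[OF pos_def_matrix_inv[OF M]])
  have "det (transpose L ** matrix_inv M ** L) * det M = det M" by (simp add: L)
  moreover have "det (matrix_inv M) * det M = 1"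
    using matrix_inv_left[OF pos_def_invertible[OF M]] by (metis det_I det_mul)
  moreover have "det (transpose L ** matrix_inv M ** L) * det M = (det L)\<^sup>2 * (det (matrix_inv M) * det M)"
    by (simp add: det_mul power2_eq_square)
  ultimately have detL: "det M = (det L)\<^sup>2" by simp
  have "det M \<noteq> 0" using pos_def_invertible[OF M] by (simp add: invertible_det_nz)
  then have Lnz: "det L \<noteq> 0" by (auto simp: detL)
  define S where "S = sqrt \<epsilon> *\<^sub>R L"
  have detS: "det S = sqrt \<epsilon> ^ CARD('n) * det L" 
  proof -
    have "S = (\<chi> i. sqrt \<epsilon> *s (L $ i))" by (simp add: S_def vec_eq_iff)
    then show ?thesis by (simp add: det_rows_mul)
  qed
  have S_form: "(S *v u) \<bullet> (matrix_inv M *v (S *v u)) = \<epsilon> * (u \<bullet> u)" for u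
  proof -
    have "(L *v u) \<bullet> (matrix_inv M *v (L *v u)) = u \<bullet> ((transpose L ** matrix_inv M ** L) *v u)"
      by (metis inner_commute inner_matrix_vector matrix_vector_mul_assoc matrix_mul_assoc)
    also have "\<dots> = u \<bullet> u" by (simp add: L)
    finally show ?thesis using \<epsilon>
      by (simp add: S_def scaleR_matrix_vector_assoc[symmetric] matrix_vector_mult_scaleR mult.assoc[symmetric])
  qed
  have "(\<integral>\<^sup>+w. ennreal (?c * exp (- (1 / (2 * \<epsilon>)) * (w \<bullet> (matrix_inv M *v w)))) \<partial>lborel)
      = ennreal \<bar>det S\<bar> * (\<integral>\<^sup>+u. ennreal (?c * exp (- (1 / (2 * \<epsilon>)) * ((S *v u) \<bullet> (matrix_inv M *v (S *v u))))) \<partial>lborel)"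
    using \<epsilon> Lnz by (intro nn_integral_lborel_linear) (auto simp: detS)
  also have "\<dots> = ennreal \<bar>det S\<bar> * (\<integral>\<^sup>+u. ennreal ?c * ennreal (exp (- (u \<bullet> u) / 2)) \<partial>(lborel :: (real^'n) measure))"
    using \<epsilon> by (simp add: S_form ennreal_mult)
  also have "\<dots> = ennreal \<bar>det S\<bar> * (ennreal ?c * ennreal (sqrt (2 * pi) ^ CARD('n)))"
    using nn_integral_standard_gaussian[where 'a="real^'n"] by (subst nn_integral_cmult) auto
  also have "\<dots> = ennreal (\<bar>det S\<bar> * ?c * sqrt (2 * pi) ^ CARD('n))"
    by (simp add: ennreal_mult[symmetric] mult.assoc)
  also have "\<bar>det S\<bar> * ?c * sqrt (2 * pi) ^ CARD('n) = 1"
  proof -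
    have "det M powr (- 1 / 2) = 1 / \<bar>det L\<bar>"
      using Lnz by (simp add: detL powr_minus_divide powr_half_sqrt powr_minus)
    moreover have "(2 * pi * \<epsilon>) powr (- real CARD('n) / 2) = 1 / (sqrt (2 * pi) ^ CARD('n) * sqrt \<epsilon> ^ CARD('n))"
    proof -
      have "(2 * pi * \<epsilon>) powr (- real CARD('n) / 2) = 1 / (2 * pi * \<epsilon>) powr (real CARD('n) * (1 / 2))"
        by (simp add: powr_minus_divide)
      also have "(2 * pi * \<epsilon>) powr (real CARD('n) * (1 / 2)) = sqrt (2 * pi * \<epsilon>) ^ CARD('n)"
      proof -
        have "(2 * pi * \<epsilon>) powr (real CARD('n) * (1 / 2)) = ((2 * pi * \<epsilon>) powr (1 / 2)) powr real CARD('n)"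
          by (simp only: powr_powr mult.commute)
        then show ?thesis using \<epsilon> by (simp add: powr_half_sqrt powr_realpow)
      qed
      finally show ?thesis by (simp add: real_sqrt_mult power_mult_distrib)
    qed
    ultimately show ?thesis using \<epsilon> Lnz by (simp add: detS abs_mult)
  qed
  finally show ?thesis by simp
qed

section \<open>Convergence of Gibbs couplings to the optimal coupling\<close>

lemma borel_prob_space_tight:
  fixes \<mu> :: "'a::real_normed_vector measure"
  assumes "prob_space \<mu>" "sets \<mu> = sets borel" "0 < \<eta>"
  shows "\<exists>R. measure \<mu> {x. R < norm x} \<le> \<eta>"
proof -
  interpret prob_space \<mu> by fact
  have sets: "{x. real n < norm x} \<in> sets \<mu>" for n
    unfolding assms(2) by (intro borel_open open_Collect_less continuous_intros)
  have "\<exists>n. \<not> real n < norm x" for x :: 'a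
    using real_arch_simple[of "norm x"] by (auto simp: not_less)
  then have "(\<Inter>n::nat. {x::'a. real n < norm x}) = {}" by blast
  moreover have "(\<lambda>n. measure \<mu> {x. real n < norm x}) \<longlonglongrightarrow> measure \<mu> (\<Inter>n::nat. {x. real n < norm x})"
    by (rule finite_Lim_measure_decseq) (use sets in \<open>auto simp: decseq_def\<close>)
  ultimately have "(\<lambda>n. measure \<mu> {x. real n < norm x}) \<longlonglongrightarrow> 0" by simp
  then have "\<forall>\<^sub>F n in sequentially. measure \<mu> {x. real n < norm x} < \<eta>"
    using assms(3) order_tendstoD(2) by blast
  then show ?thesis by (meson eventually_sequentially less_imp_le order_refl)
qed

lemma coupling_marginals:
  fixes \<mu> :: "'a::euclidean_space measure" and \<nu> :: "'b::euclidean_space measure"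
  assumes "coupling \<mu> \<nu> P"
  shows "fst \<in> P \<rightarrow>\<^sub>M borel" "snd \<in> P \<rightarrow>\<^sub>M borel" "distr P borel fst = \<mu>" "distr P borel snd = \<nu>"
    "prob_space P" "sets P = sets borel" "space P = UNIV"
  using assms sets_eq_imp_space_eq[of P borel] unfolding coupling_def
  by (simp_all cong: measurable_cong_sets add: borel_measurable_continuous_onI continuous_on_fst continuous_on_snd)

text \<open>
  The bound is uniform over all couplings, since only the tails of the marginals enter.
\<close>

lemma coupling_tight:
  fixes \<mu> :: "'a::euclidean_space measure" and \<nu> :: "'b::euclidean_space measure"
  assumes \<mu>: "prob_space \<mu>" "sets \<mu> = sets borel" and \<nu>: "prob_space \<nu>" "sets \<nu> = sets borel" and \<eta>: "0 < \<eta>"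
  shows "\<exists>R. \<forall>P. coupling \<mu> \<nu> P \<longrightarrow> measure P {p. R < norm p} \<le> \<eta>"
proof -
  obtain R1 where R1: "measure \<mu> {x. R1 < norm x} \<le> \<eta> / 2" using borel_prob_space_tight[OF \<mu>, of "\<eta> / 2"] \<eta> by auto
  obtain R2 where R2: "measure \<nu> {x. R2 < norm x} \<le> \<eta> / 2" using borel_prob_space_tight[OF \<nu>, of "\<eta> / 2"] \<eta> by auto
  have "measure P {p. R1 + R2 < norm p} \<le> \<eta>" if P: "coupling \<mu> \<nu> P" for P
  proof -
    note m = coupling_marginals[OF P]
    interpret prob_space P by (rule m)
    have s: "{x::'a. R1 < norm x} \<in> sets borel" "{y::'b. R2 < norm y} \<in> sets borel"
      by (intro borel_open open_Collect_less continuous_intros)+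
    let ?A = "fst -` {x. R1 < norm x} \<inter> space P" and ?B = "snd -` {y. R2 < norm y} \<inter> space P"
    have AB: "?A \<in> sets P" "?B \<in> sets P" using s m by (auto intro: measurable_sets)
    have "{p. R1 + R2 < norm p} \<subseteq> ?A \<union> ?B"
    proof
      fix p :: "'a \<times> 'b" assume "p \<in> {p. R1 + R2 < norm p}"
      moreover have "norm p \<le> norm (fst p) + norm (snd p)"
        using norm_Pair_le[of "fst p" "snd p"] by simp
      ultimately show "p \<in> ?A \<union> ?B" using m(7) by auto
    qed
    then have "measure P {p. R1 + R2 < norm p} \<le> measure P (?A \<union> ?B)" using AB by (intro finite_measure_mono) auto
    also have "\<dots> \<le> measure P ?A + measure P ?B" using AB by (rule measure_Un_le)
    also have "measure P ?A = measure \<mu> {x. R1 < norm x}"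
      using measure_distr[OF m(1) s(1)] by (simp add: m)
    also have "measure P ?B = measure \<nu> {x. R2 < norm x}"
      using measure_distr[OF m(2) s(2)] by (simp add: m)
    finally show ?thesis using R1 R2 by simp
  qed
  then show ?thesis by blast
qed

lemma distr_weak_limit:
  fixes m :: "'z::metric_space \<Rightarrow> 'a::metric_space"
  assumes conv: "weakly_converges P Q sequentially" and m: "continuous_on UNIV m"
    and P: "\<And>k. sets (P k) = sets borel" "\<And>k. distr (P k) borel m = \<mu>" "prob_space \<mu>"
    and Q: "prob_space Q" "sets Q = sets borel"
  shows "distr Q borel m = \<mu>"
proof (rule finite_measure_eqI_bounded_continuous)
  have [measurable]: "m \<in> borel_measurable borel" using m by (rule borel_measurable_continuous_onI)
  note [measurable_cong] = P(1) Q(2)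
  show "sets \<mu> = sets borel" using P(2) by (metis sets_distr)
  show "finite_measure \<mu>" using P(3) by (rule prob_space.finite_measure)
  show "finite_measure (distr Q borel m)"
    by (intro prob_space.finite_measure prob_space.prob_space_distr[OF Q(1)]) measurable
  fix f :: "'a \<Rightarrow> real" assume f: "continuous_on UNIV f" "bounded (range f)"
  have [measurable]: "f \<in> borel_measurable borel" using f by (intro borel_measurable_continuous_onI)
  have "continuous_on UNIV (\<lambda>p. f (m p))" by (rule continuous_on_compose2[OF f(1) m]) simp
  moreover have "bounded (range (\<lambda>p. f (m p)))" by (rule bounded_subset[OF f(2)]) auto
  ultimately have "(\<lambda>k. \<integral>p. f (m p) \<partial>P k) \<longlonglongrightarrow> (\<integral>p. f (m p) \<partial>Q)"
    using conv unfolding weakly_converges_def by blast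
  moreover have "(\<integral>p. f (m p) \<partial>P k) = (\<integral>x. f x \<partial>\<mu>)" for k
    unfolding P(2)[of k, symmetric] by (rule integral_distr[symmetric]) measurable
  ultimately show "(\<integral>x. f x \<partial>distr Q borel m) = (\<integral>x. f x \<partial>\<mu>)"
    by (simp add: integral_distr LIMSEQ_const_iff)
qed simp

lemma coupling_weak_limit:
  fixes \<mu> :: "'a::euclidean_space measure" and \<nu> :: "'b::euclidean_space measure"
  assumes P: "\<And>k. coupling \<mu> \<nu> (P k)" and Q: "prob_space Q" "sets Q = sets borel"
    and conv: "weakly_converges P Q sequentially"
  shows "coupling \<mu> \<nu> Q"
proof -
  note m = coupling_marginals[OF P]
  have "prob_space \<mu>" "prob_space \<nu>" using prob_space.prob_space_distr[OF m(5)] m by metis+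
  then have "distr Q borel fst = \<mu>" "distr Q borel snd = \<nu>"
    using m Q by (auto intro!: distr_weak_limit[OF conv] continuous_intros)
  then show ?thesis using Q by (simp add: coupling_def)
qed

text \<open>
  The transport cost as a function of \<open>F = \<Phi>(1,0)\<close> and \<open>M = M(1,0)\<close>.
\<close>

definition quadratic_cost :: "real^'n^'n \<Rightarrow> real^'n^'n \<Rightarrow> real^'n \<Rightarrow> real^'n \<Rightarrow> real" where
  "quadratic_cost F M x y = 1 / 2 * ((y - F *v x) \<bullet> (matrix_inv M *v (y - F *v x)))"

lemma continuous_matrix_vector_mult [continuous_intros]:
  "continuous_on S f \<Longrightarrow> continuous_on S (\<lambda>x. (A :: real^'n^'m) *v f x)"
  by (rule bounded_linear.continuous_on[OF matrix_vector_mul_bounded_linear])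

lemma quadratic_cost_continuous: "continuous_on UNIV (\<lambda>p. quadratic_cost F M (fst p) (snd p))"
  unfolding quadratic_cost_def by (intro continuous_intros)

lemma quadratic_cost_nonneg: "pos_def M \<Longrightarrow> 0 \<le> quadratic_cost F M x y"
  unfolding quadratic_cost_def using pos_def_matrix_inv[of M]
  by (cases "y - F *v x = 0") (auto simp: pos_def_def less_imp_le)

lemma quadratic_cost_bound: "\<exists>K\<ge>0. \<forall>x y. \<bar>quadratic_cost F M x y\<bar> \<le> K * ((norm x)\<^sup>2 + (norm y)\<^sup>2)"
proof -
  obtain a where a: "0 < a" "\<And>v. norm (matrix_inv M *v v) \<le> norm v * a"
    using bounded_linear.pos_bounded[OF matrix_vector_mul_bounded_linear] by metis
  obtain b where b: "0 < b" "\<And>v. norm (F *v v) \<le> norm v * b"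
    using bounded_linear.pos_bounded[OF matrix_vector_mul_bounded_linear] by metis
  have "\<bar>quadratic_cost F M x y\<bar> \<le> (a * (1 + b\<^sup>2)) * ((norm x)\<^sup>2 + (norm y)\<^sup>2)" for x y
  proof -
    let ?d = "y - F *v x"
    have "norm ?d \<le> norm y + norm x * b"
      using norm_triangle_ineq4[of y "F *v x"] b(2)[of x] by linarith
    then have "(norm ?d)\<^sup>2 \<le> (norm y + norm x * b)\<^sup>2" by (rule power_mono) simp
    also have "\<dots> \<le> 2 * ((norm y)\<^sup>2 + (norm x * b)\<^sup>2)"
      using sum_squares_bound[of "norm y" "norm x * b"] by (simp add: power2_sum)
    also have "\<dots> \<le> 2 * ((1 + b\<^sup>2) * ((norm x)\<^sup>2 + (norm y)\<^sup>2))"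
      by (simp add: algebra_simps power_mult_distrib)
    finally have d: "(norm ?d)\<^sup>2 \<le> 2 * ((1 + b\<^sup>2) * ((norm x)\<^sup>2 + (norm y)\<^sup>2))" .
    have "\<bar>?d \<bullet> (matrix_inv M *v ?d)\<bar> \<le> norm ?d * norm (matrix_inv M *v ?d)" by (rule Cauchy_Schwarz_ineq2)
    also have "\<dots> \<le> norm ?d * (norm ?d * a)" by (intro mult_left_mono a) simp
    also have "\<dots> = a * (norm ?d)\<^sup>2" by (simp add: power2_eq_square)
    also have "\<dots> \<le> a * (2 * ((1 + b\<^sup>2) * ((norm x)\<^sup>2 + (norm y)\<^sup>2)))"
      using d a(1) by (intro mult_left_mono) auto
    finally show ?thesis by (simp add: quadratic_cost_def abs_mult)
  qed
  then show ?thesis using a(1) by (intro exI[of _ "a * (1 + b\<^sup>2)"]) auto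
qed

text \<open>
  In a two-cycle the terms that depend on a single variable cancel and a bilinear form remains; this identifies cyclical monotonicity for pairs with monotonicity.
\<close>

lemma quadratic_cost_two_cycle:
  assumes M: "pos_def M"
  shows "quadratic_cost F M x y' + quadratic_cost F M x' y - (quadratic_cost F M x y + quadratic_cost F M x' y')
    = (x - x') \<bullet> ((transpose F ** matrix_inv M) *v y - (transpose F ** matrix_inv M) *v y')"
proof -
  note [simp del] = transpose_matrix_vector
  have sym: "u \<bullet> (matrix_inv M *v w) = w \<bullet> (matrix_inv M *v u)" for u w
    using symmetric_inner[of "matrix_inv M" u w] pos_def_matrix_inv[OF M]
    by (simp add: pos_def_def inner_commute)
  have K: "(x - x') \<bullet> ((transpose F ** matrix_inv M) *v y - (transpose F ** matrix_inv M) *v y')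
    = (F *v x - F *v x') \<bullet> (matrix_inv M *v y - matrix_inv M *v y')"
  proof -
    have "(x - x') \<bullet> (transpose F *v (matrix_inv M *v y - matrix_inv M *v y')) = (F *v (x - x')) \<bullet> (matrix_inv M *v y - matrix_inv M *v y')"
      by (simp only: inner_matrix_vector[of _ "transpose F"] transpose_transpose)
    then show ?thesis by (simp add: matrix_vector_mult_diff_distrib matrix_vector_mul_assoc)
  qed
  show ?thesis unfolding K quadratic_cost_def
    using sym[of "F *v x" y] sym[of "F *v x" y'] sym[of "F *v x'" y] sym[of "F *v x'" y']
    by (simp add: matrix_vector_mult_diff_distrib inner_diff_left inner_diff_right algebra_simps)
qed

lemma coupling_quadratic_cost_integrable:
  fixes \<mu> \<nu> :: "(real^'n) measure"
  assumes P: "coupling \<mu> \<nu> P" and \<mu>: "integrable \<mu> (\<lambda>x. (norm x)\<^sup>2)" and \<nu>: "integrable \<nu> (\<lambda>x. (norm x)\<^sup>2)"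
  shows "integrable P (\<lambda>p. quadratic_cost F M (fst p) (snd p))"
proof -
  note m = coupling_marginals[OF P]
  obtain K where K: "0 \<le> K" "\<And>x y. \<bar>quadratic_cost F M x y\<bar> \<le> K * ((norm x)\<^sup>2 + (norm y)\<^sup>2)"
    using quadratic_cost_bound by metis
  have "integrable P (\<lambda>p. (norm (fst p))\<^sup>2)" "integrable P (\<lambda>p. (norm (snd p))\<^sup>2)"
    using \<mu> \<nu> integrable_distr_eq[OF m(1), of "\<lambda>x. (norm x)\<^sup>2"] integrable_distr_eq[OF m(2), of "\<lambda>x. (norm x)\<^sup>2"]
    by (simp_all add: m)
  then have "integrable P (\<lambda>p. K * ((norm (fst p))\<^sup>2 + (norm (snd p))\<^sup>2))" by simp
  then show ?thesis
  proof (rule Bochner_Integration.integrable_bound)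
    show "(\<lambda>p. quadratic_cost F M (fst p) (snd p)) \<in> borel_measurable P"
      using borel_measurable_continuous_onI[OF quadratic_cost_continuous] m(6) by (simp cong: measurable_cong_sets)
    show "AE p in P. norm (quadratic_cost F M (fst p) (snd p)) \<le> norm (K * ((norm (fst p))\<^sup>2 + (norm (snd p))\<^sup>2))"
      using K by (simp add: abs_mult)
  qed
qed

text \<open>
  Both couplings live on a common closed contact set, which is monotone for the bilinear part of the cost and thus a graph up to a null set of the first marginal.
\<close>

theorem cyclically_monotone_coupling_eq_optimal:
  fixes \<mu> \<nu> :: "(real^'n) measure" and F M :: "real^'n^'n"
  assumes M: "pos_def M" and F: "invertible F"
    and \<mu>: "integrable \<mu> (\<lambda>x. (norm x)\<^sup>2)" and \<nu>: "integrable \<nu> (\<lambda>x. (norm x)\<^sup>2)"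
    and ac: "\<And>N. N \<in> null_sets lborel \<Longrightarrow> emeasure \<mu> N = 0"
    and P: "coupling \<mu> \<nu> P" "cyclically_monotone (quadratic_cost F M) S" "AE p in P. p \<in> S"
    and Q: "coupling \<mu> \<nu> Q"
      "(\<integral>p. quadratic_cost F M (fst p) (snd p) \<partial>Q) \<le> (\<integral>p. quadratic_cost F M (fst p) (snd p) \<partial>P)"
  shows "P = Q"
proof -
  let ?c = "quadratic_cost F M"
  note mP = coupling_marginals[OF P(1)]
  note mQ = coupling_marginals[OF Q(1)]
  have prob: "prob_space \<mu>" "prob_space \<nu>" "sets \<mu> = sets borel" "sets \<nu> = sets borel"
    using prob_space.prob_space_distr[OF mP(5)] mP by (metis sets_distr)+
  interpret \<mu>: prob_space \<mu> by (rule prob)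
  interpret \<nu>: prob_space \<nu> by (rule prob)
  obtain K where K: "0 \<le> K" "\<And>x y. \<bar>?c x y\<bar> \<le> K * ((norm x)\<^sup>2 + (norm y)\<^sup>2)"
    using quadratic_cost_bound by metis
  have c_meas: "(\<lambda>x. ?c x y) \<in> borel_measurable borel" "(\<lambda>x. ?c y x) \<in> borel_measurable borel" for y
    unfolding quadratic_cost_def by (intro borel_measurable_continuous_onI continuous_intros)+
  have m1: "integrable \<mu> (\<lambda>x. ?c x y)" for y
  proof (rule Bochner_Integration.integrable_bound)
    show "integrable \<mu> (\<lambda>x. K * ((norm x)\<^sup>2 + (norm y)\<^sup>2))" using \<mu> by simp
  qed (use K c_meas prob in \<open>auto simp: abs_mult cong: measurable_cong_sets\<close>)
  have m2: "integrable \<nu> (\<lambda>y. ?c x y)" for x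
  proof (rule Bochner_Integration.integrable_bound)
    show "integrable \<nu> (\<lambda>y. K * ((norm x)\<^sup>2 + (norm y)\<^sup>2))" using \<nu> by simp
  qed (use K c_meas prob in \<open>auto simp: abs_mult cong: measurable_cong_sets\<close>)
  obtain C where C: "closed C" "AE p in P. p \<in> C" "AE p in Q. p \<in> C"
    "\<And>x y x' y'. (x, y) \<in> C \<Longrightarrow> (x', y') \<in> C \<Longrightarrow> ?c x y + ?c x' y' \<le> ?c x y' + ?c x' y"
    using cyclically_monotone_imp_common_contact_set[OF quadratic_cost_continuous P(2,3) P(1)
        coupling_quadratic_cost_integrable[OF P(1) \<mu> \<nu>] Q(1) coupling_quadratic_cost_integrable[OF Q(1) \<mu> \<nu>] Q(2) m1 m2]
    by metis
  let ?K = "transpose F ** matrix_inv M"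
  have "invertible ?K"
    using F pos_def_invertible[OF pos_def_matrix_inv[OF M]]
    by (intro invertible_mult) (auto simp: transpose_invertible)
  then have inj: "inj ((*v) ?K)" by (simp add: inj_matrix_vector_mult)
  have mono: "0 \<le> (x - x') \<bullet> (?K *v y - ?K *v y')" if "(x, y) \<in> C" "(x', y') \<in> C" for x y x' y'
    using C(4)[OF that] quadratic_cost_two_cycle[OF M, of F x y' x' y] by simp
  obtain N where N: "N \<in> null_sets lborel" "\<And>x y y'. x \<notin> N \<Longrightarrow> (x, y) \<in> C \<Longrightarrow> (x, y') \<in> C \<Longrightarrow> y = y'"
    using closed_monotone_single_valued_AE[OF matrix_vector_mul_linear inj C(1) mono] by metis
  show "P = Q"
    by (rule coupling_eq_graph[OF C(1) _ ac[OF N(1)] N(2) mP(5,6,3) C(2) mQ(5,6,3) C(3)]) (use N(1) in auto)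
qed

lemma weakly_converges_sequentiallyI:
  assumes sub: "\<And>s. strict_mono s \<Longrightarrow> \<exists>r. strict_mono (r :: nat \<Rightarrow> nat) \<and> weakly_converges (\<lambda>k. P (s (r k))) \<mu> sequentially"
  shows "weakly_converges P \<mu> sequentially"
  unfolding weakly_converges_def
proof (intro allI impI, elim conjE, rule ccontr)
  fix f :: "'a \<Rightarrow> real" assume f: "continuous_on UNIV f" "bounded (range f)"
    and "\<not> (\<lambda>i. \<integral>x. f x \<partial>P i) \<longlonglongrightarrow> (\<integral>x. f x \<partial>\<mu>)"
  then obtain e where e: "0 < e" "\<not> (\<forall>\<^sub>F i in sequentially. dist (\<integral>x. f x \<partial>P i) (\<integral>x. f x \<partial>\<mu>) < e)"
    unfolding tendsto_iff by auto
  obtain s where s: "strict_mono (s :: nat \<Rightarrow> nat)" "\<And>n. \<not> dist (\<integral>x. f x \<partial>P (s n)) (\<integral>x. f x \<partial>\<mu>) < e"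
    using not_eventually_sequentiallyD[OF e(2)] by auto
  obtain r where "weakly_converges (\<lambda>k. P (s (r k))) \<mu> sequentially" using sub[OF s(1)] by auto
  then have "(\<lambda>k. \<integral>x. f x \<partial>P (s (r k))) \<longlonglongrightarrow> (\<integral>x. f x \<partial>\<mu>)" using f unfolding weakly_converges_def by blast
  then have "\<forall>\<^sub>F k in sequentially. dist (\<integral>x. f x \<partial>P (s (r k))) (\<integral>x. f x \<partial>\<mu>) < e" using e(1) by (rule tendstoD)
  then show False using s(2) by simp
qed

lemma weakly_converges_at_right_0I:
  assumes "\<And>X. (\<And>k. 0 < X k) \<Longrightarrow> X \<longlonglongrightarrow> 0 \<Longrightarrow> weakly_converges (\<lambda>k. P (X k)) \<mu> sequentially"
  shows "weakly_converges P \<mu> (at_right (0::real))"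
  unfolding weakly_converges_def
proof (intro allI impI)
  fix f :: "'a \<Rightarrow> real" assume f: "continuous_on UNIV f \<and> bounded (range f)"
  show "((\<lambda>i. \<integral>x. f x \<partial>P i) \<longlongrightarrow> (\<integral>x. f x \<partial>\<mu>)) (at_right 0)"
    unfolding tendsto_at_iff_sequentially comp_def
  proof (intro allI impI)
    fix X :: "nat \<Rightarrow> real" assume X: "\<forall>i. X i \<in> {0<..} - {0}" "X \<longlonglongrightarrow> 0"
    then have "weakly_converges (\<lambda>k. P (X k)) \<mu> sequentially" by (intro assms) auto
    then show "(\<lambda>n. \<integral>x. f x \<partial>P (X n)) \<longlonglongrightarrow> (\<integral>x. f x \<partial>\<mu>)" using f unfolding weakly_converges_def by blast
  qed
qed

text \<open>
  By compactness every subsequence has a further subsequence with a weak limit; its support is cyclically monotone, which identifies it as the optimal coupling.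
\<close>

theorem gibbs_couplings_converge_to_optimal:
  fixes \<mu> \<nu> :: "(real^'n) measure" and F M :: "real^'n^'n"
  assumes M: "pos_def M" and F: "invertible F"
    and \<mu>: "integrable \<mu> (\<lambda>x. (norm x)\<^sup>2)" and \<nu>: "integrable \<nu> (\<lambda>x. (norm x)\<^sup>2)"
    and ac: "\<And>N. N \<in> null_sets lborel \<Longrightarrow> emeasure \<mu> N = 0"
    and P: "\<And>k. P k = density lborel (\<lambda>(x, y). ennreal (C k * exp (- quadratic_cost F M x y / \<epsilon> k)) * f k x * g k y)"
    and meas: "\<And>k. f k \<in> borel_measurable borel" "\<And>k. g k \<in> borel_measurable borel"
    and pos: "\<And>k. 0 < C k" "\<And>k. 0 < \<epsilon> k" and \<epsilon>: "\<epsilon> \<longlonglongrightarrow> 0"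
    and coup: "\<And>k. coupling \<mu> \<nu> (P k)"
    and Q: "coupling \<mu> \<nu> Q"
      "\<And>R. coupling \<mu> \<nu> R \<Longrightarrow> (\<integral>p. quadratic_cost F M (fst p) (snd p) \<partial>Q) \<le> (\<integral>p. quadratic_cost F M (fst p) (snd p) \<partial>R)"
  shows "weakly_converges P Q sequentially"
proof (rule weakly_converges_sequentiallyI)
  fix s :: "nat \<Rightarrow> nat" assume s: "strict_mono s"
  note m = coupling_marginals[OF coup]
  have prob: "prob_space \<mu>" "prob_space \<nu>" "sets \<mu> = sets borel" "sets \<nu> = sets borel"
    using prob_space.prob_space_distr[OF m(5)] m by (metis sets_distr)+
  have "\<exists>R. \<forall>k. measure (P (s k)) {x. R < norm x} \<le> \<eta>" if "0 < \<eta>" for \<eta>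
    using coupling_tight[OF prob(1,3,2,4) that] coup by blast
  then obtain r R where r: "strict_mono (r :: nat \<Rightarrow> nat)" and R: "prob_space R" "sets R = sets borel"
    and conv: "weakly_converges (\<lambda>k. P (s (r k))) R sequentially"
    using tight_imp_weakly_convergent_subsequence[of "\<lambda>k. P (s k)"] m(5,6) by metis
  have coupR: "coupling \<mu> \<nu> R" by (rule coupling_weak_limit[OF coup R conv])
  have "(\<epsilon> \<circ> (s \<circ> r)) \<longlonglongrightarrow> 0" using \<epsilon> s r by (intro LIMSEQ_subseq_LIMSEQ strict_mono_o)
  then have "cyclically_monotone (quadratic_cost F M) (support R)"
    by (intro gibbs_limit_support_cyclically_monotone[OF quadratic_cost_continuous P meas pos _ m(5) R conv]) (simp add: comp_def)
  then have "R = Q"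
    using AE_support[OF prob_space.finite_measure[OF R(1)] R(2)] Q(2)[OF coupR]
    by (intro cyclically_monotone_coupling_eq_optimal[OF M F \<mu> \<nu> ac coupR _ _ Q(1)])
  then show "\<exists>r. strict_mono r \<and> weakly_converges (\<lambda>k. P (s (r k))) Q sequentially"
    using r conv by blast
qed

section \<open>Vanishing independent noise\<close>

text \<open>
  The difference of the two integrals of \<open>f\<close> is split into three parts: \<open>m p\<close> outside a large ball (tightness, from the weak convergence of \<open>P\<close>),
  noise larger than \<open>\<delta>\<close> (hypothesis), and the rest, where \<open>f\<close> is uniformly continuous.
\<close>

theorem weakly_converges_add_vanishing_noise:
  fixes m :: "'z::euclidean_space \<Rightarrow> 'a::euclidean_space"
  assumes P: "\<And>k. prob_space (P k)" "\<And>k. sets (P k) = sets borel"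
    and \<pi>: "prob_space \<pi>" "sets \<pi> = sets borel" and conv: "weakly_converges P \<pi> sequentially"
    and \<nu>: "\<And>k. prob_space (\<nu> k)" "\<And>k. sets (\<nu> k) = sets borel"
    and noise: "\<And>\<delta>. 0 < \<delta> \<Longrightarrow> (\<lambda>k. measure (\<nu> k) {w. \<delta> \<le> norm w}) \<longlonglongrightarrow> 0"
    and m: "continuous_on UNIV m"
  shows "weakly_converges (\<lambda>k. distr (P k \<Otimes>\<^sub>M \<nu> k) borel (\<lambda>(p, w). m p + w)) (distr \<pi> borel m) sequentially"
  unfolding weakly_converges_def
proof (intro allI impI, elim conjE)
  fix f :: "'a \<Rightarrow> real" assume f: "continuous_on UNIV f" "bounded (range f)"
  interpret \<pi>: prob_space \<pi> by (rule \<pi>)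
  have m_meas [measurable]: "m \<in> borel_measurable borel" using m by (rule borel_measurable_continuous_onI)
  have f_meas [measurable]: "f \<in> borel_measurable borel" using f(1) by (rule borel_measurable_continuous_onI)
  note [measurable_cong] = P(2) \<nu>(2) \<pi>(2)
  obtain b where b: "0 < b" "\<And>x. \<bar>f x\<bar> \<le> b" using f(2) unfolding bounded_pos by auto
  have fm: "continuous_on UNIV (\<lambda>p. f (m p))" "bounded (range (\<lambda>p. f (m p)))"
    by (rule continuous_on_compose2[OF f(1) m], simp) (rule bounded_subset[OF f(2)], auto)
  let ?I = "\<lambda>k. \<integral>x. f x \<partial>distr (P k \<Otimes>\<^sub>M \<nu> k) borel (\<lambda>(p, w). m p + w)"
  let ?J = "\<lambda>k. \<integral>p. f (m p) \<partial>P k"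
  have J: "?J \<longlonglongrightarrow> (\<integral>p. f (m p) \<partial>\<pi>)" using conv fm unfolding weakly_converges_def by blast
  have "(\<lambda>k. ?I k - ?J k) \<longlonglongrightarrow> 0"
  proof (rule LIMSEQ_I)
    fix \<eta>0 :: real assume "0 < \<eta>0"
    (* \<eta> for uniform continuity and 2 b \<eta> for each of the two exceptional events *)
    define \<eta> where "\<eta> = \<eta>0 / (1 + 4 * b)"
    have \<eta>: "0 < \<eta>" using \<open>0 < \<eta>0\<close> b(1) by (simp add: \<eta>_def)
    have "prob_space (distr \<pi> borel m)" "sets (distr \<pi> borel m) = sets borel"
      by (auto intro!: \<pi>.prob_space_distr)
    then obtain \<rho> where \<rho>: "measure (distr \<pi> borel m) {x. \<rho> < norm x} \<le> \<eta> / 2"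
      using borel_prob_space_tight[of "distr \<pi> borel m" "\<eta> / 2"] \<eta> by auto
    define U where "U = {p. norm (m p) < \<rho> + 1}"
    have U: "open U" unfolding U_def by (intro open_Collect_less continuous_intros m)
    have "measure \<pi> (- U) \<le> measure \<pi> (m -` {x. \<rho> < norm x})"
      by (rule \<pi>.finite_measure_mono) (auto simp: U_def \<pi>(2))
    also have "\<dots> = measure (distr \<pi> borel m) {x. \<rho> < norm x}"
      using sets_eq_imp_space_eq[OF \<pi>(2)] by (subst measure_distr) auto
    finally have "measure \<pi> (- U) < \<eta>" using \<rho> \<eta> by simp
    then have "1 - \<eta> < measure \<pi> U"
      using \<pi>.prob_compl[of U] U \<pi>(2) sets_eq_imp_space_eq[OF \<pi>(2)] by (simp add: Compl_eq_Diff_UNIV)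
    then have evU: "\<forall>\<^sub>F k in sequentially. 1 - \<eta> < measure (P k) U"
      by (rule weakly_converges_open_liminf[OF conv \<pi> P U])
    have "uniformly_continuous_on (cball 0 (\<rho> + 2)) f"
      using f(1) by (intro compact_uniformly_continuous continuous_on_subset[OF f(1)]) auto
    then obtain \<delta>0 where \<delta>0: "0 < \<delta>0"
      "\<And>x y. x \<in> cball 0 (\<rho> + 2) \<Longrightarrow> y \<in> cball 0 (\<rho> + 2) \<Longrightarrow> dist y x < \<delta>0 \<Longrightarrow> dist (f y) (f x) < \<eta>"
      unfolding uniformly_continuous_on_def using \<eta> by metis
    (* noise below 1 keeps the perturbed point in the ball where the modulus of continuity \<delta>0 is valid *)
    define \<delta> where "\<delta> = min 1 \<delta>0"
    have \<delta>: "0 < \<delta>" using \<delta>0 by (simp add: \<delta>_def)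
    define W where "W = {w::'a. \<delta> \<le> norm w}"
    have W_sets [measurable]: "W \<in> sets borel" unfolding W_def by measurable
    have U_sets [measurable]: "U \<in> sets borel" using U by simp
    have evW: "\<forall>\<^sub>F k in sequentially. measure (\<nu> k) W < \<eta>"
      unfolding W_def using noise[OF \<delta>] \<eta> order_tendstoD(2) by blast
    have ptwise: "\<bar>f (m p + w) - f (m p)\<bar> \<le> \<eta> + 2 * b * indicator (- U) p + 2 * b * indicator W w" for p w
    proof (cases "p \<in> U \<and> w \<notin> W")
      case True
      then have "norm (m p) < \<rho> + 1" "norm w < \<delta>" by (auto simp: U_def W_def)
      then have "m p \<in> cball 0 (\<rho> + 2)" "m p + w \<in> cball 0 (\<rho> + 2)"
        using norm_triangle_ineq[of "m p" w] by (auto simp: \<delta>_def)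
      moreover have "dist (m p + w) (m p) < \<delta>0" using \<open>norm w < \<delta>\<close> by (simp add: \<delta>_def dist_norm)
      ultimately have "dist (f (m p + w)) (f (m p)) < \<eta>" by (intro \<delta>0(2))
      then show ?thesis using True by (simp add: dist_real_def)
    next
      case False
      then have "2 * b \<le> 2 * b * indicator (- U) p + 2 * b * indicator W w" using b(1) by (auto simp: indicator_def)
      moreover have "\<bar>f (m p + w) - f (m p)\<bar> \<le> 2 * b" using b(2)[of "m p + w"] b(2)[of "m p"] by linarith
      ultimately show ?thesis using \<eta> by linarith
    qed
    have "\<forall>\<^sub>F k in sequentially. norm (?I k - ?J k - 0) < \<eta>0"
      using evU evW
    proof eventually_elim
      case (elim k)
      interpret Pk: prob_space "P k" by (rule P)
      interpret Nk: prob_space "\<nu> k" by (rule \<nu>)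
      interpret PN: pair_prob_space "P k" "\<nu> k" ..
      let ?D = "P k \<Otimes>\<^sub>M \<nu> k"
      have sp: "space (P k) = UNIV" "space (\<nu> k) = UNIV"
        using sets_eq_imp_space_eq[OF P(2)[of k]] sets_eq_imp_space_eq[OF \<nu>(2)[of k]] by auto
      have i1: "integrable ?D (\<lambda>z. f (m (fst z) + snd z))" "integrable ?D (\<lambda>z. f (m (fst z)))"
        by (rule PN.P.integrable_const_bound[where B=b]; (use b(2) in \<open>simp; fail\<close> | measurable))+
      have i2: "integrable ?D (\<lambda>z. indicator (- U) (fst z) :: real)" "integrable ?D (\<lambda>z. indicator W (snd z) :: real)"
        by (rule PN.P.integrable_const_bound[where B=1]; (simp add: indicator_def; fail | measurable))+
      have "?I k = (\<integral>z. f (m (fst z) + snd z) \<partial>?D)"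
        by (subst integral_distr) (auto simp: case_prod_unfold)
      moreover have "?J k = (\<integral>z. f (m (fst z)) \<partial>?D)"
        using integral_distr[of fst ?D "P k" "\<lambda>p. f (m p)"] Nk.distr_pair_fst[of "P k"] by simp
      ultimately have "?I k - ?J k = (\<integral>z. f (m (fst z) + snd z) - f (m (fst z)) \<partial>?D)"
        using i1 by simp
      also have "\<bar>\<dots>\<bar> \<le> (\<integral>z. \<bar>f (m (fst z) + snd z) - f (m (fst z))\<bar> \<partial>?D)"
        by (rule integral_abs_bound)
      also have "\<dots> \<le> (\<integral>z. \<eta> + 2 * b * indicator (- U) (fst z) + 2 * b * indicator W (snd z) \<partial>?D)"
        using i1 i2 ptwise by (intro integral_mono) auto
      also have "\<dots> = \<eta> + 2 * b * (\<integral>z. indicator (- U) (fst z) \<partial>?D) + 2 * b * (\<integral>z. indicator W (snd z) \<partial>?D)"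
        using i2 by (simp add: PN.P.prob_space)
      also have "(\<integral>z. indicator (- U) (fst z) \<partial>?D) = measure (P k) (- U)"
        using integral_distr[of fst ?D "P k" "\<lambda>p. indicator (- U) p :: real"] Nk.distr_pair_fst[of "P k"] by (simp add: sp)
      also have "(\<integral>z. indicator W (snd z) \<partial>?D) = measure (\<nu> k) W"
      proof -
        have "emeasure ?D (UNIV \<times> W) = emeasure (P k) UNIV * emeasure (\<nu> k) W"
          by (rule Nk.emeasure_pair_measure_Times) (use W_sets in \<open>auto simp: P(2) \<nu>(2)\<close>)
        then have "measure ?D (UNIV \<times> W) = measure (\<nu> k) W"
          using Pk.emeasure_space_1 by (simp add: sp measure_def)
        moreover have "(\<integral>z. indicator W (snd z) \<partial>?D) = (\<integral>z. indicat_real (UNIV \<times> W) z \<partial>?D)"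
          by (intro Bochner_Integration.integral_cong) (auto simp: indicator_def mem_Times_iff)
        ultimately show ?thesis by (simp add: sp space_pair_measure)
      qed
      also have "measure (P k) (- U) = 1 - measure (P k) U"
        using Pk.prob_compl[of U] by (simp add: sp Compl_eq_Diff_UNIV P(2))
      finally have "\<bar>?I k - ?J k\<bar> \<le> \<eta> + 2 * b * (1 - measure (P k) U) + 2 * b * measure (\<nu> k) W" .
      also have "\<dots> < \<eta> + 2 * b * \<eta> + 2 * b * \<eta>"
        using elim b(1) by (intro add_strict_mono add_le_less_mono mult_strict_left_mono) auto
      also have "\<dots> = \<eta> * (1 + 4 * b)" by (simp add: algebra_simps)
      also have "\<dots> = \<eta>0" using b(1) by (simp add: \<eta>_def)
      finally show ?case by simp
    qed
    then show "\<exists>no. \<forall>k\<ge>no. norm (?I k - ?J k - 0) < \<eta>0" by (simp add: eventually_sequentially)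
  qed
  from tendsto_add[OF this J] have "?I \<longlonglongrightarrow> (\<integral>p. f (m p) \<partial>\<pi>)" by simp
  then show "?I \<longlonglongrightarrow> (\<integral>x. f x \<partial>distr \<pi> borel m)" by (simp add: integral_distr)
qed

section \<open>The Gaussian bridge\<close>

definition gaussian_const :: "real \<Rightarrow> real^'n^'n \<Rightarrow> real" where
  "gaussian_const \<epsilon> M = (2 * pi * \<epsilon>) powr (- real CARD('n) / 2) * det M powr (- 1 / 2)"

definition gaussian_kernel :: "real \<Rightarrow> real^'n^'n \<Rightarrow> real^'n \<Rightarrow> real" where
  "gaussian_kernel \<epsilon> M w = gaussian_const \<epsilon> M * exp (- (1 / (2 * \<epsilon>)) * (w \<bullet> (matrix_inv M *v w)))"

text \<open>
  The inverse covariance of the bridge, up to the factor \<open>\<epsilon>\<close>, as a quadratic form: \<open>P\<close> is the covariance from time \<open>0\<close> to \<open>t\<close>, \<open>R\<close> the one from \<open>t\<close> to \<open>1\<close> and \<open>F\<close> the flow from \<open>t\<close> to \<open>1\<close>.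
\<close>

definition bridge_form :: "real^'n^'n \<Rightarrow> real^'n^'n \<Rightarrow> real^'n^'n \<Rightarrow> real^'n \<Rightarrow> real" where
  "bridge_form P R F w = w \<bullet> (matrix_inv P *v w) + (F *v w) \<bullet> (matrix_inv R *v (F *v w))"

text \<open>
  The density of the deviation of the bridge from its mean. Its normalising constant is kept as the quotient that arises from the Markov property; that the integral is \<open>1\<close> is then a consequence of the Chapman-Kolmogorov equation.
\<close>

definition bridge_kernel ::
    "real \<Rightarrow> real^'n^'n \<Rightarrow> real^'n^'n \<Rightarrow> real^'n^'n \<Rightarrow> real^'n \<Rightarrow> real" where
  "bridge_kernel \<epsilon> P R F w = gaussian_const \<epsilon> P * gaussian_const \<epsilon> R / gaussian_const \<epsilon> (F ** P ** transpose F + R) *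
     exp (- (1 / (2 * \<epsilon>)) * bridge_form P R F w)"

lemma transition_density_eq_gaussian_kernel:
  "transition_density \<Phi> B \<epsilon> s x t y = gaussian_kernel \<epsilon> (gramian \<Phi> B t s) (y - \<Phi> t s *v x)"
  by (simp add: transition_density_def gaussian_kernel_def gaussian_const_def)

lemma gaussian_const_pos:
  assumes "pos_def M" "0 < \<epsilon>" shows "0 < gaussian_const \<epsilon> M"
  using pos_def_invertible[OF assms(1)] assms(2) by (simp add: gaussian_const_def invertible_det_nz)

lemma gaussian_kernel_measurable [measurable]: "gaussian_kernel \<epsilon> M \<in> borel_measurable borel"
  unfolding gaussian_kernel_def[abs_def]
  by (intro borel_measurable_continuous_onI continuous_intros)

lemma bridge_form_continuous: "continuous_on UNIV (bridge_form P R F)"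
  unfolding bridge_form_def[abs_def] by (intro continuous_intros)

lemma bridge_kernel_measurable [measurable]: "bridge_kernel \<epsilon> P R F \<in> borel_measurable borel"
  unfolding bridge_kernel_def[abs_def]
  by (intro borel_measurable_continuous_onI continuous_intros bridge_form_continuous)

lemma nn_integral_gaussian_kernel_shift:
  assumes "pos_def M" "0 < \<epsilon>"
  shows "(\<integral>\<^sup>+y. ennreal (gaussian_kernel \<epsilon> M (y - a)) \<partial>lborel) = 1"
  using nn_integral_lborel_translate[of "\<lambda>w. ennreal (gaussian_kernel \<epsilon> M w)" "- a"] nn_integral_gaussian_kernel[OF assms]
  by (simp add: gaussian_kernel_def gaussian_const_def)

lemma gaussian_kernel_bridge:
  assumes P: "pos_def P" and R: "pos_def R" and M: "pos_def M" "M = F ** P ** transpose F + R" and \<epsilon>: "0 < \<epsilon>"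
  shows "gaussian_kernel \<epsilon> P v * gaussian_kernel \<epsilon> R (d - F *v v)
    = gaussian_kernel \<epsilon> M d * bridge_kernel \<epsilon> P R F (v - (P ** transpose F ** matrix_inv M) *v d)"
proof -
  define w where "w = v - (P ** transpose F ** matrix_inv M) *v d"
  have sq: "v \<bullet> (matrix_inv P *v v) + (d - F *v v) \<bullet> (matrix_inv R *v (d - F *v v))
    = d \<bullet> (matrix_inv M *v d) + bridge_form P R F w"
    unfolding w_def bridge_form_def by (rule complete_square_bridge[OF P R pos_def_invertible[OF M(1)] M(2)])
  let ?a = "- (1 / (2 * \<epsilon>))"
  have "exp (?a * (v \<bullet> (matrix_inv P *v v))) * exp (?a * ((d - F *v v) \<bullet> (matrix_inv R *v (d - F *v v))))
    = exp (?a * (d \<bullet> (matrix_inv M *v d))) * exp (?a * bridge_form P R F w)"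
    unfolding exp_add[symmetric] distrib_left[symmetric] sq ..
  then show ?thesis
    using gaussian_const_pos[OF M(1) \<epsilon>]
    unfolding gaussian_kernel_def bridge_kernel_def M(2)[symmetric] w_def[symmetric]
    by (simp add: field_simps)
qed

text \<open>
  Integrate the factorisation over \<open>v\<close> and \<open>d\<close> in both orders: one order gives \<open>1\<close>, the other the mass of the bridge kernel. The determinant of the precision matrix of the bridge is never computed.
\<close>

lemma nn_integral_bridge_kernel:
  fixes P R F :: "real^'n^'n"
  assumes P: "pos_def P" and R: "pos_def R" and M: "pos_def (F ** P ** transpose F + R)" and \<epsilon>: "0 < \<epsilon>"
  shows "(\<integral>\<^sup>+w. ennreal (bridge_kernel \<epsilon> P R F w) \<partial>lborel) = 1"
proof -
  let ?M = "F ** P ** transpose F + R"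
  let ?b = "bridge_kernel \<epsilon> P R F"
  note pos = gaussian_const_pos[OF P \<epsilon>] gaussian_const_pos[OF R \<epsilon>] gaussian_const_pos[OF M \<epsilon>]
  have nn: "0 \<le> gaussian_kernel \<epsilon> P w" "0 \<le> gaussian_kernel \<epsilon> R w" "0 \<le> gaussian_kernel \<epsilon> ?M w" "0 \<le> ?b w" for w
    using pos by (simp_all add: gaussian_kernel_def bridge_kernel_def)
  have "1 = (\<integral>\<^sup>+v. ennreal (gaussian_kernel \<epsilon> P v) * (\<integral>\<^sup>+d. ennreal (gaussian_kernel \<epsilon> R (d - F *v v)) \<partial>lborel) \<partial>lborel)"
    using nn_integral_gaussian_kernel_shift[OF P \<epsilon>, of 0] by (simp add: nn_integral_gaussian_kernel_shift[OF R \<epsilon>])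
  also have "\<dots> = (\<integral>\<^sup>+v. (\<integral>\<^sup>+d. ennreal (gaussian_kernel \<epsilon> P v) * ennreal (gaussian_kernel \<epsilon> R (d - F *v v)) \<partial>lborel) \<partial>lborel)"
    by (intro nn_integral_cong nn_integral_cmult[symmetric]) measurable
  also have "\<dots> = (\<integral>\<^sup>+d. (\<integral>\<^sup>+v. ennreal (gaussian_kernel \<epsilon> P v) * ennreal (gaussian_kernel \<epsilon> R (d - F *v v)) \<partial>lborel) \<partial>lborel)"
    by (rule lborel_pair.Fubini'[symmetric]) measurable
  also have "\<dots> = (\<integral>\<^sup>+d. (\<integral>\<^sup>+v. ennreal (gaussian_kernel \<epsilon> ?M d) * ennreal (?b (v - (P ** transpose F ** matrix_inv ?M) *v d)) \<partial>lborel) \<partial>lborel)"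
    by (intro nn_integral_cong) (simp add: ennreal_mult[symmetric] nn gaussian_kernel_bridge[OF P R M refl \<epsilon>])
  also have "\<dots> = (\<integral>\<^sup>+d. ennreal (gaussian_kernel \<epsilon> ?M d) * (\<integral>\<^sup>+v. ennreal (?b v) \<partial>lborel) \<partial>lborel)"
  proof (rule nn_integral_cong)
    fix d
    show "(\<integral>\<^sup>+v. ennreal (gaussian_kernel \<epsilon> ?M d) * ennreal (?b (v - (P ** transpose F ** matrix_inv ?M) *v d)) \<partial>lborel)
      = ennreal (gaussian_kernel \<epsilon> ?M d) * (\<integral>\<^sup>+v. ennreal (?b v) \<partial>lborel)"
      using nn_integral_lborel_translate[of "\<lambda>w. ennreal (?b w)" "- ((P ** transpose F ** matrix_inv ?M) *v d)"]
      by (subst nn_integral_cmult) auto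
  qed
  also have "\<dots> = (\<integral>\<^sup>+d. ennreal (gaussian_kernel \<epsilon> ?M d) \<partial>lborel) * (\<integral>\<^sup>+v. ennreal (?b v) \<partial>lborel)"
    by (rule nn_integral_multc) measurable
  also have "\<dots> = (\<integral>\<^sup>+v. ennreal (?b v) \<partial>lborel)"
    using nn_integral_gaussian_kernel_shift[OF M \<epsilon>, of 0] by simp
  finally show ?thesis by simp
qed

lemma pos_def_coercive:
  assumes "pos_def (N :: real^'n^'n)"
  obtains l where "0 < l" "\<And>w. l * (norm w)\<^sup>2 \<le> w \<bullet> (N *v w)"
proof -
  have cont: "continuous_on (sphere 0 1) (\<lambda>w. w \<bullet> (N *v w))" by (intro continuous_intros)
  have "axis undefined 1 \<in> sphere (0 :: real^'n) 1" by (simp add: norm_axis_1)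
  then have "sphere (0 :: real^'n) 1 \<noteq> {}" by blast
  from continuous_attains_inf[OF compact_sphere this cont] obtain w0 where w0: "w0 \<in> sphere 0 1" "\<And>w. w \<in> sphere 0 1 \<Longrightarrow> w0 \<bullet> (N *v w0) \<le> w \<bullet> (N *v w)"
    by blast
  show thesis
  proof (rule that)
    have "w0 \<noteq> 0" using w0(1) by auto
    then show "0 < w0 \<bullet> (N *v w0)" using assms by (simp add: pos_def_def)
    fix w :: "real^'n"
    show "(w0 \<bullet> (N *v w0)) * (norm w)\<^sup>2 \<le> w \<bullet> (N *v w)"
    proof (cases "w = 0")
      case False
      have "(1 / norm w) *\<^sub>R w \<in> sphere 0 1" using False by simp
      from w0(2)[OF this] show ?thesis using False
        by (simp add: matrix_vector_mult_scaleR power2_eq_square field_simps)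
    qed simp
  qed
qed

text \<open>
  Comparison with the kernel at parameter \<open>2 \<epsilon>\<close>, whose mass is also \<open>1\<close>: half of the exponent is spent on the factor
  \<open>exp (- l \<delta>\<^sup>2 / (4 \<epsilon>))\<close>, and the ratio \<open>A\<close> of the normalising constants does not depend on \<open>\<epsilon>\<close>.
\<close>

lemma bridge_kernel_concentrates:
  fixes P R F :: "real^'n^'n"
  assumes P: "pos_def P" and R: "pos_def R" and M: "pos_def (F ** P ** transpose F + R)"
    and \<epsilon>: "\<And>k. 0 < \<epsilon> k" "\<epsilon> \<longlonglongrightarrow> 0" and \<delta>: "0 < \<delta>"
  shows "(\<lambda>k. measure (density lborel (\<lambda>w. ennreal (bridge_kernel (\<epsilon> k) P R F w))) {w. \<delta> \<le> norm w}) \<longlonglongrightarrow> 0"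
proof -
  obtain l where l: "0 < l" "\<And>w. l * (norm w)\<^sup>2 \<le> w \<bullet> (matrix_inv P *v w)"
    using pos_def_coercive[OF pos_def_matrix_inv[OF P]] by blast
  have form: "l * \<delta>\<^sup>2 \<le> bridge_form P R F w" if "\<delta> \<le> norm w" for w
  proof -
    have "l * \<delta>\<^sup>2 \<le> l * (norm w)\<^sup>2" using that \<delta> l(1) by (intro mult_left_mono power_mono) auto
    also have "\<dots> \<le> w \<bullet> (matrix_inv P *v w)" by (rule l)
    also have "\<dots> \<le> bridge_form P R F w"
      using pos_def_matrix_inv[OF R] unfolding bridge_form_def
      by (cases "F *v w = 0") (auto simp: pos_def_def less_imp_le)
    finally show ?thesis .
  qed
  (* the ratio of the normalising constants at \<epsilon> and 2 \<epsilon> *)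
  define A where "A = 2 powr (real CARD('n) / 2)"
  define c where "c e = gaussian_const e P * gaussian_const e R / gaussian_const e (F ** P ** transpose F + R)" for e
  have const: "c e = A * c (2 * e)" if "0 < e" for e
  proof -
    have "(2 * pi * e) powr (- real CARD('n) / 2) = A * (2 * pi * (2 * e)) powr (- real CARD('n) / 2)"
    proof -
      have "(2 * pi * (2 * e)) powr (- real CARD('n) / 2) = (2 * pi * e) powr (- real CARD('n) / 2) * 2 powr (- real CARD('n) / 2)"
        using that by (subst powr_mult[symmetric]) (auto simp: mult_ac)
      moreover have "A * 2 powr (- real CARD('n) / 2) = 1"
        by (simp add: A_def powr_add[symmetric])
      moreover have "A * (x * y) = x * (A * y)" for x y by simp
      ultimately show ?thesis by (simp only: mult_1_right)
    qed
    then have "gaussian_const e N = A * gaussian_const (2 * e) N" for N :: "real^'n^'n"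
      by (simp add: gaussian_const_def)
    moreover have "A \<noteq> 0" by (simp add: A_def)
    ultimately show ?thesis by (simp add: c_def)
  qed
  have bound: "measure (density lborel (\<lambda>w. ennreal (bridge_kernel e P R F w))) {w. \<delta> \<le> norm w} \<le> A * exp (- (l * \<delta>\<^sup>2 / 4) * inverse e)"
    if e: "0 < e" for e
  proof -
    let ?W = "{w::real^'n. \<delta> \<le> norm w}"
    have e2: "0 < 2 * e" using e by simp
    have W [measurable]: "?W \<in> sets borel" by measurable
    have nn: "0 \<le> bridge_kernel (2 * e) P R F w" for w
      using gaussian_const_pos[OF P e2] gaussian_const_pos[OF R e2] gaussian_const_pos[OF M e2] by (simp add: bridge_kernel_def)
    have "emeasure (density lborel (\<lambda>w. ennreal (bridge_kernel e P R F w))) ?W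
      = (\<integral>\<^sup>+w. ennreal (bridge_kernel e P R F w) * indicator ?W w \<partial>lborel)"
      by (subst emeasure_density) auto
    also have "\<dots> \<le> (\<integral>\<^sup>+w. ennreal (A * exp (- (l * \<delta>\<^sup>2 / 4) * inverse e)) * ennreal (bridge_kernel (2 * e) P R F w) \<partial>lborel)"
    proof (rule nn_integral_mono)
      fix w
      have "bridge_kernel e P R F w \<le> A * exp (- (l * \<delta>\<^sup>2 / 4) * inverse e) * bridge_kernel (2 * e) P R F w" if "\<delta> \<le> norm w"
      proof -
        have "- (1 / (2 * e)) * bridge_form P R F w = - (1 / (4 * e)) * bridge_form P R F w + - (1 / (2 * (2 * e))) * bridge_form P R F w"
          using e by (simp add: field_simps)
        also have "\<dots> \<le> - (l * \<delta>\<^sup>2 / 4) * inverse e + - (1 / (2 * (2 * e))) * bridge_form P R F w"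
          using form[OF that] e by (simp add: field_simps)
        finally have "exp (- (1 / (2 * e)) * bridge_form P R F w) \<le> exp (- (l * \<delta>\<^sup>2 / 4) * inverse e) * exp (- (1 / (2 * (2 * e))) * bridge_form P R F w)"
          unfolding exp_add[symmetric] by simp
        from mult_left_mono[OF this, of "A * c (2 * e)"]
        show ?thesis
          using gaussian_const_pos[OF P e2] gaussian_const_pos[OF R e2] gaussian_const_pos[OF M e2]
          unfolding bridge_kernel_def c_def[symmetric] const[OF e] by (simp add: A_def c_def mult_ac)
      qed
      then show "ennreal (bridge_kernel e P R F w) * indicator ?W w \<le> ennreal (A * exp (- (l * \<delta>\<^sup>2 / 4) * inverse e)) * ennreal (bridge_kernel (2 * e) P R F w)"
        using nn[of w] by (auto simp: indicator_def A_def ennreal_mult[symmetric] intro!: ennreal_leI)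
    qed
    also have "\<dots> = ennreal (A * exp (- (l * \<delta>\<^sup>2 / 4) * inverse e))"
      by (subst nn_integral_cmult) (auto simp: nn_integral_bridge_kernel[OF P R M e2])
    finally show ?thesis
      unfolding measure_def by (intro enn2real_leI) (auto simp: A_def)
  qed
  have "(\<lambda>k. exp (- (l * \<delta>\<^sup>2 / 4) * inverse (\<epsilon> k))) \<longlonglongrightarrow> 0"
    using l(1) \<delta> \<epsilon> by (intro exp_neg_inverse_tendsto_0) auto
  then have lim: "(\<lambda>k. A * exp (- (l * \<delta>\<^sup>2 / 4) * inverse (\<epsilon> k))) \<longlonglongrightarrow> 0"
    using tendsto_mult_right_zero by simp
  show ?thesis
  proof (rule tendsto_sandwich[OF always_eventually always_eventually tendsto_const lim]; rule allI)
    fix k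
    show "0 \<le> measure (density lborel (\<lambda>w. ennreal (bridge_kernel (\<epsilon> k) P R F w))) {w. \<delta> \<le> norm w}" by simp
    show "measure (density lborel (\<lambda>w. ennreal (bridge_kernel (\<epsilon> k) P R F w))) {w. \<delta> \<le> norm w}
      \<le> A * exp (- (l * \<delta>\<^sup>2 / 4) * inverse (\<epsilon> k))" by (rule bound[OF \<epsilon>(1)])
  qed
qed

text \<open>
  The conditional mean of \<open>x(t)\<close> given both endpoints \<open>x(0) = fst p\<close> and \<open>x(1) = snd p\<close>.
\<close>

definition bridge_mean ::
    "(real \<Rightarrow> real \<Rightarrow> real^'n^'n) \<Rightarrow> (real \<Rightarrow> real^'m^'n) \<Rightarrow> real \<Rightarrow> (real^'n) \<times> (real^'n) \<Rightarrow> real^'n" where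
  "bridge_mean \<Phi> B t p = \<Phi> t 0 *v fst p +
     (gramian \<Phi> B t 0 ** transpose (\<Phi> 1 t) ** matrix_inv (gramian \<Phi> B 1 0)) *v (snd p - \<Phi> 1 0 *v fst p)"

lemma bridge_mean_continuous: "continuous_on UNIV (bridge_mean \<Phi> B t)"
  unfolding bridge_mean_def[abs_def] by (intro continuous_intros)

text \<open>
  The two formulas differ by the identity \<open>R = M - F P F'\<close> for the Gramian on \<open>[t, 1]\<close>.
\<close>

lemma interpolation_map_eq_bridge_mean:
  assumes \<Phi>: "state_transition A \<Phi>" "continuous_on {0..1} A" and ctrl: "controllable \<Phi> B" and t: "0 < t" "t < 1"
  shows "interpolation_map \<Phi> B T t x = bridge_mean \<Phi> B t (x, T x)"
proof -
  let ?M = "gramian \<Phi> B 1 0" and ?P = "gramian \<Phi> B t 0" and ?R = "gramian \<Phi> B 1 t" and ?F = "\<Phi> 1 t"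
  have inv: "?M ** matrix_inv ?M = mat 1"
    using ctrl by (intro matrix_inv_right) (simp add: controllable_def)
  have "\<Phi> t 1 ** ?R ** matrix_inv ?M ** \<Phi> 1 0
      = \<Phi> t 1 ** (?M - ?F ** ?P ** transpose ?F) ** matrix_inv ?M ** \<Phi> 1 0"
    using gramian_split[OF \<Phi> ctrl t] by simp
  also have "\<dots> = \<Phi> t 1 ** (?M ** matrix_inv ?M) ** \<Phi> 1 0 - (\<Phi> t 1 ** ?F) ** ?P ** transpose ?F ** matrix_inv ?M ** \<Phi> 1 0"
    by (simp add: bounded_bilinear.diff_left[OF bounded_bilinear_matrix_mult]
        bounded_bilinear.diff_right[OF bounded_bilinear_matrix_mult] matrix_mul_assoc)
  also have "\<Phi> t 1 ** ?F = mat 1" using t by (intro state_transition_inverse[OF \<Phi>]) auto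
  also have "\<Phi> t 1 ** (?M ** matrix_inv ?M) ** \<Phi> 1 0 = \<Phi> t 0"
    using state_transition_compose[OF \<Phi>, of t 1 0] t by (simp add: inv)
  finally show ?thesis
    by (simp add: interpolation_map_def bridge_mean_def matrix_vector_mult_diff_rdistrib
        matrix_vector_mult_diff_distrib matrix_vector_mul_assoc matrix_mul_assoc)
qed

lemma transition_density_bridge:
  assumes \<Phi>: "state_transition A \<Phi>" "continuous_on {0..1} A" and ctrl: "controllable \<Phi> B"
    and t: "0 < t" "t < 1" and \<epsilon>: "0 < \<epsilon>"
  shows "transition_density \<Phi> B \<epsilon> 0 x t z * transition_density \<Phi> B \<epsilon> t z 1 y
    = transition_density \<Phi> B \<epsilon> 0 x 1 y * bridge_kernel \<epsilon> (gramian \<Phi> B t 0) (gramian \<Phi> B 1 t) (\<Phi> 1 t) (z - bridge_mean \<Phi> B t (x, y))"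
proof -
  have pd: "pos_def (gramian \<Phi> B t 0)" "pos_def (gramian \<Phi> B 1 t)" "pos_def (gramian \<Phi> B 1 0)"
    using t by (auto intro!: gramian_pos_def[OF ctrl])
  have comp: "\<Phi> 1 t *v (\<Phi> t 0 *v x) = \<Phi> 1 0 *v x"
    using state_transition_compose[OF \<Phi>, of 1 t 0] t by (simp add: matrix_vector_mul_assoc)
  show ?thesis
    using gaussian_kernel_bridge[OF pd(1,2,3) gramian_split[OF \<Phi> ctrl t] \<epsilon>, of "z - \<Phi> t 0 *v x" "y - \<Phi> 1 0 *v x"]
    by (simp add: transition_density_eq_gaussian_kernel bridge_mean_def matrix_vector_mult_diff_distrib comp algebra_simps)
qed

lemma transition_density_measurable_pair [measurable]:
  fixes f :: "'a \<Rightarrow> real^'n"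
  assumes [measurable]: "f \<in> borel_measurable N" "g \<in> borel_measurable N"
  shows "(\<lambda>w. transition_density \<Phi> B \<epsilon> s (f w) t (g w)) \<in> borel_measurable N"
  unfolding transition_density_eq_gaussian_kernel by measurable

text \<open>
  Tonelli brings the integrals over the endpoints outside; the bridge factorisation then turns the remaining density in \<open>z\<close> into that of the noise around the bridge mean.
\<close>

lemma entropic_interpolation_eq_noisy_bridge:
  fixes \<Phi> :: "real \<Rightarrow> real \<Rightarrow> real^'n^'n"
  assumes \<Phi>: "state_transition A \<Phi>" "continuous_on {0..1} A" and ctrl: "controllable \<Phi> B"
    and t: "0 < t" "t < 1" and \<epsilon>: "0 < \<epsilon>" and pair: "schrodinger_pair \<Phi> B \<epsilon> \<mu>0 \<mu>1 \<phi>hat0 \<phi>1"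
  defines "\<nu> \<equiv> density lborel (\<lambda>w. ennreal (bridge_kernel \<epsilon> (gramian \<Phi> B t 0) (gramian \<Phi> B 1 t) (\<Phi> 1 t) w))"
  shows "entropic_interpolation \<Phi> B \<epsilon> \<mu>0 \<mu>1 \<phi>hat0 \<phi>1 t
    = distr (schrodinger_plan \<Phi> B \<epsilon> \<phi>hat0 \<phi>1 \<Otimes>\<^sub>M \<nu>) borel (\<lambda>(p, w). bridge_mean \<Phi> B t p + w)"
    (is "?E = distr (?S \<Otimes>\<^sub>M \<nu>) borel ?h")
proof (rule measure_eqI)
  have pd: "pos_def (gramian \<Phi> B t 0)" "pos_def (gramian \<Phi> B 1 t)" "pos_def (gramian \<Phi> B 1 0)"
    using t by (auto intro!: gramian_pos_def[OF ctrl])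
  have [measurable]: "\<phi>hat0 \<in> borel_measurable borel" "\<phi>1 \<in> borel_measurable borel"
    using pair by (auto simp: schrodinger_pair_def)
  let ?b = "bridge_kernel \<epsilon> (gramian \<Phi> B t 0) (gramian \<Phi> B 1 t) (\<Phi> 1 t)"
  have m [measurable]: "bridge_mean \<Phi> B t \<in> borel_measurable borel"
    by (rule borel_measurable_continuous_onI[OF bridge_mean_continuous])
  have [measurable]: "fst \<in> borel_measurable (borel :: ((real^'n) \<times> (real^'n)) measure)"
    "snd \<in> borel_measurable (borel :: ((real^'n) \<times> (real^'n)) measure)"
    by (intro borel_measurable_continuous_onI continuous_intros)+
  have nn: "0 \<le> transition_density \<Phi> B \<epsilon> s x u y" for s x u y
    by (simp add: transition_density_def)
  have bn: "0 \<le> ?b w" for w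
    using gaussian_const_pos[OF pd(1) \<epsilon>] gaussian_const_pos[OF pd(2) \<epsilon>] gaussian_const_pos[OF pd(3) \<epsilon>]
    by (simp add: bridge_kernel_def gramian_split[OF \<Phi> ctrl t, symmetric])
  have "(\<integral>\<^sup>+w. ennreal (?b w) \<partial>lborel) = 1"
    using pd \<epsilon> gramian_split[OF \<Phi> ctrl t] by (intro nn_integral_bridge_kernel) auto
  then have "prob_space \<nu>"
    unfolding \<nu>_def by (intro prob_spaceI) (simp add: emeasure_density)
  then interpret \<nu>: prob_space \<nu> .
  show "sets ?E = sets (distr (?S \<Otimes>\<^sub>M \<nu>) borel ?h)" using t by (simp add: entropic_interpolation_def)
  fix S assume "S \<in> sets ?E"
  then have S [measurable]: "S \<in> sets borel" using t by (simp add: entropic_interpolation_def)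
  have setsS: "sets ?S = sets borel" by (simp add: schrodinger_plan_def)
  have sets\<nu>: "sets \<nu> = sets borel" by (simp add: \<nu>_def)
  have h_meas: "?h \<in> ?S \<Otimes>\<^sub>M \<nu> \<rightarrow>\<^sub>M borel"
    using setsS sets\<nu> by (simp cong: measurable_cong_sets sets_pair_measure_cong)
  let ?q = "transition_density \<Phi> B \<epsilon>" and ?m = "bridge_mean \<Phi> B t"
  let ?d = "\<lambda>p. ennreal (?q 0 (fst p) 1 (snd p)) * \<phi>hat0 (fst p) * \<phi>1 (snd p)"
  have "emeasure ?E S = (\<integral>\<^sup>+z. (\<integral>\<^sup>+y. ennreal (?q t z 1 y) * \<phi>1 y \<partial>lborel) * (\<integral>\<^sup>+x. ennreal (?q 0 x t z) * \<phi>hat0 x \<partial>lborel) * indicator S z \<partial>lborel)"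
    using t by (simp add: entropic_interpolation_def emeasure_density)
  also have "\<dots> = (\<integral>\<^sup>+z. (\<integral>\<^sup>+x. (\<integral>\<^sup>+y. ennreal (?q 0 x t z) * \<phi>hat0 x * (ennreal (?q t z 1 y) * \<phi>1 y) * indicator S z \<partial>lborel) \<partial>lborel) \<partial>lborel)"
  proof (rule nn_integral_cong)
    fix z
    define a where "a y = ennreal (?q t z 1 y) * \<phi>1 y" for y
    define c where "c x = ennreal (?q 0 x t z) * \<phi>hat0 x" for x
    define i :: ennreal where "i = indicator S z"
    have [measurable]: "a \<in> borel_measurable borel" "c \<in> borel_measurable borel"
      unfolding a_def c_def by measurable
    have "(\<integral>\<^sup>+x. (\<integral>\<^sup>+y. c x * a y * i \<partial>lborel) \<partial>lborel) = (\<integral>\<^sup>+x. c x * ((\<integral>\<^sup>+y. a y \<partial>lborel) * i) \<partial>lborel)"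
      by (intro nn_integral_cong) (simp add: nn_integral_cmult nn_integral_multc mult.assoc)
    also have "\<dots> = (\<integral>\<^sup>+x. c x \<partial>lborel) * ((\<integral>\<^sup>+y. a y \<partial>lborel) * i)"
      by (rule nn_integral_multc) measurable
    finally show "(\<integral>\<^sup>+y. ennreal (?q t z 1 y) * \<phi>1 y \<partial>lborel) * (\<integral>\<^sup>+x. ennreal (?q 0 x t z) * \<phi>hat0 x \<partial>lborel) * indicator S z
      = (\<integral>\<^sup>+x. (\<integral>\<^sup>+y. ennreal (?q 0 x t z) * \<phi>hat0 x * (ennreal (?q t z 1 y) * \<phi>1 y) * indicator S z \<partial>lborel) \<partial>lborel)"
      by (simp only: a_def c_def i_def mult_ac)
  qed
  also have "\<dots> = (\<integral>\<^sup>+z. (\<integral>\<^sup>+x. (\<integral>\<^sup>+y. ennreal (?q 0 x 1 y) * \<phi>hat0 x * \<phi>1 y * (ennreal (?b (z - ?m (x, y))) * indicator S z) \<partial>lborel) \<partial>lborel) \<partial>lborel)"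
  proof (intro nn_integral_cong)
    fix z x y
    have swap: "a * h * (b * g) * i = (a * b) * (h * g * i)" for a b h g i :: ennreal by (simp only: mult_ac)
    have eq: "ennreal (?q 0 x t z) * ennreal (?q t z 1 y) = ennreal (?q 0 x 1 y) * ennreal (?b (z - ?m (x, y)))"
      by (simp add: ennreal_mult[symmetric] nn bn transition_density_bridge[OF \<Phi> ctrl t \<epsilon>])
    show "ennreal (?q 0 x t z) * \<phi>hat0 x * (ennreal (?q t z 1 y) * \<phi>1 y) * indicator S z
      = ennreal (?q 0 x 1 y) * \<phi>hat0 x * \<phi>1 y * (ennreal (?b (z - ?m (x, y))) * indicator S z)"
      unfolding swap eq by (simp only: mult_ac)
  qed
  also have "\<dots> = (\<integral>\<^sup>+z. (\<integral>\<^sup>+p. ?d p * (ennreal (?b (z - ?m p)) * indicator S z) \<partial>lborel) \<partial>lborel)"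
    unfolding lborel_prod[symmetric]
    by (intro nn_integral_cong, subst lborel.nn_integral_fst[symmetric]) (auto simp: lborel_prod)
  also have "\<dots> = (\<integral>\<^sup>+p. (\<integral>\<^sup>+z. ?d p * (ennreal (?b (z - ?m p)) * indicator S z) \<partial>lborel) \<partial>lborel)"
    by (rule lborel_pair.Fubini') measurable
  also have "\<dots> = (\<integral>\<^sup>+p. ?d p * (\<integral>\<^sup>+w. indicator S (?m p + w) \<partial>\<nu>) \<partial>lborel)"
  proof (rule nn_integral_cong)
    fix p
    have "(\<integral>\<^sup>+z. ennreal (?b (z - ?m p)) * indicator S z \<partial>lborel)
        = (\<integral>\<^sup>+w. ennreal (?b w) * indicator S (?m p + w) \<partial>lborel)"
      using nn_integral_lborel_translate[of "\<lambda>z. ennreal (?b (z - ?m p)) * indicator S z" "?m p"]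
      by simp
    also have "\<dots> = (\<integral>\<^sup>+w. indicator S (?m p + w) \<partial>\<nu>)"
      unfolding \<nu>_def by (subst nn_integral_density) auto
    finally show "(\<integral>\<^sup>+z. ?d p * (ennreal (?b (z - ?m p)) * indicator S z) \<partial>lborel)
      = ?d p * (\<integral>\<^sup>+w. indicator S (?m p + w) \<partial>\<nu>)"
      by (subst nn_integral_cmult) auto
  qed
  also have "\<dots> = (\<integral>\<^sup>+p. (\<integral>\<^sup>+w. indicator S (?m p + w) \<partial>\<nu>) \<partial>?S)"
    unfolding schrodinger_plan_def case_prod_unfold
    by (subst nn_integral_density) (auto intro!: \<nu>.borel_measurable_nn_integral simp: sets\<nu> cong: measurable_cong_sets)
  also have "\<dots> = (\<integral>\<^sup>+x. indicator S (?h x) \<partial>(?S \<Otimes>\<^sub>M \<nu>))"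
    by (subst \<nu>.nn_integral_fst[symmetric]) (auto simp: setsS sets\<nu> cong: measurable_cong_sets sets_pair_measure_cong)
  also have "\<dots> = emeasure (distr (?S \<Otimes>\<^sub>M \<nu>) borel ?h) S"
  proof -
    have "(\<integral>\<^sup>+x. indicator S x \<partial>distr (?S \<Otimes>\<^sub>M \<nu>) borel ?h) = (\<integral>\<^sup>+x. indicator S (?h x) \<partial>(?S \<Otimes>\<^sub>M \<nu>))"
      by (rule nn_integral_distr[OF h_meas]) measurable
    then show ?thesis by simp
  qed
  finally show "emeasure ?E S = emeasure (distr (?S \<Otimes>\<^sub>M \<nu>) borel ?h) S" .
qed

section \<open>The small-noise limit of Schrodinger bridges\<close>

lemma schrodinger_plan_gibbs:
  "schrodinger_plan \<Phi> B \<epsilon> \<phi>hat0 \<phi>1 = density lborel (\<lambda>(x, y).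
     ennreal (gaussian_const \<epsilon> (gramian \<Phi> B 1 0) * exp (- quadratic_cost (\<Phi> 1 0) (gramian \<Phi> B 1 0) x y / \<epsilon>)) * \<phi>hat0 x * \<phi>1 y)"
  by (simp add: schrodinger_plan_def transition_density_eq_gaussian_kernel gaussian_kernel_def quadratic_cost_def)

lemma transport_cost_eq_integral:
  assumes "pos_def (gramian \<Phi> B 1 0)" and "integrable P (\<lambda>p. quadratic_cost (\<Phi> 1 0) (gramian \<Phi> B 1 0) (fst p) (snd p))"
  shows "transport_cost \<Phi> B P = ennreal (\<integral>p. quadratic_cost (\<Phi> 1 0) (gramian \<Phi> B 1 0) (fst p) (snd p) \<partial>P)"
  unfolding transport_cost_def case_prod_unfold quadratic_cost_def[symmetric]
  using assms by (intro nn_integral_eq_integral) (auto simp: quadratic_cost_nonneg)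

text \<open>
  On the graph of \<open>T\<close> a function of both endpoints is a function of the first one.
\<close>

lemma distr_graph_coupling:
  fixes \<mu> :: "'a::euclidean_space measure" and \<nu> :: "'b::euclidean_space measure"
    and h :: "'a \<Rightarrow> 'c::euclidean_space"
  assumes \<pi>: "coupling \<mu> \<nu> \<pi>" and T: "concentrated_on_graph \<pi> T"
    and g: "g \<in> borel_measurable borel" and h: "h \<in> borel_measurable borel" and eq: "\<And>x. g (x, T x) = h x"
  shows "distr \<pi> borel g = distr \<mu> borel h"
proof -
  note m = coupling_marginals[OF \<pi>]
  have "distr \<pi> borel g = distr \<pi> borel (\<lambda>p. h (fst p))"
  proof (rule distr_cong_AE)
    have "AE p in \<pi>. snd p = T (fst p)" using T by (simp add: concentrated_on_graph_def)
    then show "AE p in \<pi>. g p = h (fst p)" by eventually_elim (metis eq prod.collapse)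
    show "g \<in> \<pi> \<rightarrow>\<^sub>M borel" using g m(6) by (simp cong: measurable_cong_sets)
    show "(\<lambda>p. h (fst p)) \<in> \<pi> \<rightarrow>\<^sub>M borel" by (rule measurable_compose[OF m(1) h])
  qed simp_all
  also have "\<dots> = distr (distr \<pi> borel fst) borel h"
    using m(1) h by (subst distr_distr) (auto simp: comp_def)
  finally show ?thesis by (simp add: m)
qed

theorem theorem3:
  fixes A :: "real \<Rightarrow> real^'n^'n"
    and B :: "real \<Rightarrow> real^'m^'n"
    and \<Phi> :: "real \<Rightarrow> real \<Rightarrow> real^'n^'n"
    and \<rho>0 \<rho>1 :: "real^'n \<Rightarrow> real"
    and \<mu>0 \<mu>1 :: "(real^'n) measure"
    and \<phi>hat0 \<phi>1 :: "real \<Rightarrow> real^'n \<Rightarrow> ennreal"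
    and \<pi> :: "((real^'n) \<times> (real^'n)) measure"
  assumes "continuous_on {0..1} A" and "continuous_on {0..1} B"
    and "state_transition A \<Phi>"
    and "controllable \<Phi> B"
    and "\<rho>0 \<in> borel_measurable borel" and "\<And>x. 0 \<le> \<rho>0 x"
    and "\<mu>0 = density lborel (\<lambda>x. ennreal (\<rho>0 x))" and "prob_space \<mu>0"
    and "integrable \<mu>0 (\<lambda>x. (norm x)\<^sup>2)"
    and "\<rho>1 \<in> borel_measurable borel" and "\<And>x. 0 \<le> \<rho>1 x"
    and "\<mu>1 = density lborel (\<lambda>x. ennreal (\<rho>1 x))" and "prob_space \<mu>1"
    and "integrable \<mu>1 (\<lambda>x. (norm x)\<^sup>2)"
    and "\<And>\<epsilon>. 0 < \<epsilon> \<Longrightarrow> schrodinger_pair \<Phi> B \<epsilon> \<mu>0 \<mu>1 (\<phi>hat0 \<epsilon>) (\<phi>1 \<epsilon>)"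
    and "optimal_plan \<Phi> B \<mu>0 \<mu>1 \<pi>"
  shows "weakly_converges (\<lambda>\<epsilon>. schrodinger_plan \<Phi> B \<epsilon> (\<phi>hat0 \<epsilon>) (\<phi>1 \<epsilon>)) \<pi> (at_right 0) \<and>
    (\<forall>T. concentrated_on_graph \<pi> T \<longrightarrow>
      (\<forall>t\<in>{0..1}. weakly_converges
        (\<lambda>\<epsilon>. entropic_interpolation \<Phi> B \<epsilon> \<mu>0 \<mu>1 (\<phi>hat0 \<epsilon>) (\<phi>1 \<epsilon>) t)
        (displacement_interpolation \<Phi> B \<mu>0 T t) (at_right 0)))"
proof -
  let ?M = "gramian \<Phi> B 1 0" and ?F = "\<Phi> 1 0"
  let ?P = "\<lambda>\<epsilon>. schrodinger_plan \<Phi> B \<epsilon> (\<phi>hat0 \<epsilon>) (\<phi>1 \<epsilon>)"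
  note \<Phi> = \<open>state_transition A \<Phi>\<close> \<open>continuous_on {0..1} A\<close>
  note ctrl = \<open>controllable \<Phi> B\<close>
  note pair = \<open>\<And>\<epsilon>. 0 < \<epsilon> \<Longrightarrow> schrodinger_pair \<Phi> B \<epsilon> \<mu>0 \<mu>1 (\<phi>hat0 \<epsilon>) (\<phi>1 \<epsilon>)\<close>
  note mom = \<open>integrable \<mu>0 (\<lambda>x. (norm x)\<^sup>2)\<close> \<open>integrable \<mu>1 (\<lambda>x. (norm x)\<^sup>2)\<close>
  have sets\<mu>: "sets \<mu>0 = sets borel" using \<open>\<mu>0 = _\<close> by simp
  have M: "pos_def ?M" by (rule gramian_pos_def[OF ctrl]) auto
  have inverse: "\<Phi> 1 0 ** \<Phi> 0 1 = mat 1" "\<Phi> 0 1 ** \<Phi> 1 0 = mat 1"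
    by (rule state_transition_inverse[OF \<Phi>]; simp)+
  then have F: "invertible ?F" unfolding invertible_def by blast
  have M_inv: "?M ** matrix_inv ?M = mat 1" by (rule matrix_inv_right[OF pos_def_invertible[OF M]])
  have ac: "emeasure \<mu>0 N = 0" if "N \<in> null_sets lborel" for N
  proof -
    have "absolutely_continuous lborel \<mu>0"
      unfolding \<open>\<mu>0 = _\<close> using \<open>\<rho>0 \<in> borel_measurable borel\<close> by (intro absolutely_continuousI_density) simp
    then show ?thesis using that unfolding absolutely_continuous_def by auto
  qed
  have coup: "coupling \<mu>0 \<mu>1 (?P \<epsilon>)" if "0 < \<epsilon>" for \<epsilon>
    using pair[OF that] by (simp add: schrodinger_pair_def)
  have coup\<pi>: "coupling \<mu>0 \<mu>1 \<pi>" using \<open>optimal_plan \<Phi> B \<mu>0 \<mu>1 \<pi>\<close> by (simp add: optimal_plan_def)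
  have opt: "(\<integral>p. quadratic_cost ?F ?M (fst p) (snd p) \<partial>\<pi>) \<le> (\<integral>p. quadratic_cost ?F ?M (fst p) (snd p) \<partial>R)"
    if R: "coupling \<mu>0 \<mu>1 R" for R
  proof -
    note int = coupling_quadratic_cost_integrable[OF _ mom, of _ ?F ?M]
    have "transport_cost \<Phi> B \<pi> \<le> transport_cost \<Phi> B R"
      using \<open>optimal_plan \<Phi> B \<mu>0 \<mu>1 \<pi>\<close> R by (simp add: optimal_plan_def)
    then show ?thesis
      unfolding transport_cost_eq_integral[OF M int[OF R]] transport_cost_eq_integral[OF M int[OF coup\<pi>]]
      by (simp add: integral_nonneg_AE quadratic_cost_nonneg[OF M])
  qed
  have plans: "weakly_converges (\<lambda>k. ?P (X k)) \<pi> sequentially" if X: "\<And>k. 0 < X k" "X \<longlonglongrightarrow> 0" for X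
    by (rule gibbs_couplings_converge_to_optimal[OF M F mom ac schrodinger_plan_gibbs _ _ gaussian_const_pos[OF M X(1)] X(1) X(2) coup[OF X(1)] coup\<pi> opt])
      (use pair[OF X(1)] in \<open>auto simp: schrodinger_pair_def\<close>)
  have "weakly_converges (\<lambda>\<epsilon>. entropic_interpolation \<Phi> B \<epsilon> \<mu>0 \<mu>1 (\<phi>hat0 \<epsilon>) (\<phi>1 \<epsilon>) t)
      (displacement_interpolation \<Phi> B \<mu>0 T t) (at_right 0)"
    if T: "concentrated_on_graph \<pi> T" and t: "t \<in> {0..1}" for T t
  proof -
    have T_meas [measurable]: "T \<in> borel_measurable borel" using T by (simp add: concentrated_on_graph_def)
    have zero: "(0 :: real^'n^'n) ** N = 0" "N ** (0 :: real^'n^'n) = 0" for N :: "real^'n^'n"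
      by (rule bounded_bilinear.zero_left[OF bounded_bilinear_matrix_mult] bounded_bilinear.zero_right[OF bounded_bilinear_matrix_mult])+
    consider "t = 0" | "t = 1" | "0 < t" "t < 1" using t by fastforce
    then show ?thesis
    proof cases
      case 1
      have "\<Phi> 0 1 ** ?M ** matrix_inv ?M ** \<Phi> 1 0 = \<Phi> 0 1 ** (?M ** matrix_inv ?M) ** \<Phi> 1 0"
        by (simp add: matrix_mul_assoc)
      then have "interpolation_map \<Phi> B T 0 = (\<lambda>x. x)"
        by (simp add: interpolation_map_def fun_eq_iff M_inv inverse zero)
      then show ?thesis
        using 1 sets\<mu> by (simp add: weakly_converges_def entropic_interpolation_def displacement_interpolation_def distr_id2)
    next
      case 2
      have "\<Phi> 1 1 = mat 1" using \<Phi>(1) by (simp add: state_transition_def)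
      then have "interpolation_map \<Phi> B T 1 = T"
        by (simp add: interpolation_map_def fun_eq_iff M_inv zero)
      moreover have "distr \<pi> borel snd = distr \<mu>0 borel T"
        by (rule distr_graph_coupling[OF coup\<pi> T]) (auto intro!: borel_measurable_continuous_onI continuous_intros)
      ultimately show ?thesis
        using 2 coupling_marginals(4)[OF coup\<pi>]
        by (simp add: weakly_converges_def entropic_interpolation_def displacement_interpolation_def)
    next
      case 3
      let ?b = "\<lambda>\<epsilon>. bridge_kernel \<epsilon> (gramian \<Phi> B t 0) (gramian \<Phi> B 1 t) (\<Phi> 1 t)"
      let ?\<nu> = "\<lambda>\<epsilon>. density lborel (\<lambda>w. ennreal (?b \<epsilon> w))"
      have pd: "pos_def (gramian \<Phi> B t 0)" "pos_def (gramian \<Phi> B 1 t)"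
        "pos_def (\<Phi> 1 t ** gramian \<Phi> B t 0 ** transpose (\<Phi> 1 t) + gramian \<Phi> B 1 t)"
        using 3 M gramian_split[OF \<Phi> ctrl 3] by (auto intro!: gramian_pos_def[OF ctrl])
      have "displacement_interpolation \<Phi> B \<mu>0 T t = distr \<pi> borel (bridge_mean \<Phi> B t)"
        unfolding displacement_interpolation_def
      proof (rule distr_graph_coupling[OF coup\<pi> T, symmetric])
        show "bridge_mean \<Phi> B t \<in> borel_measurable borel"
          by (rule borel_measurable_continuous_onI[OF bridge_mean_continuous])
        show "interpolation_map \<Phi> B T t \<in> borel_measurable borel"
          unfolding interpolation_map_def[abs_def] by measurable
        show "bridge_mean \<Phi> B t (x, T x) = interpolation_map \<Phi> B T t x" for x
          by (rule interpolation_map_eq_bridge_mean[OF \<Phi> ctrl 3, symmetric])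
      qed
      moreover have "weakly_converges (\<lambda>\<epsilon>. entropic_interpolation \<Phi> B \<epsilon> \<mu>0 \<mu>1 (\<phi>hat0 \<epsilon>) (\<phi>1 \<epsilon>) t)
          (distr \<pi> borel (bridge_mean \<Phi> B t)) (at_right 0)"
      proof (rule weakly_converges_at_right_0I)
        fix X :: "nat \<Rightarrow> real" assume X: "\<And>k. 0 < X k" "X \<longlonglongrightarrow> 0"
        have \<nu>: "prob_space (?\<nu> (X k))" for k
          by (rule prob_spaceI) (simp add: emeasure_density nn_integral_bridge_kernel[OF pd X(1)])
        have "weakly_converges (\<lambda>k. distr (?P (X k) \<Otimes>\<^sub>M ?\<nu> (X k)) borel (\<lambda>(p, w). bridge_mean \<Phi> B t p + w))
            (distr \<pi> borel (bridge_mean \<Phi> B t)) sequentially"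
          by (rule weakly_converges_add_vanishing_noise[OF coupling_marginals(5,6)[OF coup[OF X(1)]]
                coupling_marginals(5,6)[OF coup\<pi>] plans[OF X] \<nu> _ bridge_kernel_concentrates[OF pd X] bridge_mean_continuous]) simp_all
        then show "weakly_converges (\<lambda>k. entropic_interpolation \<Phi> B (X k) \<mu>0 \<mu>1 (\<phi>hat0 (X k)) (\<phi>1 (X k)) t)
            (distr \<pi> borel (bridge_mean \<Phi> B t)) sequentially"
          by (simp add: entropic_interpolation_eq_noisy_bridge[OF \<Phi> ctrl 3 X(1) pair[OF X(1)]])
      qed
      ultimately show ?thesis by simp
    qed
  qed
  moreover have "weakly_converges ?P \<pi> (at_right 0)"
    by (rule weakly_converges_at_right_0I) (rule plans)
  ultimately show ?thesis by blast
qed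

end
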